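(* Let $f$ be a nonconstant analytic function on an open connected subset $\Omega$ of $\mathbb{C}$. Let $a<b$ be values attained by $|f|$ such that $D:=\{z\in\Omega:|f(z)|\in[a,b]\}$ is compact. For $t\in[a,b]$ let $L(t)$ be the length of $\{z\in\Omega:|f(z)|=t\}$, and let $\kappa$ be the signed curvature of the level curves of $|f|$ (see context). Then: (a) the area of $D$ equals $\displaystyle\int_a^b\left(\int_{\{z:|f(z)|=t\}}\frac{1}{|f'(z)|}\,|dz|\right)dt$; (b) $\displaystyle\int_a^b L(t)\,dt=\iint_D|f'|\,dA$; (c) $\displaystyle L(b)=L(a)+\iint_D\kappa\,dA$.
   Context: The level-$t$ set of $f$ means the level-$t$ set of $|f|$. The critical points of $|f|^2$ are the zeros of $f$ and of $f'$; all other points are called regular points. A level set is regular if it contains no zero of $f$ or of $f'$. $L(t)$ is the total length of the level-$t$ set, defined also when that level is critical (a level-$0$ set consists of isolated points and has length $0$). Signed curvature: at each regular point let $\mathbf{N}=-\nabla|f|/|\nabla|f||$ and let $\mathbf{T}$ be the unit tangent to the level curve of $|f|$ such that $(\mathbf{T},\mathbf{N})$ is a positively oriented frame of $\mathbb{R}^2\cong\mathbb{C}$. Then $\kappa$ is defined by $d\mathbf{T}/ds=\kappa\mathbf{N}$, where $s$ is arc length with positive direction induced by $\mathbf{T}$. In (a), the inner line integral is only defined for those $t$ for which the level-$t$ set is regular (all but finitely many $t\in[a,b]$), and the outer integral is an improper Riemann integral if necessary. In (c), $\iint_D\kappa\,dA$ is a proper Riemann integral if $D$ contains no zero of $f$ or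 $f'$, and otherwise an improper Riemann integral: the limit of integrals over an expanding sequence of Jordan measurable closed subsets avoiding the finitely many critical points and exhausting the rest, required to exist and to be independent of the sequence. *)

theory Defs
  imports "HOL-Complex_Analysis.Complex_Analysis"
begin

text \<open>
  The length of a plane set is its one-dimensional Hausdorff measure. It is defined for every
  Borel set, so it covers critical level sets as well, and integration against it
  is the line integral with respect to arc length.
\<close>

definition hausdorff1_pre :: "real \<Rightarrow> complex set \<Rightarrow> ennreal" where
  "hausdorff1_pre \<delta> S =
     (INF A \<in> {A :: nat \<Rightarrow> complex set.
                 S \<subseteq> (\<Union>n. A n) \<and> (\<forall>n. bounded (A n) \<and> diameter (A n) \<le> \<delta>)}.
        \<Sum>n. ennreal (diameter (A n)))"

definition hausdorff1_outer :: "complex set \<Rightarrow> ennreal" where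
  "hausdorff1_outer S = (SUP \<delta> \<in> {0<..}. hausdorff1_pre \<delta> S)"

definition arc_length :: "complex measure" where
  "arc_length = measure_of UNIV (sets borel) hausdorff1_outer"

lemma hausdorff1_pre_le:
  assumes "S \<subseteq> (\<Union>n. A n)" "\<And>n. bounded (A n)" "\<And>n. diameter (A n) \<le> \<delta>"
  shows "hausdorff1_pre \<delta> S \<le> (\<Sum>n. ennreal (diameter (A n)))"
  unfolding hausdorff1_pre_def using assms by (intro INF_lower) auto

lemma hausdorff1_pre_greatest:
  assumes "\<And>A. S \<subseteq> (\<Union>n. A n) \<Longrightarrow> (\<And>n. bounded (A n)) \<Longrightarrow> (\<And>n. diameter (A n) \<le> \<delta>)
             \<Longrightarrow> c \<le> (\<Sum>n. ennreal (diameter (A n)))"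
  shows "c \<le> hausdorff1_pre \<delta> S"
  unfolding hausdorff1_pre_def using assms by (intro INF_greatest) auto

lemma hausdorff1_pre_mono: "S \<subseteq> T \<Longrightarrow> hausdorff1_pre \<delta> S \<le> hausdorff1_pre \<delta> T"
  by (rule hausdorff1_pre_greatest, rule hausdorff1_pre_le) auto

lemma hausdorff1_pre_antimono: "\<delta> \<le> \<delta>' \<Longrightarrow> hausdorff1_pre \<delta>' S \<le> hausdorff1_pre \<delta> S"
  by (rule hausdorff1_pre_greatest, rule hausdorff1_pre_le) (auto intro: order_trans)

lemma hausdorff1_pre_le_outer: "0 < \<delta> \<Longrightarrow> hausdorff1_pre \<delta> S \<le> hausdorff1_outer S"
  unfolding hausdorff1_outer_def by (intro SUP_upper) auto

lemma hausdorff1_outer_mono: "S \<subseteq> T \<Longrightarrow> hausdorff1_outer S \<le> hausdorff1_outer T"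
  unfolding hausdorff1_outer_def by (intro SUP_mono) (auto intro: hausdorff1_pre_mono)

lemma hausdorff1_outer_empty [simp]: "hausdorff1_outer {} = 0"
proof -
  have "hausdorff1_pre \<delta> {} = 0" if "0 < \<delta>" for \<delta>
    using hausdorff1_pre_le[of "{}" "\<lambda>_. {}" \<delta>] that by simp
  then show ?thesis
    unfolding hausdorff1_outer_def by (auto intro!: antisym SUP_least)
qed

lemma hausdorff1_pre_subadditive:
  "hausdorff1_pre \<delta> (\<Union>i. B i) \<le> (\<Sum>i. hausdorff1_pre \<delta> (B i))" for B :: "nat \<Rightarrow> complex set"
proof (rule ennreal_le_epsilon)
  fix e :: real
  assume fin: "(\<Sum>i. hausdorff1_pre \<delta> (B i)) < top" and e: "0 < e"
  have finB: "hausdorff1_pre \<delta> (B i) < top" for i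
    by (metis ennreal_suminf_lessD fin)
  have "\<exists>A. B i \<subseteq> (\<Union>n. A n) \<and> (\<forall>n. bounded (A n)) \<and> (\<forall>n. diameter (A n) \<le> \<delta>) \<and>
            (\<Sum>n. ennreal (diameter (A n))) \<le> hausdorff1_pre \<delta> (B i) + ennreal (e * (1/2) ^ Suc i)"
    for i
  proof -
    have "0 < ennreal (e * (1/2) ^ Suc i)"
      using e by (simp only: ennreal_less_zero_iff) simp
    then have "hausdorff1_pre \<delta> (B i) < hausdorff1_pre \<delta> (B i) + ennreal (e * (1/2) ^ Suc i)"
      using ennreal_add_left_cancel_less[of "hausdorff1_pre \<delta> (B i)" 0] finB[of i]
      by (metis add.right_neutral infinity_ennreal_def less_irrefl)
    then show ?thesis
      unfolding hausdorff1_pre_def[of \<delta> "B i"] INF_less_iff by (auto intro: less_imp_le)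
  qed
  then obtain A where A: "\<And>i. B i \<subseteq> (\<Union>n. A i n)" "\<And>i n. bounded (A i n)"
      "\<And>i n. diameter (A i n) \<le> \<delta>"
      "\<And>i. (\<Sum>n. ennreal (diameter (A i n))) \<le> hausdorff1_pre \<delta> (B i) + ennreal (e * (1/2) ^ Suc i)"
    by metis
  define C where "C = (\<lambda>m. case prod_decode m of (i, n) \<Rightarrow> A i n)"
  have "hausdorff1_pre \<delta> (\<Union>i. B i) \<le> (\<Sum>m. ennreal (diameter (C m)))"
  proof (rule hausdorff1_pre_le)
    show "(\<Union>i. B i) \<subseteq> (\<Union>m. C m)"
    proof clarify
      fix x i assume "x \<in> B i"
      then obtain n where "x \<in> A i n" using A(1) by blast
      then have "x \<in> C (prod_encode (i, n))" by (simp add: C_def)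
      then show "x \<in> (\<Union>m. C m)" by blast
    qed
  qed (auto simp: C_def A split: prod.split)
  also have "\<dots> = (\<Sum>i. \<Sum>n. ennreal (diameter (A i n)))"
  proof -
    have "(\<Sum>m. (\<lambda>(i, n). ennreal (diameter (A i n))) (prod_decode m))
          = (\<Sum>i. \<Sum>n. ennreal (diameter (A i n)))"
      by (rule suminf_ennreal_2dimen) simp
    then show ?thesis by (simp add: C_def case_prod_unfold)
  qed
  also have "\<dots> \<le> (\<Sum>i. hausdorff1_pre \<delta> (B i) + ennreal (e * (1/2) ^ Suc i))"
    by (intro suminf_le A(4) summableI)
  also have "\<dots> = (\<Sum>i. hausdorff1_pre \<delta> (B i)) + (\<Sum>i. ennreal (e * (1/2) ^ Suc i))"
    by (rule suminf_add[symmetric]) (rule summableI)+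
  also have "(\<Sum>i. ennreal (e * (1/2) ^ Suc i)) = ennreal e"
    using e sums_mult[OF power_half_series, of e] by (intro sums_unique[symmetric]) simp
  finally show "hausdorff1_pre \<delta> (\<Union>i. B i) \<le> (\<Sum>i. hausdorff1_pre \<delta> (B i)) + ennreal e" .
qed

lemma hausdorff1_outer_subadditive:
  "hausdorff1_outer (\<Union>i. B i) \<le> (\<Sum>i. hausdorff1_outer (B i))" for B :: "nat \<Rightarrow> complex set"
proof -
  have "hausdorff1_pre \<delta> (\<Union>i. B i) \<le> (\<Sum>i. hausdorff1_outer (B i))" if "0 < \<delta>" for \<delta>
    using that
    by (intro order_trans[OF hausdorff1_pre_subadditive] suminf_le summableI hausdorff1_pre_le_outer)
  then show ?thesis
    unfolding hausdorff1_outer_def[of "\<Union>i. B i"] by (auto intro: SUP_least)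
qed

lemma hausdorff1_outer_subadditive2:
  "hausdorff1_outer (A \<union> B) \<le> hausdorff1_outer A + hausdorff1_outer B"
proof -
  have "(\<Sum>i. hausdorff1_outer (binaryset A B i)) = hausdorff1_outer A + hausdorff1_outer B"
    by (subst suminf_finite[of "{0, 1}"]) (auto simp: binaryset_def)
  then show ?thesis
    using hausdorff1_outer_subadditive[of "binaryset A B"] by (simp add: UN_binaryset_eq)
qed

lemma hausdorff1_outer_separated:
  assumes d: "0 < d" and sep: "\<And>x y. x \<in> A \<Longrightarrow> y \<in> B \<Longrightarrow> d \<le> dist x y"
  shows "hausdorff1_outer A + hausdorff1_outer B \<le> hausdorff1_outer (A \<union> B)"
proof -
  have *: "hausdorff1_pre \<delta> A + hausdorff1_pre \<delta> B \<le> hausdorff1_pre \<delta> (A \<union> B)" if \<delta>: "\<delta> < d" for \<delta>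
  proof (rule hausdorff1_pre_greatest)
    fix C :: "nat \<Rightarrow> complex set"
    assume C: "A \<union> B \<subseteq> (\<Union>n. C n)" "\<And>n. bounded (C n)" "\<And>n. diameter (C n) \<le> \<delta>"
    define CA where "CA = (\<lambda>n. if C n \<inter> A = {} then {} else C n)"
    define CB where "CB = (\<lambda>n. if C n \<inter> B = {} then {} else C n)"
    have d0: "0 \<le> \<delta>"
      using diameter_ge_0[OF C(2)[of 0]] C(3)[of 0] by linarith
    have "hausdorff1_pre \<delta> A \<le> (\<Sum>n. ennreal (diameter (CA n)))"
    proof (rule hausdorff1_pre_le)
      show "A \<subseteq> (\<Union>n. CA n)"
      proof
        fix x assume "x \<in> A"
        then obtain n where "x \<in> C n" using C(1) by blast
        then have "x \<in> CA n" using \<open>x \<in> A\<close> by (auto simp: CA_def)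
        then show "x \<in> (\<Union>n. CA n)" by blast
      qed
    qed (use C d0 in \<open>auto simp: CA_def\<close>)
    moreover have "hausdorff1_pre \<delta> B \<le> (\<Sum>n. ennreal (diameter (CB n)))"
    proof (rule hausdorff1_pre_le)
      show "B \<subseteq> (\<Union>n. CB n)"
      proof
        fix x assume "x \<in> B"
        then obtain n where "x \<in> C n" using C(1) by blast
        then have "x \<in> CB n" using \<open>x \<in> B\<close> by (auto simp: CB_def)
        then show "x \<in> (\<Union>n. CB n)" by blast
      qed
    qed (use C d0 in \<open>auto simp: CB_def\<close>)
    ultimately have "hausdorff1_pre \<delta> A + hausdorff1_pre \<delta> B
        \<le> (\<Sum>n. ennreal (diameter (CA n))) + (\<Sum>n. ennreal (diameter (CB n)))"
      by (rule add_mono)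
    also have "\<dots> = (\<Sum>n. ennreal (diameter (CA n)) + ennreal (diameter (CB n)))"
      by (rule suminf_add) (rule summableI)+
    also have "\<dots> \<le> (\<Sum>n. ennreal (diameter (C n)))"
    proof (rule suminf_le)
      fix n
      have "C n \<inter> A = {} \<or> C n \<inter> B = {}"
      proof (rule ccontr)
        assume "\<not> ?thesis"
        then obtain x y where "x \<in> C n" "x \<in> A" "y \<in> C n" "y \<in> B" by blast
        then show False
          using sep[of x y] diameter_bounded_bound[OF C(2)[of n], of x y] C(3)[of n] \<delta> by force
      qed
      then show "ennreal (diameter (CA n)) + ennreal (diameter (CB n)) \<le> ennreal (diameter (C n))"
        by (auto simp: CA_def CB_def)
    qed (rule summableI)+
    finally show "hausdorff1_pre \<delta> A + hausdorff1_pre \<delta> B \<le> (\<Sum>n. ennreal (diameter (C n)))" .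
  qed
  have le: "hausdorff1_pre \<delta> A + hausdorff1_pre \<delta>' B \<le> hausdorff1_outer (A \<union> B)"
    if "0 < \<delta>" "0 < \<delta>'" for \<delta> \<delta>'
  proof -
    define e where "e = min (min \<delta> \<delta>') (d / 2)"
    have e: "0 < e" "e \<le> \<delta>" "e \<le> \<delta>'" "e < d" using that d by (auto simp: e_def)
    have "hausdorff1_pre \<delta> A + hausdorff1_pre \<delta>' B \<le> hausdorff1_pre e A + hausdorff1_pre e B"
      using e by (intro add_mono hausdorff1_pre_antimono)
    also have "\<dots> \<le> hausdorff1_pre e (A \<union> B)" using * e by blast
    also have "\<dots> \<le> hausdorff1_outer (A \<union> B)" using e by (intro hausdorff1_pre_le_outer)
    finally show ?thesis .
  qed
  have ne: "{0::real<..} \<noteq> {}" by (simp add: greaterThan_non_empty)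
  have "hausdorff1_pre \<delta> A + hausdorff1_outer B \<le> hausdorff1_outer (A \<union> B)" if "0 < \<delta>" for \<delta>
    unfolding hausdorff1_outer_def[of B] using le[OF that]
    by (subst ennreal_SUP_add_right[OF ne]) (auto intro!: SUP_least)
  then show ?thesis
    unfolding hausdorff1_outer_def[of A]
    by (subst ennreal_SUP_add_left[symmetric, OF ne]) (auto intro!: SUP_least)
qed

lemma hausdorff1_outer_closed:
  assumes F: "closed F" "F \<noteq> {}"
  shows "hausdorff1_outer (X \<inter> F) + hausdorff1_outer (X - F) \<le> hausdorff1_outer X"
proof (cases "hausdorff1_outer X = top")
  case False
  define Y where "Y = (\<lambda>n::nat. {x \<in> X. 1 / real (n + 1) < infdist x F})"
  define R where
    "R = (\<lambda>k::nat. {x \<in> X. 1 / real (k + 2) < infdist x F \<and> infdist x F \<le> 1 / real (k + 1)})"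
  have sep: "hausdorff1_outer A + hausdorff1_outer B \<le> hausdorff1_outer (A \<union> B)"
    if "u < v" "\<And>x. x \<in> A \<Longrightarrow> v \<le> infdist x F" "\<And>x. x \<in> B \<Longrightarrow> infdist x F \<le> u" for u v A B
  proof (rule hausdorff1_outer_separated[of "v - u"])
    fix x y assume "x \<in> A" "y \<in> B"
    then show "v - u \<le> dist x y"
      using that(2)[of x] that(3)[of y] infdist_triangle[of x F y] by (simp add: dist_commute)
  qed (use that in simp)
  have shells: "(\<Sum>k<n. hausdorff1_outer (R (2 * k + c))) \<le> hausdorff1_outer (\<Union>k<n. R (2 * k + c))"
    for n c
  proof (induction n)
    case (Suc n)
    have "(\<Sum>k<Suc n. hausdorff1_outer (R (2 * k + c)))
        \<le> hausdorff1_outer (\<Union>k<n. R (2 * k + c)) + hausdorff1_outer (R (2 * n + c))"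
      using Suc by (simp add: add_mono)
    also have "\<dots> \<le> hausdorff1_outer ((\<Union>k<n. R (2 * k + c)) \<union> R (2 * n + c))"
    proof (cases "n = 0")
      case False
      show ?thesis
      proof (rule sep[of "1 / real (2 * n + c + 1)" "1 / real (2 * n + c)"])
        show "1 / real (2 * n + c + 1) < 1 / real (2 * n + c)"
          using False by (intro divide_strict_left_mono) auto
      next
        fix x assume "x \<in> (\<Union>k<n. R (2 * k + c))"
        then obtain k where k: "k < n" "1 / real (2 * k + c + 2) < infdist x F"
          by (auto simp: R_def)
        have "1 / real (2 * n + c) \<le> 1 / real (2 * k + c + 2)"
          using k by (intro divide_left_mono) auto
        with k show "1 / real (2 * n + c) \<le> infdist x F" by linarith
      qed (auto simp: R_def)
    qed auto
    also have "(\<Union>k<n. R (2 * k + c)) \<union> R (2 * n + c) = (\<Union>k<Suc n. R (2 * k + c))"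
      by (auto simp: lessThan_Suc)
    finally show ?case .
  qed auto
  have shells': "(\<Sum>k<n. hausdorff1_outer (R (2 * k + c))) \<le> hausdorff1_outer X" for n c
    by (rule order_trans[OF shells hausdorff1_outer_mono]) (auto simp: R_def)
  define S where "S = (\<Sum>k. hausdorff1_outer (R k))"
  have part: "(\<Sum>k<n. hausdorff1_outer (R k)) \<le> hausdorff1_outer X + hausdorff1_outer X" for n
  proof -
    have "(\<Sum>k<n. hausdorff1_outer (R k)) \<le> (\<Sum>k<2 * n. hausdorff1_outer (R k))"
      by (intro sum_mono2) auto
    also have "\<dots> = (\<Sum>k<n. hausdorff1_outer (R (2 * k + 0))) + (\<Sum>k<n. hausdorff1_outer (R (2 * k + 1)))"
      by (induction n) (auto simp: algebra_simps)
    also have "\<dots> \<le> hausdorff1_outer X + hausdorff1_outer X"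
      by (intro add_mono shells')
    finally show ?thesis .
  qed
  have "S \<le> hausdorff1_outer X + hausdorff1_outer X"
    unfolding S_def by (rule suminf_le_const[OF summableI part])
  with False have S: "S < top"
    by (metis ennreal_add_eq_top less_top top_unique)
  have bound: "hausdorff1_outer (X \<inter> F) + hausdorff1_outer (X - F) + (\<Sum>k<n. hausdorff1_outer (R k))
      \<le> hausdorff1_outer X + S" for n
  proof -
    have "X - F \<subseteq> Y n \<union> (\<Union>k. R (k + n))"
    proof
      fix x assume x: "x \<in> X - F"
      then have pos: "0 < infdist x F"
        using F by (metis DiffE in_closed_iff_infdist_zero infdist_nonneg less_eq_real_def)
      show "x \<in> Y n \<union> (\<Union>k. R (k + n))"
      proof (cases "x \<in> Y n")
        case nY: False
        obtain m where m: "1 / real (Suc m) < infdist x F"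
          using pos by (metis inverse_eq_divide reals_Archimedean)
        define P where "P = (\<lambda>j. 1 / real (j + 1) < infdist x F)"
        define j where "j = (LEAST j. P j)"
        have Pj: "P j" unfolding j_def by (rule LeastI[of _ m]) (use m in \<open>simp add: P_def add.commute\<close>)
        have nlt: "\<not> P i" if "i < j" for i using that unfolding j_def by (rule not_less_Least)
        have nPn: "infdist x F \<le> 1 / real (n + 1)" using nY x by (auto simp: Y_def)
        have jn: "n < j"
        proof (rule ccontr)
          assume "\<not> n < j"
          then have "1 / real (n + 1) \<le> 1 / real (j + 1)" by (intro divide_left_mono) auto
          with Pj nPn show False by (simp add: P_def)
        qed
        then obtain k where k: "j = Suc (k + n)"
          by (metis add.commute less_imp_Suc_add)
        have "\<not> P (k + n)" using nlt k by simp
        with Pj k x have "x \<in> R (k + n)" by (auto simp: R_def P_def algebra_simps)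
        then show ?thesis by blast
      qed simp
    qed
    then have "hausdorff1_outer (X - F) \<le> hausdorff1_outer (Y n \<union> (\<Union>k. R (k + n)))"
      by (rule hausdorff1_outer_mono)
    also have "\<dots> \<le> hausdorff1_outer (Y n) + hausdorff1_outer (\<Union>k. R (k + n))"
      by (rule hausdorff1_outer_subadditive2)
    also have "\<dots> \<le> hausdorff1_outer (Y n) + (\<Sum>k. hausdorff1_outer (R (k + n)))"
      by (intro add_left_mono hausdorff1_outer_subadditive)
    finally have le: "hausdorff1_outer (X - F)
        \<le> hausdorff1_outer (Y n) + (\<Sum>k. hausdorff1_outer (R (k + n)))" .
    from le have "hausdorff1_outer (X \<inter> F) + hausdorff1_outer (X - F) + (\<Sum>k<n. hausdorff1_outer (R k))
        \<le> hausdorff1_outer (X \<inter> F) + (hausdorff1_outer (Y n) + (\<Sum>k. hausdorff1_outer (R (k + n))))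
           + (\<Sum>k<n. hausdorff1_outer (R k))"
      by (intro add_mono order_refl)
    also have "\<dots> = (hausdorff1_outer (Y n) + hausdorff1_outer (X \<inter> F)) + S"
      unfolding S_def by (subst suminf_offset[of "\<lambda>k. hausdorff1_outer (R k)" n]) (auto simp: ac_simps)
    also have "hausdorff1_outer (Y n) + hausdorff1_outer (X \<inter> F) \<le> hausdorff1_outer (Y n \<union> X \<inter> F)"
      by (rule sep[of 0 "1 / real (n + 1)"]) (auto simp: Y_def)
    also have "\<dots> \<le> hausdorff1_outer X"
      by (rule hausdorff1_outer_mono) (auto simp: Y_def)
    finally show ?thesis by (simp add: add_mono)
  qed
  have lim: "(\<lambda>n. \<Sum>k<n. hausdorff1_outer (R k)) \<longlonglongrightarrow> S"
    unfolding S_def by (rule summable_LIMSEQ) (rule summableI)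
  have "hausdorff1_outer (X \<inter> F) + hausdorff1_outer (X - F) + S \<le> hausdorff1_outer X + S"
    by (rule LIMSEQ_le_const2[OF tendsto_add[OF tendsto_const lim]]) (use bound in blast)
  then show ?thesis
    using S by (auto simp: ennreal_add_left_cancel_le add.commute[of _ S])
qed simp

lemma measure_space_hausdorff1: "measure_space UNIV (sets borel) hausdorff1_outer"
proof -
  interpret P: sigma_algebra UNIV "Pow (UNIV :: complex set)"
    by (rule sigma_algebra_Pow)
  have pos: "positive (Pow UNIV) hausdorff1_outer"
    by (simp add: positive_def)
  have oms: "outer_measure_space (Pow UNIV) hausdorff1_outer"
    unfolding outer_measure_space_def
    by (intro conjI pos) (auto simp: increasing_def countably_subadditive_def hausdorff1_outer_mono
        intro: hausdorff1_outer_subadditive)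
  let ?L = "lambda_system UNIV (Pow UNIV) hausdorff1_outer"
  have L: "measure_space UNIV ?L hausdorff1_outer"
    by (rule P.caratheodory_lemma[OF oms])
  have closed: "F \<in> ?L" if "closed F" for F
  proof (cases "F = {}")
    case False
    have "hausdorff1_outer (X \<inter> F) + hausdorff1_outer (X - F) = hausdorff1_outer X" for X
    proof (rule antisym[OF hausdorff1_outer_closed[OF that False]])
      have "X \<inter> F \<union> (X - F) = X" by blast
      then show "hausdorff1_outer X \<le> hausdorff1_outer (X \<inter> F) + hausdorff1_outer (X - F)"
        using hausdorff1_outer_subadditive2[of "X \<inter> F" "X - F"] by simp
    qed
    then show ?thesis unfolding P.lambda_system_eq by simp
  qed (use P.lambda_system_empty[OF pos] in blast)
  have sL: "sigma_algebra UNIV ?L" using L by (simp add: measure_space_def)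
  have "sets (borel :: complex measure) \<subseteq> ?L"
    unfolding borel_eq_closed
    by (subst sets_measure_of, simp)
      (intro sigma_algebra.sigma_sets_subset[OF sL], use closed in blast)
  moreover have "sigma_algebra UNIV (sets (borel :: complex measure))"
    using sets.sigma_algebra_axioms[of "borel :: complex measure"] by simp
  moreover have "positive (sets borel) hausdorff1_outer"
    by (simp add: positive_def)
  moreover have "countably_additive (sets borel) hausdorff1_outer"
    if "sets (borel :: complex measure) \<subseteq> ?L"
  proof (rule countably_additiveI)
    fix A :: "nat \<Rightarrow> complex set"
    assume A: "range A \<subseteq> sets borel" "disjoint_family A" "(\<Union>i. A i) \<in> sets borel"
    have "countably_additive ?L hausdorff1_outer" using L by (simp add: measure_space_def)
    then show "(\<Sum>i. hausdorff1_outer (A i)) = hausdorff1_outer (\<Union>i. A i)"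
      unfolding countably_additive_def using A that by blast
  qed
  ultimately show ?thesis
    unfolding measure_space_def by blast
qed

lemma space_arc_length [simp]: "space arc_length = UNIV"
  unfolding arc_length_def by (rule space_measure_of) simp

lemma sets_arc_length [simp, measurable_cong]: "sets arc_length = sets borel"
proof -
  have "sets arc_length = sigma_sets UNIV (sets borel)"
    unfolding arc_length_def by (rule sets_measure_of) simp
  then show ?thesis
    using sets.sigma_sets_eq[of "borel :: complex measure"] by simp
qed

lemma emeasure_arc_length:
  assumes "S \<in> sets borel"
  shows "emeasure arc_length S = hausdorff1_outer S"
proof -
  have "sigma_algebra UNIV (sets (borel :: complex measure))"
       "positive (sets borel) hausdorff1_outer" "countably_additive (sets borel) hausdorff1_outer"
    using measure_space_hausdorff1 unfolding measure_space_def by blast+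
  then show ?thesis
    unfolding arc_length_def using assms by (rule emeasure_measure_of_sigma)
qed

definition level_set :: "(complex \<Rightarrow> complex) \<Rightarrow> complex set \<Rightarrow> real \<Rightarrow> complex set" where
  "level_set f \<Omega> t = {z \<in> \<Omega>. norm (f z) = t}"

definition level_band :: "(complex \<Rightarrow> complex) \<Rightarrow> complex set \<Rightarrow> real \<Rightarrow> real \<Rightarrow> complex set" where
  "level_band f \<Omega> a b = {z \<in> \<Omega>. norm (f z) \<in> {a..b}}"

definition critical_points :: "(complex \<Rightarrow> complex) \<Rightarrow> complex set \<Rightarrow> complex set" where
  "critical_points f \<Omega> = {z \<in> \<Omega>. f z = 0 \<or> deriv f z = 0}"

definition regular_level :: "(complex \<Rightarrow> complex) \<Rightarrow> complex set \<Rightarrow> real \<Rightarrow> bool" where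
  "regular_level f \<Omega> t \<longleftrightarrow> level_set f \<Omega> t \<inter> critical_points f \<Omega> = {}"

definition level_length :: "(complex \<Rightarrow> complex) \<Rightarrow> complex set \<Rightarrow> real \<Rightarrow> real" where
  "level_length f \<Omega> t = measure arc_length (level_set f \<Omega> t)"

definition gradient :: "(complex \<Rightarrow> real) \<Rightarrow> complex \<Rightarrow> complex" where
  "gradient u z = (THE D. GDERIV u z :> D)"

definition level_normal :: "(complex \<Rightarrow> complex) \<Rightarrow> complex \<Rightarrow> complex" where
  "level_normal f z =
     - gradient (\<lambda>w. norm (f w)) z /\<^sub>R norm (gradient (\<lambda>w. norm (f w)) z)"

text \<open>The orthonormal frame \<open>(T, N)\<close> is positively oriented iff \<open>N = \<i> T\<close>.\<close>

definition level_tangent :: "(complex \<Rightarrow> complex) \<Rightarrow> complex \<Rightarrow> complex" where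
  "level_tangent f z = - \<i> * level_normal f z"

text \<open>
  The curve \<open>\<gamma>\<close> is a parametrization by arc length of the level curve through \<open>z\<close>, in the
  direction of the tangent field; the last conjunct is \<open>dT/ds = k N\<close>.
\<close>

definition has_signed_curvature :: "(complex \<Rightarrow> complex) \<Rightarrow> complex \<Rightarrow> real \<Rightarrow> bool" where
  "has_signed_curvature f z k \<longleftrightarrow>
     (\<exists>\<gamma> :: real \<Rightarrow> complex. \<exists>\<epsilon>>0. \<gamma> 0 = z \<and>
        (\<forall>s\<in>{-\<epsilon><..<\<epsilon>}. norm (f (\<gamma> s)) = norm (f z) \<and>
           (\<gamma> has_vector_derivative level_tangent f (\<gamma> s)) (at s)) \<and>
        ((\<lambda>s. level_tangent f (\<gamma> s)) has_vector_derivative k *\<^sub>R level_normal f z) (at 0))"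

definition signed_curvature :: "(complex \<Rightarrow> complex) \<Rightarrow> complex \<Rightarrow> real" where
  "signed_curvature f z = (THE k. has_signed_curvature f z k)"

text \<open>A bounded set is Jordan measurable iff its (compact) boundary is a null set.\<close>

definition jordan_measurable :: "complex set \<Rightarrow> bool" where
  "jordan_measurable K \<longleftrightarrow> bounded K \<and> negligible (frontier K)"

definition jordan_exhaustion :: "complex set \<Rightarrow> complex set \<Rightarrow> (nat \<Rightarrow> complex set) \<Rightarrow> bool" where
  "jordan_exhaustion D Z K \<longleftrightarrow>
     incseq K \<and> (\<forall>n. closed (K n) \<and> jordan_measurable (K n)) \<and> (\<Union>n. K n) = D - Z"

text \<open>
  Integral over \<open>D\<close> of a function that need not be defined on the finite set \<open>Z\<close>; improper
  if \<open>D\<close> meets \<open>Z\<close>.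
\<close>

definition has_area_integral ::
    "(complex \<Rightarrow> real) \<Rightarrow> complex set \<Rightarrow> complex set \<Rightarrow> real \<Rightarrow> bool" where
  "has_area_integral g D Z I \<longleftrightarrow>
     (if D \<inter> Z = {} then (g has_integral I) D
      else (\<exists>K. jordan_exhaustion D Z K) \<and>
           (\<forall>K. jordan_exhaustion D Z K \<longrightarrow>
              (\<forall>n. g integrable_on K n) \<and> (\<lambda>n. integral (K n) g) \<longlonglongrightarrow> I))"

end

theory Submission
  imports Defs
begin

text \<open>
Write \<open>\<nu> = \<nabla>\<bar>f\<bar> / \<bar>\<nabla>\<bar>f\<bar>\<bar>\<close> for the unit normal of the level curves that points to higher levels; since \<open>f\<close> is
holomorphic, \<open>\<bar>\<nabla>\<bar>f\<bar>\<bar> = \<bar>f'\<bar>\<close>. Parts (a) and (b) are the coarea formula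
\<open>\<integral> (\<integral>\<^bsub>\<bar>f\<bar> = t\<^esub> h ds) dt = \<integral>\<integral> h \<bar>f'\<bar> dA\<close> for \<open>h = 1 / \<bar>f'\<bar>\<close> and \<open>h = 1\<close>. Part (c) is the divergence
theorem for \<open>\<nu>\<close>: its flux through a level is the length of the level, and its divergence is the
signed curvature.

Both formulas are local away from the zeros of \<open>f\<close> and \<open>f'\<close>. There \<open>log f = u + \<i> v\<close> is a conformal
coordinate with inverse \<open>g\<close>, in which the levels of \<open>\<bar>f\<bar>\<close> are vertical lines. Arc length on them is
\<open>\<bar>g'\<bar> dv\<close> and area is \<open>\<bar>g'\<bar>\<^sup>2 du dv\<close>, so the coarea formula becomes Fubini's theorem (\<open>local_coarea\<close>).
The curvature is \<open>Re (g'' / g') / \<bar>g'\<bar>\<close>, so \<open>\<kappa> dA\<close> is the derivative of \<open>\<bar>g'\<bar>\<close> with respect to \<open>u\<close>, times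
\<open>du dv\<close>, and the divergence theorem becomes the fundamental theorem of calculus
(\<open>local_divergence\<close>). That Hausdorff measure computes \<open>\<bar>g'\<bar> dv\<close> is
\<open>arc_length_image_injective_curve\<close>; that areas scale by \<open>\<bar>g'\<bar>\<^sup>2\<close> is
\<open>emeasure_injective_holomorphic_image\<close>.

The coarea formula holds for arbitrary Borel functions, so charts are glued by cutting the band into
disjoint Borel pieces (\<open>band_coarea\<close>). The divergence theorem has boundary terms, so there the charts
are glued by a partition of unity (\<open>band_divergence\<close>).

The critical points in the band are finite in number, and they do no harm because
\<open>\<bar>\<kappa>\<bar> \<le> \<bar>f'' / f' - f' / f\<bar>\<close> has at most a simple pole there and is therefore integrable
(\<open>curvature_integrable\<close>). Cutting out discs of radius about \<open>\<epsilon>\<close> costs a gradient of size \<open>1 / \<epsilon>\<close> on an area of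
size \<open>\<epsilon>\<^sup>2\<close>, hence an error of order \<open>\<epsilon>\<close>. The same limit gives finiteness of the length of critical levels
(\<open>finite_length_and_total_curvature\<close>). Absolute integrability of \<open>\<kappa>\<close> makes the improper integral
independent of the exhaustion.
\<close>

section \<open>Lebesgue measure in the complex plane\<close>

lemma measurable_Complex: "(\<lambda>(x, y). Complex x y) \<in> borel_measurable (lborel \<Otimes>\<^sub>M lborel)"
  unfolding Complex_eq case_prod_unfold by measurable

text \<open>
Both sides give a rectangle the product of its side lengths, and rectangles determine Lebesgue
measure. The two integral formulas that follow are Fubini's theorem in the coordinates
\<open>x = Re z\<close>, \<open>y = Im z\<close>.
\<close>

lemma lborel_complex_eq_distr_pair:
  "(lborel :: complex measure) = distr (lborel \<Otimes>\<^sub>M lborel) borel (\<lambda>(x, y). Complex x y)"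
proof (rule lborel_eqI)
  note m = measurable_Complex
  fix l u :: complex
  assume lu: "\<And>b. b \<in> Basis \<Longrightarrow> l \<bullet> b \<le> u \<bullet> b"
  have le: "Re l \<le> Re u" "Im l \<le> Im u"
    using lu[of 1] lu[of \<i>] by (auto simp: Basis_complex_def)
  have "emeasure (distr (lborel \<Otimes>\<^sub>M lborel) borel (\<lambda>(x, y). Complex x y)) (box l u)
     = emeasure (lborel \<Otimes>\<^sub>M lborel) ({Re l<..<Re u} \<times> {Im l<..<Im u})"
    by (subst emeasure_distr[OF m])
      (auto intro!: arg_cong[where f="emeasure _"] simp: space_pair_measure in_box_complex_iff box_Complex_eq)
  also have "\<dots> = ennreal (Re u - Re l) * ennreal (Im u - Im l)"
    using le by (subst lborel.emeasure_pair_measure_Times) auto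
  finally show "emeasure (distr (lborel \<Otimes>\<^sub>M lborel) borel (\<lambda>(x, y). Complex x y)) (box l u)
      = (\<Prod>b\<in>Basis. (u - l) \<bullet> b)"
    using le by (simp add: Basis_complex_def ennreal_mult)
qed simp

lemma nn_integral_lborel_complex:
  assumes [measurable]: "k \<in> borel_measurable borel"
  shows "(\<integral>\<^sup>+z. k z \<partial>(lborel :: complex measure))
       = (\<integral>\<^sup>+x. \<integral>\<^sup>+y. k (Complex x y) \<partial>lborel \<partial>lborel)"
proof -
  note m = measurable_Complex
  show ?thesis
    by (subst lborel_complex_eq_distr_pair, subst nn_integral_distr[OF m], simp,
        subst lborel.nn_integral_fst[symmetric]) (use m in measurable)
qed

lemma integral_lborel_complex:
  fixes k :: "complex \<Rightarrow> real"
  assumes k: "integrable lborel k"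
  shows "(\<integral>z. k z \<partial>lborel) = (\<integral>y. \<integral>x. k (Complex x y) \<partial>lborel \<partial>lborel)"
proof -
  note m = measurable_Complex
  have km: "k \<in> borel_measurable borel" using k by auto
  have i: "integrable (lborel \<Otimes>\<^sub>M lborel) (\<lambda>(x, y). k (Complex x y))"
    using k by (subst (asm) lborel_complex_eq_distr_pair, subst (asm) integrable_distr_eq[OF m])
      (use km in \<open>auto simp: case_prod_unfold\<close>)
  show ?thesis
    using km lborel_pair.integral_snd[of "\<lambda>x y. k (Complex x y)"] i
    by (subst lborel_complex_eq_distr_pair, subst integral_distr[OF m]) (simp_all add: case_prod_unfold)
qed

definition complex_of_vec2 :: "real^2 \<Rightarrow> complex" where
  "complex_of_vec2 x = Complex (x $ 1) (x $ 2)"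

definition vec2_of_complex :: "complex \<Rightarrow> real^2" where
  "vec2_of_complex z = vector [Re z, Im z]"

lemma vec2_complex_inverse [simp]:
  "complex_of_vec2 (vec2_of_complex z) = z" "vec2_of_complex (complex_of_vec2 x) = x"
  by (auto simp: complex_of_vec2_def vec2_of_complex_def vec_eq_iff forall_2)

lemma bounded_linear_complex_of_vec2: "bounded_linear complex_of_vec2"
  unfolding linear_conv_bounded_linear[symmetric] by (rule linearI) (auto simp: complex_of_vec2_def complex_eq_iff)

lemma bounded_linear_vec2_of_complex: "bounded_linear vec2_of_complex"
  unfolding linear_conv_bounded_linear[symmetric] by (rule linearI) (auto simp: vec2_of_complex_def vec_eq_iff forall_2)

lemma measurable_complex_of_vec2: "complex_of_vec2 \<in> borel_measurable borel"
  by (intro borel_measurable_continuous_onI linear_continuous_on bounded_linear_complex_of_vec2)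

lemma lborel_complex_eq_distr_vec2:
  "(lborel :: complex measure) = distr lborel borel complex_of_vec2"
proof (rule lborel_eqI)
  have m: "complex_of_vec2 \<in> borel_measurable lborel"
    using measurable_complex_of_vec2 by simp
  fix l u :: complex
  assume lu: "\<And>b. b \<in> Basis \<Longrightarrow> l \<bullet> b \<le> u \<bullet> b"
  have le: "Re l \<le> Re u" "Im l \<le> Im u"
    using lu[of 1] lu[of \<i>] by (auto simp: Basis_complex_def)
  have "emeasure (distr lborel borel complex_of_vec2) (box l u)
     = emeasure lborel (box (vec2_of_complex l) (vec2_of_complex u))"
    by (subst emeasure_distr[OF m])
      (auto intro!: arg_cong[where f="emeasure _"]
        simp: complex_of_vec2_def vec2_of_complex_def in_box_complex_iff mem_box_cart forall_2)
  moreover have "emeasure lborel (box (vec2_of_complex l) (vec2_of_complex u))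
      = ennreal ((Re u - Re l) * (Im u - Im l))"
  proof -
    have B: "(Basis :: (real^2) set) = {axis 1 1, axis 2 1}"
      by (auto simp: Basis_vec_def UNIV_2)
    show ?thesis
      using le by (subst emeasure_lborel_box)
        (auto simp: B inner_axis axis_eq_axis vec2_of_complex_def)
  qed
  ultimately show "emeasure (distr lborel borel complex_of_vec2) (box l u)
      = (\<Prod>b\<in>Basis. (u - l) \<bullet> b)"
    by (simp add: Basis_complex_def)
qed simp

text \<open>
On a compact set the inverse of a continuous injection is continuous, so that the image of a
Borel set is its preimage under a Borel map.
\<close>

lemma borel_image_inj_on_compact:
  fixes \<gamma> :: "'a::euclidean_space \<Rightarrow> 'b::euclidean_space"
  assumes "compact K" "continuous_on K \<gamma>" "inj_on \<gamma> K" "E \<in> sets borel" "E \<subseteq> K"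
  shows "\<gamma> ` E \<in> sets borel"
proof -
  define q where "q = the_inv_into K \<gamma>"
  have q: "q (\<gamma> x) = x" if "x \<in> K" for x
    using that assms(3) by (simp add: q_def the_inv_into_f_f)
  have cq: "continuous_on (\<gamma> ` K) q"
    by (rule continuous_on_inv[OF assms(2,1)]) (use q in auto)
  have K: "\<gamma> ` K \<in> sets borel"
    by (intro borel_compact compact_continuous_image assms)
  have "q \<in> borel_measurable (restrict_space borel (\<gamma> ` K))"
    by (rule borel_measurable_continuous_on_restrict[OF cq])
  then have "q -` E \<inter> space (restrict_space borel (\<gamma> ` K)) \<in> sets (restrict_space borel (\<gamma> ` K))"
    using assms(4) by (rule measurable_sets)
  then have "q -` E \<inter> \<gamma> ` K \<in> sets borel"
    using K by (simp add: sets_restrict_space_iff space_restrict_space)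
  moreover have "q -` E \<inter> \<gamma> ` K = \<gamma> ` E"
    using q assms(5) by force
  ultimately show ?thesis by simp
qed

text \<open>
Seen as a real linear map of the plane, multiplication by \<open>g'\<close> is a rotation followed by a
dilation by \<open>\<bar>g'\<bar>\<close>, so its determinant is \<open>\<bar>g'\<bar>\<^sup>2\<close>. The change of variables takes place in \<open>real^2\<close>,
to which the plane is identified by a measure preserving linear map. Containment in a compact
set makes the Jacobian integrable.
\<close>

lemma emeasure_injective_holomorphic_image:
  fixes g :: "complex \<Rightarrow> complex"
  assumes V: "open V" "g holomorphic_on V" "inj_on g V" and K: "compact K" "K \<subseteq> V"
    and E: "E \<in> sets borel" "E \<subseteq> K"
  shows "emeasure lborel (g ` E) = (\<integral>\<^sup>+w\<in>E. ennreal ((norm (deriv g w))\<^sup>2) \<partial>lborel)"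
proof -
  let ?C = complex_of_vec2 and ?R = vec2_of_complex
  note mC = measurable_complex_of_vec2
  have contg: "continuous_on K g" and injg: "inj_on g K"
    using V K holomorphic_on_imp_continuous_on continuous_on_subset inj_on_subset by blast+
  have gE: "g ` E \<in> sets borel"
    by (rule borel_image_inj_on_compact[OF K(1) contg injg E])
  define S where "S = ?C -` E"
  define S0 where "S0 = ?C -` K"
  define F where "F = (\<lambda>x. ?R (g (?C x)))"
  define F' where "F' = (\<lambda>x h. ?R (deriv g (?C x) * ?C h))"
  have S_eq: "S = ?R ` E" "S0 = ?R ` K" unfolding S_def S0_def by (auto simp: image_iff intro!: bexI[of _ "?C _"])
  have SB: "S \<in> sets borel" unfolding S_def using measurable_sets[OF mC E(1)] by simp
  have S0: "compact S0" unfolding S_eq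
    by (intro compact_continuous_image linear_continuous_on K) (rule bounded_linear_vec2_of_complex)
  have SS: "S \<subseteq> S0" using E by (auto simp: S_def S0_def)
  have dg: "continuous_on V (deriv g)"
    using V holomorphic_deriv holomorphic_on_imp_continuous_on by blast
  have der: "(F has_derivative F' x) (at x within S)" if "x \<in> S" for x
  proof -
    have "?C x \<in> V" using that E K by (auto simp: S_def)
    then have "(g has_field_derivative deriv g (?C x)) (at (?C x))"
      using V holomorphic_derivI by blast
    then have "(g has_derivative (\<lambda>h. deriv g (?C x) * h)) (at (?C x))"
      by (simp add: has_field_derivative_def)
    then have "((\<lambda>x. g (?C x)) has_derivative (\<lambda>h. deriv g (?C x) * ?C h)) (at x within S)"
      using has_derivative_compose[OF bounded_linear_imp_has_derivative[OF bounded_linear_complex_of_vec2]]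
      by blast
    then show ?thesis unfolding F_def F'_def
      by (intro bounded_linear.has_derivative[of ?R]) (simp_all add: bounded_linear_vec2_of_complex)
  qed
  have detF: "\<bar>det (matrix (F' x))\<bar> = (norm (deriv g (?C x)))\<^sup>2" for x
    unfolding cmod_power2
    by (simp add: det_2 matrix_def F'_def complex_of_vec2_def vec2_of_complex_def axis_def power2_eq_square)
  have contJ: "continuous_on S0 (\<lambda>x. (norm (deriv g (?C x)))\<^sup>2)"
    by (intro continuous_intros continuous_on_compose2[OF dg, of S0 ?C] linear_continuous_on)
      (use K in \<open>auto simp: S0_def bounded_linear_complex_of_vec2\<close>)
  have intb: "set_integrable lborel S0 (\<lambda>x. (norm (deriv g (?C x)))\<^sup>2)"
    unfolding set_integrable_def by (rule borel_integrable_compact[OF S0 contJ])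
  have intS: "set_integrable lborel S (\<lambda>x. (norm (deriv g (?C x)))\<^sup>2)"
    by (rule set_integrable_subset[OF intb]) (use SB SS in auto)
  have hi: "((\<lambda>x. (norm (deriv g (?C x)))\<^sup>2) has_integral (LINT x:S|lborel. (norm (deriv g (?C x)))\<^sup>2)) S"
    using set_borel_integral_eq_integral[OF intS] by (simp add: has_integral_iff)
  have injF: "inj_on F S"
    unfolding F_def inj_on_def using injg E(2) by (metis S_def inj_onD subsetD vec2_complex_inverse vimageE)
  have F: "F ` S = ?C -` (g ` E)"
  proof (intro set_eqI iffI)
    fix x assume "x \<in> ?C -` (g ` E)"
    then obtain e where e: "e \<in> E" "?C x = g e" by auto
    then have "x = F (?R e)" by (metis F_def vec2_complex_inverse)
    then show "x \<in> F ` S" using e by (auto simp: S_def)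
  qed (auto simp: F_def S_def)
  have "F ` S \<in> lmeasurable \<and>
      measure lebesgue (F ` S) = (LINT x:S|lborel. (norm (deriv g (?C x)))\<^sup>2)"
    using has_measure_differentiable_image[OF _ der injF] hi SB by (simp add: detF)
  then have meas: "measure lebesgue (F ` S) = (LINT x:S|lborel. (norm (deriv g (?C x)))\<^sup>2)"
    and lm: "F ` S \<in> lmeasurable" by auto
  have "emeasure lborel (g ` E) = emeasure lborel (?C -` (g ` E))"
    by (subst lborel_complex_eq_distr_vec2, subst emeasure_distr) (use mC gE in auto)
  also have "\<dots> = emeasure lebesgue (F ` S)"
    unfolding F using measurable_sets[OF mC gE] by simp
  also have "\<dots> = ennreal (LINT x:S|lborel. (norm (deriv g (?C x)))\<^sup>2)"
    using meas lm by (simp add: emeasure_eq_measure2)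
  also have "\<dots> = (\<integral>\<^sup>+x\<in>S. ennreal ((norm (deriv g (?C x)))\<^sup>2) \<partial>lborel)"
    using intS unfolding set_lebesgue_integral_def set_integrable_def
    by (subst nn_integral_eq_integral[symmetric])
       (auto intro!: nn_integral_cong simp: indicator_def)
  also have "\<dots> = (\<integral>\<^sup>+w. ennreal ((norm (deriv g w))\<^sup>2) * indicator E w \<partial>lborel)"
  proof -
    have "(\<lambda>w. indicator K w *\<^sub>R ((norm (deriv g w))\<^sup>2)) \<in> borel_measurable borel"
      by (intro borel_measurable_continuous_on_indicator continuous_intros continuous_on_subset[OF dg] K borel_compact)
    then have "(\<lambda>w. ennreal (indicator K w *\<^sub>R ((norm (deriv g w))\<^sup>2)) * indicator E w) \<in> borel_measurable borel"
      using E by measurable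
    then have m: "(\<lambda>w. ennreal ((norm (deriv g w))\<^sup>2) * indicator E w) \<in> borel_measurable borel"
      by (rule measurable_cong[THEN iffD1, rotated]) (use E in \<open>auto simp: indicator_def\<close>)
    show ?thesis
      by (subst lborel_complex_eq_distr_vec2, subst nn_integral_distr)
        (use mC m in \<open>auto simp: S_def indicator_def intro!: nn_integral_cong\<close>)
  qed
  finally show ?thesis .
qed

section \<open>Change of variables along an injective parametrization\<close>

text \<open>
The common pattern of the two changes of variables used below: a compact set \<open>K\<close> parametrizes a
set that carries a measure \<open>M\<close>, and \<open>M\<close> pulls back to \<open>j\<close> times Lebesgue measure. For area the
parametrization is conformal and \<open>j = \<bar>g'\<bar>\<^sup>2\<close>; for arc length it is a curve and \<open>j\<close> is its speed.
Nothing is known about \<open>\<gamma>\<close> and \<open>j\<close> off \<open>K\<close>, so they are replaced by \<open>0\<close> there to obtain Borel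
functions on the whole space.
\<close>
locale injective_parametrization =
  fixes \<gamma> :: "'a::euclidean_space \<Rightarrow> 'b::euclidean_space" and j :: "'a \<Rightarrow> real"
    and K :: "'a set" and M :: "'b measure"
  assumes compact_K: "compact K" and cont: "continuous_on K \<gamma>" and inj: "inj_on \<gamma> K"
    and sets_M: "sets M = sets borel"
    and cont_j: "continuous_on K j" and j_nonneg: "\<And>x. x \<in> K \<Longrightarrow> 0 \<le> j x"
    and image_measure: "\<And>E. E \<in> sets borel \<Longrightarrow> E \<subseteq> K \<Longrightarrow>
      emeasure M (\<gamma> ` E) = (\<integral>\<^sup>+x\<in>E. ennreal (j x) \<partial>lborel)"
begin

lemma K_borel: "K \<in> sets borel"
  using compact_K by (rule borel_compact)

lemma weight_measurable: "(\<lambda>x. indicator K x * j x) \<in> borel_measurable borel"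
  using borel_measurable_continuous_on_indicator[OF K_borel cont_j] by simp

lemma restricted_measurable: "(\<lambda>x. indicator K x *\<^sub>R \<gamma> x) \<in> borel_measurable borel"
  by (rule borel_measurable_continuous_on_indicator[OF K_borel cont])

lemma image_borel: "\<gamma> ` K \<in> sets borel"
  by (intro borel_compact compact_continuous_image cont compact_K)

lemma density_image:
  "density M (indicator (\<gamma> ` K)) =
   distr (density lborel (\<lambda>x. ennreal (indicator K x * j x))) borel (\<lambda>x. indicator K x *\<^sub>R \<gamma> x)"
  (is "?M = distr ?N borel ?g")
proof (rule sym, rule measure_eqI)
  show "sets (distr ?N borel ?g) = sets ?M" using sets_M by simp
  fix A assume "A \<in> sets (distr ?N borel ?g)"
  then have A: "A \<in> sets borel" by simp
  define E where "E = K \<inter> ?g -` A"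
  have EB: "E \<in> sets borel" unfolding E_def using K_borel measurable_sets[OF restricted_measurable A] by auto
  have "emeasure (distr ?N borel ?g) A = emeasure ?N (?g -` A)"
    using A restricted_measurable by (simp add: emeasure_distr)
  also have "\<dots> = (\<integral>\<^sup>+x. ennreal (indicator K x * j x) * indicator (?g -` A) x \<partial>lborel)"
    by (rule emeasure_density) (use weight_measurable measurable_sets[OF restricted_measurable A] in auto)
  also have "\<dots> = (\<integral>\<^sup>+x\<in>E. ennreal (j x) \<partial>lborel)"
    by (intro nn_integral_cong) (auto simp: E_def indicator_def)
  also have "\<dots> = emeasure M (\<gamma> ` E)"
    by (rule image_measure[symmetric]) (use EB in \<open>auto simp: E_def\<close>)
  also have "\<gamma> ` E = \<gamma> ` K \<inter> A"
    by (auto simp: E_def)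
  also have "emeasure M (\<gamma> ` K \<inter> A) = emeasure ?M A"
    using A image_borel sets_M by (subst emeasure_density) (auto simp: nn_integral_indicator[symmetric] indicator_inter_arith
        simp del: nn_integral_indicator cong: measurable_cong_sets)
  finally show "emeasure (distr ?N borel ?g) A = emeasure ?M A" .
qed

lemma nn_integral_image:
  assumes h: "h \<in> borel_measurable borel"
  shows "(\<integral>\<^sup>+z\<in>\<gamma> ` K. h z \<partial>M) = (\<integral>\<^sup>+x. ennreal (indicator K x * j x) * h (indicator K x *\<^sub>R \<gamma> x) \<partial>lborel)"
proof -
  have hM: "h \<in> borel_measurable M" using h sets_M by (simp cong: measurable_cong_sets)
  have "(\<integral>\<^sup>+z\<in>\<gamma> ` K. h z \<partial>M) = (\<integral>\<^sup>+z. h z \<partial>density M (indicator (\<gamma> ` K)))"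
    using image_borel sets_M hM by (subst nn_integral_density) (auto simp: mult.commute)
  also have "\<dots> = (\<integral>\<^sup>+x. ennreal (indicator K x * j x) * h (indicator K x *\<^sub>R \<gamma> x) \<partial>lborel)"
    unfolding density_image
    using restricted_measurable weight_measurable h by (subst nn_integral_distr) (auto simp: nn_integral_density)
  finally show ?thesis .
qed

lemma integral_image:
  fixes h :: "'b \<Rightarrow> real"
  assumes h: "continuous_on (\<gamma> ` K) h"
  shows "set_integrable M (\<gamma> ` K) h" (is ?th1)
    and "(LINT z:\<gamma> ` K|M. h z) = (LINT x:K|lborel. j x * h (\<gamma> x))" (is ?th2)
proof -
  define h' where "h' = (\<lambda>z. indicator (\<gamma> ` K) z * h z)"
  have mh: "h' \<in> borel_measurable borel"
    using borel_measurable_continuous_on_indicator[OF image_borel h] by (simp add: h'_def)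
  have mh': "h' \<in> borel_measurable M" using mh sets_M by (simp cong: measurable_cong_sets)
  have iM: "(indicator (\<gamma> ` K) :: _ \<Rightarrow> real) \<in> borel_measurable M" using image_borel sets_M by simp
  have dens: "density M (indicator (\<gamma> ` K)) = density M (\<lambda>x. ennreal (indicator (\<gamma> ` K) x))"
    by (simp add: ennreal_indicator)
  have j0: "0 \<le> indicator K x * j x" for x using j_nonneg by (auto simp: indicator_def)
  have "set_integrable M (\<gamma> ` K) h \<longleftrightarrow> integrable (density M (indicator (\<gamma> ` K))) h'"
    unfolding dens set_integrable_def
    by (subst integrable_density[OF mh' iM]) (auto simp: h'_def indicator_def intro!: Bochner_Integration.integrable_cong)
  also have "\<dots> \<longleftrightarrow> integrable lborel (\<lambda>x. (indicator K x * j x) *\<^sub>R h' (indicator K x *\<^sub>R \<gamma> x))"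
    unfolding density_image
    using restricted_measurable mh weight_measurable j0
    by (subst integrable_distr_eq) (simp_all add: integrable_density)
  also have "\<dots> \<longleftrightarrow> integrable lborel (\<lambda>x. indicator K x *\<^sub>R (j x * h (\<gamma> x)))"
    by (intro Bochner_Integration.integrable_cong refl) (auto simp: h'_def indicator_def)
  finally show ?th1
    using borel_integrable_compact[OF compact_K, of "\<lambda>x. j x * h (\<gamma> x)"]
      continuous_on_mult[OF cont_j continuous_on_compose2[OF h cont]] by auto
  have "(LINT z:\<gamma> ` K|M. h z) = (\<integral>z. h' z \<partial>density M (indicator (\<gamma> ` K)))"
    unfolding dens set_lebesgue_integral_def
    by (subst integral_density[OF mh' iM]) (auto simp: h'_def indicator_def intro!: Bochner_Integration.integral_cong)
  also have "\<dots> = (\<integral>x. (indicator K x * j x) *\<^sub>R h' (indicator K x *\<^sub>R \<gamma> x) \<partial>lborel)"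
    unfolding density_image
    using restricted_measurable mh weight_measurable j0
    by (subst integral_distr) (simp_all add: integral_density)
  also have "\<dots> = (LINT x:K|lborel. j x * h (\<gamma> x))"
    unfolding set_lebesgue_integral_def
    by (intro Bochner_Integration.integral_cong refl) (auto simp: h'_def indicator_def)
  finally show ?th2 .
qed

end

section \<open>The length of a smooth injective curve\<close>

text \<open>
Cutting the interval into \<open>N\<close> equal pieces gives a cover by sets of diameter at most
\<open>C (q - p) / N\<close>. The sum of these bounds is \<open>C (q - p)\<close> for every \<open>N\<close>, and \<open>N\<close> can be chosen so large
that each piece has diameter at most \<open>\<delta>\<close>.
\<close>

lemma hausdorff1_outer_image_Lipschitz_le:
  fixes \<gamma> :: "real \<Rightarrow> complex"
  assumes pq: "p \<le> q" and C: "0 \<le> C"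
    and lip: "\<And>x y. x \<in> {p..q} \<Longrightarrow> y \<in> {p..q} \<Longrightarrow> dist (\<gamma> x) (\<gamma> y) \<le> C * \<bar>x - y\<bar>"
  shows "hausdorff1_outer (\<gamma> ` {p..q}) \<le> ennreal (C * (q - p))"
  unfolding hausdorff1_outer_def
proof (rule SUP_least)
  fix \<delta> :: real assume "\<delta> \<in> {0<..}"
  then have d: "0 < \<delta>" by simp
  obtain N :: nat where N: "C * (q - p) / \<delta> < real N" using reals_Archimedean2 by blast
  have N0: "0 < real N" using N C pq d by (smt (verit) divide_nonneg_pos mult_nonneg_nonneg)
  define r where "r = (q - p) / real N"
  have r0: "0 \<le> r" using pq N0 by (simp add: r_def)
  have Nr: "real N * r = q - p" using N0 by (simp add: r_def)
  have rd: "C * r \<le> \<delta>" using N N0 d by (simp add: r_def field_simps)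
  define I where "I = (\<lambda>n::nat. {p + real n * r .. p + real (Suc n) * r})"
  define A where "A = (\<lambda>n. if n < N then \<gamma> ` I n else {})"
  have Isub: "I n \<subseteq> {p..q}" if "n < N" for n
  proof -
    have "real (Suc n) * r \<le> real N * r" using that r0 by (intro mult_right_mono) auto
    moreover have "0 \<le> real n * r" using r0 by simp
    ultimately show ?thesis using Nr by (auto simp: I_def)
  qed
  have dA: "dist x y \<le> C * r" if "x \<in> A n" "y \<in> A n" for x y n
  proof -
    obtain s t where st: "n < N" "s \<in> I n" "t \<in> I n" "x = \<gamma> s" "y = \<gamma> t"
      using \<open>x \<in> A n\<close> \<open>y \<in> A n\<close> by (auto simp: A_def split: if_splits)
    have "\<bar>s - t\<bar> \<le> r" using st by (auto simp: I_def algebra_simps)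
    then show ?thesis using lip[of s t] Isub[of n] st C
      by (smt (verit) mult_left_mono subsetD)
  qed
  have bA: "bounded (A n)" for n
    unfolding bounded_def using dA by blast
  have diamA: "diameter (A n) \<le> C * r" for n
    by (rule diameter_le) (use dA C r0 in \<open>auto simp: dist_norm\<close>)
  have "hausdorff1_pre \<delta> (\<gamma> ` {p..q}) \<le> (\<Sum>n. ennreal (diameter (A n)))"
  proof (rule hausdorff1_pre_le)
    show "\<gamma> ` {p..q} \<subseteq> (\<Union>n. A n)"
    proof clarify
      fix x assume x: "x \<in> {p..q}"
      show "\<gamma> x \<in> (\<Union>n. A n)"
      proof (cases "r = 0")
        case True
        then have "x \<in> I 0" "0 < N" using x Nr N0 by (auto simp: I_def)
        then show ?thesis by (auto simp: A_def intro!: exI[of _ 0])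
      next
        case False
        then have r: "0 < r" using r0 by simp
        define m where "m = nat \<lfloor>(x - p) / r\<rfloor>"
        have m: "real m \<le> (x - p) / r" "(x - p) / r < real m + 1"
          using x r unfolding m_def by (auto simp: floor_less_iff)
        have mI: "x \<in> I m" using m r by (auto simp: I_def field_simps)
        show ?thesis
        proof (cases "m < N")
          case True
          then have "\<gamma> x \<in> A m" using mI by (auto simp: A_def)
          then show ?thesis by blast
        next
          case False
          then have "real N * r \<le> real m * r" using r by (intro mult_right_mono) auto
          moreover have "real m * r \<le> x - p" using m r by (simp add: field_simps)
          ultimately have "x = q" using x Nr by auto
          moreover have "q \<in> I (N - 1)" using N0 Nr r
            by (auto simp: I_def of_nat_diff algebra_simps)
          ultimately have "\<gamma> x \<in> A (N - 1)" using N0 by (auto simp: A_def)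
          then show ?thesis by blast
        qed
      qed
    qed
  qed (use bA diamA rd in \<open>auto intro: order_trans\<close>)
  also have "\<dots> = (\<Sum>n<N. ennreal (diameter (A n)))"
    by (rule suminf_finite) (auto simp: A_def)
  also have "\<dots> \<le> (\<Sum>n<N. ennreal (C * r))"
    using diamA by (intro sum_mono ennreal_leI) 
  also have "\<dots> = ennreal (C * (q - p))"
    using C r0 by (simp add: ennreal_of_nat_eq_real_of_nat ennreal_mult[symmetric] Nr[symmetric] ac_simps)
  finally show "hausdorff1_pre \<delta> (\<gamma> ` {p..q}) \<le> ennreal (C * (q - p))" .
qed

text \<open>
A cover of the image pulls back to a cover of the interval. Each pulled back set lies in an
interval no longer than the diameter of the covering set divided by \<open>c\<close>, so countable
subadditivity of Lebesgue measure bounds \<open>q - p\<close>.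
\<close>

lemma hausdorff1_outer_image_ge:
  fixes \<gamma> :: "real \<Rightarrow> complex"
  assumes pq: "p \<le> q" and c: "0 < c"
    and low: "\<And>x y. x \<in> {p..q} \<Longrightarrow> y \<in> {p..q} \<Longrightarrow> c * \<bar>x - y\<bar> \<le> dist (\<gamma> x) (\<gamma> y)"
  shows "ennreal (c * (q - p)) \<le> hausdorff1_outer (\<gamma> ` {p..q})"
proof -
  have "ennreal (c * (q - p)) \<le> hausdorff1_pre 1 (\<gamma> ` {p..q})"
  proof (rule hausdorff1_pre_greatest)
    fix A :: "nat \<Rightarrow> complex set"
    assume A: "\<gamma> ` {p..q} \<subseteq> (\<Union>n. A n)" "\<And>n. bounded (A n)"
    define B where "B = (\<lambda>n. {x \<in> {p..q}. \<gamma> x \<in> A n})"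
    define J where "J = (\<lambda>n. if B n = {} then {} else {Inf (B n)..Sup (B n)})"
    have bB: "bdd_below (B n)" "bdd_above (B n)" for n
      by (auto simp: B_def intro!: bdd_belowI[of _ p] bdd_aboveI[of _ q])
    have BJ: "B n \<subseteq> J n" for n
      using bB[of n] by (auto simp: J_def intro: cInf_lower cSup_upper)
    have len: "c * (Sup (B n) - Inf (B n)) \<le> diameter (A n)" if "B n \<noteq> {}" for n
    proof -
      have "c * (x - y) \<le> diameter (A n)" if "x \<in> B n" "y \<in> B n" for x y
        using low[of x y] that diameter_bounded_bound[OF A(2), of "\<gamma> x" n "\<gamma> y"] c
        by (auto simp: B_def abs_if mult_less_0_iff split: if_splits)
          (smt (verit) mult_left_mono)+
      then have *: "x \<le> diameter (A n) / c + y" if "x \<in> B n" "y \<in> B n" for x y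
        using that c by (simp add: pos_le_divide_eq[symmetric] le_diff_eq[symmetric] diff_le_eq mult.commute[of c])
      have "Sup (B n) \<le> diameter (A n) / c + y" if "y \<in> B n" for y
        using * that \<open>B n \<noteq> {}\<close> by (intro cSup_least) auto
      then have "Sup (B n) - diameter (A n) / c \<le> Inf (B n)"
        using \<open>B n \<noteq> {}\<close> by (intro cInf_greatest) (auto simp: algebra_simps)
      then show ?thesis using c by (simp add: field_simps)
    qed
    have eJ: "ennreal c * emeasure lborel (J n) \<le> ennreal (diameter (A n))" for n
    proof (cases "B n = {}")
      case False
      then have "Inf (B n) \<le> Sup (B n)" using bB by (simp add: cInf_le_cSup)
      then show ?thesis using False len[OF False] c by (simp add: J_def ennreal_mult[symmetric] ennreal_leI)
    qed (simp add: J_def)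
    have "{p..q} \<subseteq> (\<Union>n. J n)"
    proof
      fix x assume "x \<in> {p..q}"
      then obtain n where "x \<in> B n" using A(1) by (fastforce simp: B_def)
      then show "x \<in> (\<Union>n. J n)" using BJ by blast
    qed
    then have "emeasure lborel {p..q} \<le> emeasure lborel (\<Union>n. J n)"
      by (intro emeasure_mono) (auto simp: J_def)
    also have "\<dots> \<le> (\<Sum>n. emeasure lborel (J n))"
      by (rule emeasure_subadditive_countably) (auto simp: J_def)
    finally have "ennreal c * ennreal (q - p) \<le> ennreal c * (\<Sum>n. emeasure lborel (J n))"
      using pq by (intro mult_left_mono) auto
    also have "\<dots> = (\<Sum>n. ennreal c * emeasure lborel (J n))" by simp
    also have "\<dots> \<le> (\<Sum>n. ennreal (diameter (A n)))"
      by (intro suminf_le eJ summableI)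
    finally show "ennreal (c * (q - p)) \<le> (\<Sum>n. ennreal (diameter (A n)))"
      using c pq by (simp add: ennreal_mult)
  qed
  also have "\<dots> \<le> hausdorff1_outer (\<gamma> ` {p..q})" by (rule hausdorff1_pre_le_outer) simp
  finally show ?thesis .
qed

lemma arc_length_singleton [simp]: "emeasure arc_length {z} = 0"
proof -
  have "hausdorff1_outer ((\<lambda>_::real. z) ` {0..0}) \<le> ennreal (0 * (0 - 0))"
    by (rule hausdorff1_outer_image_Lipschitz_le) auto
  then show ?thesis by (simp add: emeasure_arc_length)
qed

lemma arc_length_finite [simp]: "finite S \<Longrightarrow> emeasure arc_length S = 0"
proof (induction S rule: finite_induct)
  case (insert x F)
  have "emeasure arc_length ({x} \<union> F) \<le> emeasure arc_length {x} + emeasure arc_length F"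
    by (rule emeasure_subadditive) (auto intro: insert borel_closed finite_imp_closed)
  then show ?case using insert by simp
qed simp

text \<open>
Where the velocity stays within \<open>e\<close> of a fixed vector \<open>v\<close>, the curve stretches distances by a factor
between \<open>\<bar>v\<bar> - e\<close> and \<open>\<bar>v\<bar> + e\<close>; the two preceding estimates then bound its length on both sides.
\<close>

lemma arc_length_image_approx:
  fixes \<gamma> :: "real \<Rightarrow> complex"
  assumes "s \<le> t" and e: "0 \<le> e"
    and der: "\<And>x. x \<in> {s..t} \<Longrightarrow> (\<gamma> has_vector_derivative \<gamma>' x) (at x within {s..t})"
    and x0: "x0 \<in> {s..t}"
    and near: "\<And>x. x \<in> {s..t} \<Longrightarrow> norm (\<gamma>' x - \<gamma>' x0) \<le> e"
  shows "emeasure arc_length (\<gamma> ` {s..t}) \<le> ennreal ((norm (\<gamma>' x0) + e) * (t - s))"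
    and "ennreal ((norm (\<gamma>' x0) - e) * (t - s)) \<le> emeasure arc_length (\<gamma> ` {s..t})"
proof -
  have cont: "continuous_on {s..t} \<gamma>"
    using der by (rule continuous_on_vector_derivative)
  have B: "\<gamma> ` {s..t} \<in> sets borel"
    by (intro borel_compact compact_continuous_image cont) auto
  have lin: "norm (\<gamma> x - \<gamma> y - (x - y) *\<^sub>R \<gamma>' x0) \<le> \<bar>x - y\<bar> * e"
    if "x \<in> {s..t}" "y \<in> {s..t}" for x y
    using vector_differentiable_bound_linearization[where a=y and b=x, OF der _ near x0] that
    by (auto simp: closed_segment_eq_real_ivl split: if_splits)
  have up: "dist (\<gamma> x) (\<gamma> y) \<le> (norm (\<gamma>' x0) + e) * \<bar>x - y\<bar>"
    and lo: "(norm (\<gamma>' x0) - e) * \<bar>x - y\<bar> \<le> dist (\<gamma> x) (\<gamma> y)"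
    if "x \<in> {s..t}" "y \<in> {s..t}" for x y
    using lin[OF that] norm_triangle_ineq2[of "\<gamma> x - \<gamma> y" "(x - y) *\<^sub>R \<gamma>' x0"]
      norm_triangle_ineq2[of "(x - y) *\<^sub>R \<gamma>' x0" "\<gamma> x - \<gamma> y"]
      norm_minus_commute[of "\<gamma> x - \<gamma> y"]
    by (simp_all only: dist_norm norm_scaleR real_norm_def distrib_left right_diff_distrib mult.commute[of _ "\<bar>x - y\<bar>"])
  show "emeasure arc_length (\<gamma> ` {s..t}) \<le> ennreal ((norm (\<gamma>' x0) + e) * (t - s))"
    using hausdorff1_outer_image_Lipschitz_le[OF assms(1) _ up] e B by (simp add: emeasure_arc_length)
  show "ennreal ((norm (\<gamma>' x0) - e) * (t - s)) \<le> emeasure arc_length (\<gamma> ` {s..t})"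
  proof (cases "0 < norm (\<gamma>' x0) - e")
    case True
    then show ?thesis
      using hausdorff1_outer_image_ge[OF assms(1) True lo] B by (simp add: emeasure_arc_length)
  next
    case False
    then have "(norm (\<gamma>' x0) - e) * (t - s) \<le> 0" using assms(1) by (intro mult_nonpos_nonneg) auto
    then show ?thesis by (simp add: ennreal_neg)
  qed
qed

text \<open>
By the preceding estimates the length \<open>\<Lambda> x\<close> of the arc up to parameter \<open>x\<close> is differentiable with
derivative \<open>\<bar>\<gamma>' x\<bar>\<close>, and the fundamental theorem of calculus recovers \<open>\<Lambda> q\<close>. Injectivity makes
lengths of adjacent arcs add up, since they share only an end point.
\<close>

lemma arc_length_image_Icc:
  fixes \<gamma> :: "real \<Rightarrow> complex"
  assumes pq: "p \<le> q"
    and der: "\<And>x. x \<in> {p..q} \<Longrightarrow> (\<gamma> has_vector_derivative \<gamma>' x) (at x within {p..q})"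
    and cont': "continuous_on {p..q} \<gamma>'" and inj: "inj_on \<gamma> {p..q}"
  shows "emeasure arc_length (\<gamma> ` {p..q}) = (\<integral>\<^sup>+x\<in>{p..q}. ennreal (norm (\<gamma>' x)) \<partial>lborel)"
proof -
  have cont: "continuous_on {p..q} \<gamma>"
    using der by (rule continuous_on_vector_derivative)
  have B: "\<gamma> ` {s..t} \<in> sets borel" if "{s..t} \<subseteq> {p..q}" for s t
    by (intro borel_compact compact_continuous_image continuous_on_subset[OF cont] that) auto
  obtain C where C: "0 \<le> C" "\<And>x. x \<in> {p..q} \<Longrightarrow> norm (\<gamma>' x) \<le> C"
    using compact_continuous_image[OF cont'] compact_imp_bounded bounded_pos
    by (metis compact_Icc imageI less_eq_real_def)
  have fin: "emeasure arc_length (\<gamma> ` {s..t}) < \<infinity>" if "{s..t} \<subseteq> {p..q}" for s t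
  proof (cases "s \<le> t")
    case True
    \<comment> \<open>A crude bound is enough for finiteness: any two velocities differ by at most \<open>2 C\<close>.\<close>
    have "emeasure arc_length (\<gamma> ` {s..t}) \<le> ennreal ((norm (\<gamma>' s) + 2 * C) * (t - s))"
    proof (rule arc_length_image_approx(1)[OF True])
      fix x assume x: "x \<in> {s..t}"
      show "(\<gamma> has_vector_derivative \<gamma>' x) (at x within {s..t})"
        using der[of x] x that has_vector_derivative_within_subset by blast
      show "norm (\<gamma>' x - \<gamma>' s) \<le> 2 * C"
        using C(2)[of x] C(2)[of s] x that norm_triangle_ineq4[of "\<gamma>' x" "\<gamma>' s"] True by (force simp: subset_eq)
    qed (use C True in auto)
    then show ?thesis unfolding infinity_ennreal_def by (rule le_less_trans) (rule ennreal_less_top)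
  qed simp
  define \<Lambda> where "\<Lambda> = (\<lambda>x. measure arc_length (\<gamma> ` {p..x}))"
  have add: "\<Lambda> y = \<Lambda> x + measure arc_length (\<gamma> ` {x..y})" if "p \<le> x" "x \<le> y" "y \<le> q" for x y
  proof -
    have "\<gamma> ` {p..y} = \<gamma> ` {p..x} \<union> \<gamma> ` {x..y}"
      using that by (subst image_Un[symmetric]) (auto intro!: arg_cong[of _ _ "(`) \<gamma>"])
    moreover have "\<gamma> ` {p..x} \<inter> \<gamma> ` {x..y} = {\<gamma> x}"
      using that inj by (auto simp: inj_on_def) (metis atLeastAtMost_iff order_antisym order_trans)+
    moreover have "measure arc_length (\<gamma> ` {p..x} \<union> \<gamma> ` {x..y})
        = measure arc_length (\<gamma> ` {p..x}) + measure arc_length (\<gamma> ` {x..y} - \<gamma> ` {p..x})"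
      using fin[of p x] fin[of x y] B[of p x] B[of x y] that by (intro measure_Un2) (auto simp: fmeasurable_def)
    moreover have "measure arc_length (\<gamma> ` {x..y} - \<gamma> ` {p..x}) =
        measure arc_length (\<gamma> ` {x..y}) - measure arc_length (\<gamma> ` {x..y} \<inter> \<gamma> ` {p..x})"
      using fin[of p x] fin[of x y] B[of p x] B[of x y] that
      by (subst measure_Diff[symmetric]) (auto intro!: arg_cong[of _ _ "measure _"])
    ultimately show ?thesis
      unfolding \<Lambda>_def by (simp add: Int_commute measure_def)
  qed
  have "(\<Lambda> has_vector_derivative norm (\<gamma>' x)) (at x within {p..q})" if x: "x \<in> {p..q}" for x
    unfolding has_vector_derivative_def has_derivative_within_alt
  proof (intro conjI allI impI)
    fix e :: real assume e: "0 < e"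
    obtain d where d: "0 < d" "\<And>y. y \<in> {p..q} \<Longrightarrow> \<bar>y - x\<bar> < d \<Longrightarrow> norm (\<gamma>' y - \<gamma>' x) \<le> e"
      using cont' x e unfolding continuous_on_iff dist_norm real_norm_def by (meson less_imp_le)
    have bd: "\<bar>measure arc_length (\<gamma> ` {s..t}) - (t - s) * norm (\<gamma>' x)\<bar> \<le> e * (t - s)"
      if st: "p \<le> s" "s \<le> t" "t \<le> q" "x \<in> {s..t}" "\<bar>s - x\<bar> < d" "\<bar>t - x\<bar> < d" for s t
    proof -
      have n: "norm (\<gamma>' y - \<gamma>' x) \<le> e" if "y \<in> {s..t}" for y
        using d(2)[of y] that st by auto
      have dv: "(\<gamma> has_vector_derivative \<gamma>' y) (at y within {s..t})" if "y \<in> {s..t}" for y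
        using der[of y] that st has_vector_derivative_within_subset[of \<gamma> _ y "{p..q}" "{s..t}"] by auto
      have em: "emeasure arc_length (\<gamma> ` {s..t}) = ennreal (measure arc_length (\<gamma> ` {s..t}))"
        using fin[of s t] st by (intro emeasure_eq_ennreal_measure) (auto simp: less_top)
      have "measure arc_length (\<gamma> ` {s..t}) \<le> (norm (\<gamma>' x) + e) * (t - s)"
      proof (rule iffD1[OF ennreal_le_iff])
        show "ennreal (measure arc_length (\<gamma> ` {s..t})) \<le> ennreal ((norm (\<gamma>' x) + e) * (t - s))"
          unfolding em[symmetric] by (rule arc_length_image_approx(1)[OF st(2) _ dv st(4) n]) (use e in auto)
      qed (use e st in auto)
      moreover have "(norm (\<gamma>' x) - e) * (t - s) \<le> measure arc_length (\<gamma> ` {s..t})"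
      proof (rule iffD1[OF ennreal_le_iff])
        show "ennreal ((norm (\<gamma>' x) - e) * (t - s)) \<le> ennreal (measure arc_length (\<gamma> ` {s..t}))"
          unfolding em[symmetric] by (rule arc_length_image_approx(2)[OF st(2) _ dv st(4) n]) (use e in auto)
      qed auto
      ultimately show ?thesis by (simp add: algebra_simps abs_le_iff)
    qed
    show "\<exists>d>0. \<forall>y\<in>{p..q}. norm (y - x) < d \<longrightarrow>
        norm (\<Lambda> y - \<Lambda> x - (y - x) *\<^sub>R norm (\<gamma>' x)) \<le> e * norm (y - x)"
    proof (intro exI[of _ d] conjI ballI impI d(1))
      fix y assume y: "y \<in> {p..q}" "norm (y - x) < d"
      show "norm (\<Lambda> y - \<Lambda> x - (y - x) *\<^sub>R norm (\<gamma>' x)) \<le> e * norm (y - x)"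
      proof (cases "x \<le> y")
        case True
        then show ?thesis using bd[of x y] add[of x y] x y d by (simp add: abs_minus_commute)
      next
        case False
        then show ?thesis using bd[of y x] add[of y x] x y d
          by (simp add: abs_minus_commute algebra_simps abs_le_iff)
      qed
    qed
  qed (rule bounded_linear_scaleR_left)
  then have hi: "((\<lambda>x. norm (\<gamma>' x)) has_integral (\<Lambda> q - \<Lambda> p)) {p..q}"
    by (intro fundamental_theorem_of_calculus pq)
  have "\<Lambda> p = 0" by (simp add: \<Lambda>_def measure_def)
  then have "emeasure arc_length (\<gamma> ` {p..q}) = ennreal (\<Lambda> q - \<Lambda> p)"
    using fin[of p q] by (simp add: \<Lambda>_def emeasure_eq_ennreal_measure less_top)
  also have "\<dots> = (\<integral>\<^sup>+x. ennreal (norm (\<gamma>' x)) * indicator {p..q} x \<partial>lborel)"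
    by (rule nn_integral_has_integral_lebesgue'[OF _ hi, symmetric]) simp
  finally show ?thesis .
qed

text \<open>
Both sides are finite measures in \<open>E\<close>, and they agree on intervals.
\<close>

lemma arc_length_image_injective_curve:
  fixes \<gamma> :: "real \<Rightarrow> complex"
  assumes der: "\<And>x. x \<in> {p..q} \<Longrightarrow> (\<gamma> has_vector_derivative \<gamma>' x) (at x within {p..q})"
    and cont': "continuous_on {p..q} \<gamma>'" and inj: "inj_on \<gamma> {p..q}"
    and E: "E \<in> sets borel" "E \<subseteq> {p..q}"
  shows "emeasure arc_length (\<gamma> ` E) = (\<integral>\<^sup>+x\<in>E. ennreal (norm (\<gamma>' x)) \<partial>lborel)"
proof -
  have cont: "continuous_on {p..q} \<gamma>"
    using der by (rule continuous_on_vector_derivative)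
  have B: "\<gamma> ` A \<in> sets borel" if "A \<in> sets borel" "A \<subseteq> {p..q}" for A
    by (rule borel_image_inj_on_compact[OF _ cont inj]) (use that in auto)
  have mj: "(\<lambda>x. indicator {p..q} x * norm (\<gamma>' x)) \<in> borel_measurable borel"
    using borel_measurable_continuous_on_indicator[of "{p..q}" "\<lambda>x. norm (\<gamma>' x)"] cont'
    by (simp add: continuous_on_norm)
  define q0 where "q0 = the_inv_into {p..q} \<gamma>"
  have q0: "q0 (\<gamma> x) = x" if "x \<in> {p..q}" for x
    using that inj by (simp add: q0_def the_inv_into_f_f)
  have cq: "continuous_on (\<gamma> ` {p..q}) q0"
    by (rule continuous_on_inv[OF cont]) (use q0 in auto)
  define Q where "Q = (\<lambda>z. indicator (\<gamma> ` {p..q}) z *\<^sub>R q0 z)"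
  have mQ: "Q \<in> borel_measurable borel" unfolding Q_def
    by (rule borel_measurable_continuous_on_indicator[OF B cq]) auto
  define G where "G = \<gamma> ` {p..q}"
  have G: "G \<in> sets borel" unfolding G_def by (rule B) auto
  define M1 where "M1 = distr (density arc_length (indicator G)) borel Q"
  define M2 where "M2 = density lborel (\<lambda>x. ennreal (indicator {p..q} x * norm (\<gamma>' x)))"
  have mQ': "Q \<in> density arc_length (indicator G) \<rightarrow>\<^sub>M borel"
    using mQ by (simp cong: measurable_cong_sets)
  have e1: "emeasure M1 A = emeasure arc_length (\<gamma> ` ({p..q} \<inter> A))" if "A \<in> sets borel" for A
  proof -
    have m: "Q -` A \<in> sets borel" using measurable_sets[OF mQ that] by simp
    have "emeasure M1 A = emeasure (density arc_length (indicator G)) (Q -` A)"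
      unfolding M1_def by (subst emeasure_distr[OF mQ' that]) simp
    also have "\<dots> = emeasure arc_length (G \<inter> Q -` A)"
      using m G by (subst emeasure_density) (auto simp: nn_integral_indicator[symmetric] indicator_inter_arith
        simp del: nn_integral_indicator cong: measurable_cong_sets)
    also have "G \<inter> Q -` A = \<gamma> ` ({p..q} \<inter> A)"
      using q0 by (auto simp: G_def Q_def)
    finally show ?thesis .
  qed
  have e2: "emeasure M2 A = (\<integral>\<^sup>+x\<in>({p..q} \<inter> A). ennreal (norm (\<gamma>' x)) \<partial>lborel)" if "A \<in> sets borel" for A
    unfolding M2_def using mj that
    by (subst emeasure_density) (auto intro!: nn_integral_cong simp: indicator_def)
  have key: "emeasure arc_length (\<gamma> ` {s..q}) = (\<integral>\<^sup>+x\<in>{s..q}. ennreal (norm (\<gamma>' x)) \<partial>lborel)"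
    if "p \<le> s" for s
  proof (cases "s \<le> q")
    case True
    show ?thesis
    proof (rule arc_length_image_Icc[OF True])
      show "(\<gamma> has_vector_derivative \<gamma>' x) (at x within {s..q})" if "x \<in> {s..q}" for x
        using der[of x] that \<open>p \<le> s\<close> has_vector_derivative_within_subset[of \<gamma> _ x "{p..q}" "{s..q}"] by auto
    qed (use that in \<open>auto intro: continuous_on_subset[OF cont'] inj_on_subset[OF inj]\<close>)
  qed simp
  have "M1 = M2"
  proof (rule measure_eqI_lessThan)
    fix x :: real
    show eq: "emeasure M1 {x<..} = emeasure M2 {x<..}"
    proof (cases "x < p")
      case True
      then have "{p..q} \<inter> {x<..} = {p..q}" by auto
      then show ?thesis using key[of p] by (simp add: e1 e2)
    next
      case False
      then have I: "{p..q} \<inter> {x<..} = {x<..q}" by auto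
      have "emeasure arc_length (\<gamma> ` {x<..q}) = emeasure arc_length (\<gamma> ` {x..q})"
      proof (cases "x \<le> q")
        case True
        have "{x<..q} \<subseteq> {p..q}" using False by auto
        then have gB: "\<gamma> ` {x<..q} \<in> sets borel" using B[of "{x<..q}"] by simp
        have "{x..q} = insert x {x<..q}" using True by auto
        then have "\<gamma> ` {x..q} = {\<gamma> x} \<union> \<gamma> ` {x<..q}" by simp
        then have "emeasure arc_length (\<gamma> ` {x..q}) \<le> emeasure arc_length {\<gamma> x} + emeasure arc_length (\<gamma> ` {x<..q})"
          using gB by (metis emeasure_subadditive borel_singleton sets.empty_sets sets_arc_length)
        moreover have "emeasure arc_length (\<gamma> ` {x<..q}) \<le> emeasure arc_length (\<gamma> ` {x..q})"
          using B[of "{x..q}"] False by (intro emeasure_mono) auto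
        ultimately show ?thesis by simp
      qed simp
      also have "\<dots> = (\<integral>\<^sup>+x\<in>{x..q}. ennreal (norm (\<gamma>' x)) \<partial>lborel)"
        using False by (intro key) auto
      also have "\<dots> = (\<integral>\<^sup>+x\<in>{x<..q}. ennreal (norm (\<gamma>' x)) \<partial>lborel)"
        using AE_lborel_singleton[of x]
        by (intro nn_integral_cong_AE) (auto simp: indicator_def elim!: eventually_mono)
      finally show ?thesis by (simp add: e1 e2 I)
    qed
    have "set_integrable lborel {p..q} (\<lambda>x. norm (\<gamma>' x))"
      using borel_integrable_compact[of "{p..q}" "\<lambda>x. norm (\<gamma>' x)"] cont'
      by (simp add: set_integrable_def continuous_on_norm)
    then have "(\<integral>\<^sup>+x. ennreal (norm (\<gamma>' x)) * indicator {p..q} x \<partial>lborel) < \<infinity>"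
      unfolding set_integrable_def integrable_iff_bounded
      by (auto elim!: le_less_trans[rotated] intro!: nn_integral_mono simp: indicator_def)
    then show "emeasure M1 {x<..} < \<infinity>"
      unfolding eq by (subst e2) (auto elim!: le_less_trans[rotated] intro!: nn_integral_mono simp: indicator_def)
  qed (simp_all add: M1_def M2_def)
  then have "emeasure M1 E = emeasure M2 E" by simp
  then show ?thesis using E by (simp add: e1 e2 Int_absorb1)
qed

section \<open>Logarithmic charts\<close>

text \<open>
Near a point where neither \<open>f\<close> nor \<open>f'\<close> vanishes, \<open>w = u + \<i> v = log f\<close> is a conformal coordinate; \<open>g\<close> is
its inverse. In this coordinate the level \<open>\<bar>f\<bar> = t\<close> is the vertical line \<open>u = ln t\<close>, arc length
along it is \<open>\<bar>g'\<bar> dv\<close>, area is \<open>\<bar>g'\<bar>\<^sup>2 du dv\<close>, and \<open>\<bar>f'\<bar> \<bar>g'\<bar> = exp u\<close>. The closed rectangle inside the open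
set \<open>V\<close> makes everything bounded and integrable.
\<close>
locale log_chart =
  fixes f g :: "complex \<Rightarrow> complex" and \<Omega> V :: "complex set" and p q :: complex
  assumes open_domain: "open \<Omega>" and holo: "f holomorphic_on \<Omega>"
    and open_V: "open V" and holo_g: "g holomorphic_on V" and inj_g: "inj_on g V"
    and g_into: "g ` V \<subseteq> \<Omega>" and f_g: "\<And>w. w \<in> V \<Longrightarrow> f (g w) = exp w"
    and box_V: "cbox p q \<subseteq> V" and Re_less: "Re p < Re q" and Im_less: "Im p < Im q"
begin

definition patch :: "complex set" where "patch = g ` cbox p q"

lemma g_has_deriv: "w \<in> V \<Longrightarrow> (g has_field_derivative deriv g w) (at w)"
  using holomorphic_derivI[OF holo_g open_V] by blast

lemma f_has_deriv: "z \<in> \<Omega> \<Longrightarrow> (f has_field_derivative deriv f z) (at z)"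
  using holomorphic_derivI[OF holo open_domain] by blast

lemma deriv_f_g: "w \<in> V \<Longrightarrow> deriv f (g w) * deriv g w = exp w"
proof -
  assume w: "w \<in> V"
  have "((\<lambda>w. f (g w)) has_field_derivative deriv f (g w) * deriv g w) (at w)"
    using w g_into by (intro DERIV_chain2[OF f_has_deriv g_has_deriv]) auto
  moreover have "(exp has_field_derivative exp w) (at w)" by (rule DERIV_exp)
  then have "((\<lambda>w. f (g w)) has_field_derivative exp w) (at w)"
    by (rule has_field_derivative_transform_within_open[OF _ open_V w]) (simp add: f_g)
  ultimately show ?thesis by (rule DERIV_unique)
qed

lemma deriv_g_nz: "w \<in> V \<Longrightarrow> deriv g w \<noteq> 0" and deriv_f_nz: "w \<in> V \<Longrightarrow> deriv f (g w) \<noteq> 0"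
  using deriv_f_g[of w] by auto

lemma norm_deriv_f_g: "w \<in> V \<Longrightarrow> norm (deriv f (g w)) * norm (deriv g w) = exp (Re w)"
  using deriv_f_g[of w] by (metis norm_exp_eq_Re norm_mult)

lemma norm_f_g: "w \<in> V \<Longrightarrow> norm (f (g w)) = exp (Re w)"
  by (simp add: f_g norm_exp_eq_Re)

lemma continuous_g: "S \<subseteq> V \<Longrightarrow> continuous_on S g"
  using holomorphic_on_imp_continuous_on[OF holo_g] continuous_on_subset by blast

lemma continuous_deriv_g: "S \<subseteq> V \<Longrightarrow> continuous_on S (deriv g)"
  using holomorphic_on_imp_continuous_on[OF holomorphic_deriv[OF holo_g open_V]] continuous_on_subset by blast

lemma inj_box: "inj_on g (cbox p q)"
  using inj_g box_V inj_on_subset by blast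

lemma compact_patch: "compact patch"
  unfolding patch_def by (intro compact_continuous_image continuous_g box_V compact_cbox)

lemma patch_borel [measurable, simp]: "patch \<in> sets borel"
  using compact_patch by (rule borel_compact)

lemma patch_subset: "patch \<subseteq> \<Omega>"
  using g_into box_V by (auto simp: patch_def)

lemma patch_regular: "z \<in> patch \<Longrightarrow> f z \<noteq> 0 \<and> deriv f z \<noteq> 0"
  using box_V deriv_f_nz f_g unfolding patch_def by auto

lemma Complex_in_box:
  "Complex u v \<in> cbox p q \<longleftrightarrow> u \<in> {Re p..Re q} \<and> v \<in> {Im p..Im q}"
  by (simp add: in_cbox_complex_iff)

lemma area_image:
  assumes "E \<in> sets borel" "E \<subseteq> cbox p q"
  shows "emeasure lborel (g ` E) = (\<integral>\<^sup>+w\<in>E. ennreal ((norm (deriv g w))\<^sup>2) \<partial>lborel)"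
  by (rule emeasure_injective_holomorphic_image[OF open_V holo_g inj_g compact_cbox box_V assms])

lemma area_nn_integral:
  assumes "h \<in> borel_measurable borel"
  shows "(\<integral>\<^sup>+z\<in>patch. h z \<partial>lborel) =
    (\<integral>\<^sup>+w. ennreal (indicator (cbox p q) w * (norm (deriv g w))\<^sup>2) * h (indicator (cbox p q) w *\<^sub>R g w) \<partial>lborel)"
  unfolding patch_def
  by (rule injective_parametrization.nn_integral_image, unfold_locales)
     (auto intro!: continuous_intros continuous_g continuous_deriv_g box_V inj_box area_image assms)

definition line :: "real \<Rightarrow> real \<Rightarrow> complex" where "line u v = g (Complex u v)"

lemma line_has_vector_derivative:
  assumes "Complex u v \<in> V"
  shows "(line u has_vector_derivative \<i> * deriv g (Complex u v)) (at v within S)"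
proof -
  have c: "((\<lambda>v. Complex u v) has_vector_derivative \<i>) (at v within S)"
    unfolding Complex_eq has_vector_derivative_def
    by (auto intro!: derivative_eq_intros simp: scaleR_conv_of_real)
  have "((g \<circ> Complex u) has_vector_derivative \<i> * deriv g (Complex u v)) (at v within S)"
    using field_vector_diff_chain_within[OF c, of g "deriv g (Complex u v)"] g_has_deriv[OF assms]
    by (simp add: has_field_derivative_at_within)
  then show ?thesis by (simp add: line_def[abs_def] o_def)
qed

lemma arc_length_line_image:
  assumes u: "u \<in> {Re p..Re q}" and E: "E \<in> sets borel" "E \<subseteq> {Im p..Im q}"
  shows "emeasure arc_length (line u ` E) = (\<integral>\<^sup>+v\<in>E. ennreal (norm (deriv g (Complex u v))) \<partial>lborel)"
proof -
  have V: "Complex u v \<in> V" if "v \<in> {Im p..Im q}" for v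
    using box_V u that Complex_in_box by blast
  have cC: "continuous_on S (Complex u)" for S
    unfolding Complex_eq by (intro continuous_intros)
  have "emeasure arc_length (line u ` E) = (\<integral>\<^sup>+v\<in>E. ennreal (norm (\<i> * deriv g (Complex u v))) \<partial>lborel)"
  proof (rule arc_length_image_injective_curve[OF line_has_vector_derivative _ _ E])
    show "continuous_on {Im p..Im q} (\<lambda>v. \<i> * deriv g (Complex u v))"
      by (intro continuous_intros continuous_on_compose2[OF continuous_deriv_g[OF order_refl] cC]) (use V in auto)
    show "inj_on (line u) {Im p..Im q}"
      using V inj_onD[OF inj_g] unfolding line_def by (intro inj_onI) (metis complex.inject)
  qed (use V in auto)
  then show ?thesis by (simp add: norm_mult)
qed

lemma line_continuous:
  assumes "u \<in> {Re p..Re q}"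
  shows "continuous_on {Im p..Im q} (line u)" "continuous_on {Im p..Im q} (\<lambda>v. norm (deriv g (Complex u v)))"
    "inj_on (line u) {Im p..Im q}"
proof -
  have V: "Complex u v \<in> V" if "v \<in> {Im p..Im q}" for v
    using box_V assms that Complex_in_box by blast
  have cC: "continuous_on S (Complex u)" for S
    unfolding Complex_eq by (intro continuous_intros)
  show "continuous_on {Im p..Im q} (line u)"
    unfolding line_def[abs_def]
    by (intro continuous_on_compose2[OF continuous_g[OF order_refl] cC]) (use V in auto)
  show "continuous_on {Im p..Im q} (\<lambda>v. norm (deriv g (Complex u v)))"
    by (intro continuous_intros continuous_on_compose2[OF continuous_deriv_g[OF order_refl] cC]) (use V in auto)
  show "inj_on (line u) {Im p..Im q}"
    using V inj_onD[OF inj_g] unfolding line_def by (intro inj_onI) (metis complex.inject)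
qed

lemma level_Int_patch:
  assumes "t > 0" "ln t \<in> {Re p..Re q}"
  shows "level_set f \<Omega> t \<inter> patch = line (ln t) ` {Im p..Im q}"
proof (intro set_eqI iffI)
  fix z assume z: "z \<in> level_set f \<Omega> t \<inter> patch"
  then obtain w where w: "w \<in> cbox p q" "z = g w" by (auto simp: patch_def)
  then have "exp (Re w) = t" using z norm_f_g[of w] box_V by (auto simp: level_set_def)
  then have "ln t = Re w" by auto
  then have "z = line (ln t) (Im w)" using w by (simp add: line_def)
  then show "z \<in> line (ln t) ` {Im p..Im q}" using w by (auto simp: in_cbox_complex_iff)
next
  fix z assume "z \<in> line (ln t) ` {Im p..Im q}"
  then obtain v where v: "v \<in> {Im p..Im q}" "z = g (Complex (ln t) v)" by (auto simp: line_def)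
  then have R: "Complex (ln t) v \<in> cbox p q" using assms by (simp add: Complex_in_box)
  then show "z \<in> level_set f \<Omega> t \<inter> patch"
    using v assms norm_f_g[of "Complex (ln t) v"] box_V patch_subset by (auto simp: level_set_def patch_def)
qed

lemma level_Int_patch_empty:
  assumes "\<not> (t > 0 \<and> ln t \<in> {Re p..Re q})"
  shows "level_set f \<Omega> t \<inter> patch = {}"
proof -
  have "t > 0 \<and> ln t \<in> {Re p..Re q}" if "w \<in> cbox p q" "norm (f (g w)) = t" for w
    using that norm_f_g[of w] box_V by (auto simp: in_cbox_complex_iff)
  then show ?thesis using assms by (auto simp: level_set_def patch_def)
qed

text \<open>
In the chart both integrals become the integral of \<open>h \<bar>g'\<bar> exp u\<close> over the rectangle: on the left
\<open>dt = exp u du\<close>, on the right \<open>\<bar>f'\<bar> \<bar>g'\<bar>\<^sup>2 = exp u \<bar>g'\<bar>\<close>. The function \<open>k\<close> is \<open>h \<bar>g'\<bar>\<close> in the chart,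
extended by \<open>0\<close> off the rectangle.
\<close>

lemma local_coarea:
  assumes h[measurable]: "h \<in> borel_measurable borel"
  shows "(\<lambda>t. \<integral>\<^sup>+z\<in>level_set f \<Omega> t \<inter> patch. h z \<partial>arc_length) \<in> borel_measurable borel" (is "?J \<in> _")
    and "(\<integral>\<^sup>+t. (\<integral>\<^sup>+z\<in>level_set f \<Omega> t \<inter> patch. h z \<partial>arc_length) \<partial>lborel)
       = (\<integral>\<^sup>+z\<in>patch. h z * ennreal (norm (deriv f z)) \<partial>lborel)"
proof -
  define k where "k = (\<lambda>w. ennreal (indicator (cbox p q) w * norm (deriv g w)) * h (indicator (cbox p q) w *\<^sub>R g w))"
  have mg: "(\<lambda>w. indicator (cbox p q) w *\<^sub>R g w) \<in> borel_measurable borel"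
    by (rule borel_measurable_continuous_on_indicator[OF _ continuous_g[OF box_V]]) auto
  have "(\<lambda>w. indicator (cbox p q) w *\<^sub>R norm (deriv g w)) \<in> borel_measurable borel"
    by (rule borel_measurable_continuous_on_indicator) (auto intro!: continuous_intros continuous_deriv_g box_V)
  then have [measurable]: "k \<in> borel_measurable borel"
    unfolding k_def using mg by simp
  note mC = measurable_Complex
  define K where "K = (\<lambda>u. \<integral>\<^sup>+v. k (Complex u v) \<partial>lborel)"
  have mK [measurable]: "K \<in> borel_measurable borel"
  proof -
    have "(\<lambda>x. \<integral>\<^sup>+y. (\<lambda>(u, v). k (Complex u v)) (x, y) \<partial>lborel) \<in> borel_measurable lborel"
      by (rule lborel.borel_measurable_nn_integral_fst)
        (use measurable_compose[OF mC, of k borel] in \<open>simp add: case_prod_unfold\<close>)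
    then show ?thesis by (simp add: K_def)
  qed
  have J: "?J t = K (ln t) * indicator {exp (Re p)..exp (Re q)} t" for t
  proof (cases "t > 0 \<and> ln t \<in> {Re p..Re q}")
    case True
    then have t: "t \<in> {exp (Re p)..exp (Re q)}"
      by (auto simp: ln_ge_iff) (metis exp_le_cancel_iff exp_ln)
    have "?J t = (\<integral>\<^sup>+v. ennreal (indicator {Im p..Im q} v * norm (deriv g (Complex (ln t) v)))
        * h (indicator {Im p..Im q} v *\<^sub>R line (ln t) v) \<partial>lborel)"
      unfolding level_Int_patch[OF conjunct1[OF True] conjunct2[OF True]]
      using line_continuous[of "ln t"] True
      by (intro injective_parametrization.nn_integral_image injective_parametrization.intro)
        (auto intro!: arc_length_line_image)
    also have "\<dots> = K (ln t)"
      unfolding K_def k_def using True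
      by (intro nn_integral_cong) (auto simp: indicator_def Complex_in_box line_def)
    finally show ?thesis using t by simp
  next
    case False
    then have "t \<notin> {exp (Re p)..exp (Re q)}"
      by (metis atLeastAtMost_iff exp_gt_zero exp_le_cancel_iff exp_ln order_less_le_trans)
    then show ?thesis using level_Int_patch_empty[OF False] by simp
  qed
  show "?J \<in> borel_measurable borel"
    unfolding J by measurable
  have "(\<integral>\<^sup>+t. ?J t \<partial>lborel) = (\<integral>\<^sup>+t. K (ln t) * indicator {exp (Re p)..exp (Re q)} t \<partial>lborel)"
    by (simp only: J)
  also have "\<dots> = (\<integral>\<^sup>+u. K (ln (exp u)) * ennreal (exp u) * indicator {Re p..Re q} u \<partial>lborel)"
    by (rule nn_integral_substitution_aux) (auto intro!: derivative_eq_intros continuous_intros Re_less)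
  also have "\<dots> = (\<integral>\<^sup>+u. (\<integral>\<^sup>+v. k (Complex u v) * ennreal (exp u) \<partial>lborel) \<partial>lborel)"
  proof (intro nn_integral_cong)
    fix u :: real
    have m: "(\<lambda>v. k (Complex u v)) \<in> borel_measurable lborel"
      unfolding Complex_eq by measurable
    have z: "k (Complex u v) = 0" if "u \<notin> {Re p..Re q}" for v
    proof -
      have "Complex u v \<notin> cbox p q" using that by (simp only: Complex_in_box) blast
      then show ?thesis by (simp add: k_def)
    qed
    have "(\<integral>\<^sup>+v. k (Complex u v) * ennreal (exp u) \<partial>lborel) = K u * ennreal (exp u)"
      unfolding K_def by (rule nn_integral_multc[OF m])
    then show "K (ln (exp u)) * ennreal (exp u) * indicator {Re p..Re q} u
        = (\<integral>\<^sup>+v. k (Complex u v) * ennreal (exp u) \<partial>lborel)"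
      by (cases "u \<in> {Re p..Re q}") (simp_all add: z)
  qed
  also have "\<dots> = (\<integral>\<^sup>+w. k w * ennreal (exp (Re w)) \<partial>lborel)"
    by (subst nn_integral_lborel_complex) simp_all
  also have "\<dots> = (\<integral>\<^sup>+w. ennreal (indicator (cbox p q) w * (norm (deriv g w))\<^sup>2) *
      (\<lambda>z. h z * ennreal (indicator patch z * norm (deriv f z))) (indicator (cbox p q) w *\<^sub>R g w) \<partial>lborel)"
  proof (intro nn_integral_cong)
    fix w
    show "k w * ennreal (exp (Re w)) = ennreal (indicator (cbox p q) w * (norm (deriv g w))\<^sup>2) *
      (\<lambda>z. h z * ennreal (indicator patch z * norm (deriv f z))) (indicator (cbox p q) w *\<^sub>R g w)"
    proof (cases "w \<in> cbox p q")
      case True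
      then have wV: "w \<in> V" and P: "g w \<in> patch" using box_V by (auto simp: patch_def)
      have "ennreal ((norm (deriv g w))\<^sup>2) * ennreal (norm (deriv f (g w))) =
          ennreal (norm (deriv g w)) * ennreal (exp (Re w))"
        unfolding norm_deriv_f_g[OF wV, symmetric]
        by (simp add: ennreal_mult[symmetric] power2_eq_square ac_simps)
      then show ?thesis using True P by (simp add: k_def mult_ac)
    qed (simp add: k_def)
  qed
  also have "\<dots> = (\<integral>\<^sup>+z\<in>patch. h z * ennreal (indicator patch z * norm (deriv f z)) \<partial>lborel)"
  proof (rule area_nn_integral[symmetric])
    have "continuous_on patch (deriv f)"
      using holomorphic_on_imp_continuous_on[OF holomorphic_deriv[OF holo open_domain]] patch_subset
        continuous_on_subset by blast
    then have "(\<lambda>z. indicator patch z *\<^sub>R norm (deriv f z)) \<in> borel_measurable borel"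
      by (intro borel_measurable_continuous_on_indicator continuous_intros) auto
    then show "(\<lambda>z. h z * ennreal (indicator patch z * norm (deriv f z))) \<in> borel_measurable borel"
      by simp
  qed
  also have "\<dots> = (\<integral>\<^sup>+z\<in>patch. h z * ennreal (norm (deriv f z)) \<partial>lborel)"
    by (intro nn_integral_cong) (auto simp: indicator_def)
  finally show "(\<integral>\<^sup>+t. ?J t \<partial>lborel) = (\<integral>\<^sup>+z\<in>patch. h z * ennreal (norm (deriv f z)) \<partial>lborel)" .
qed

lemma level_length_patch_finite: "emeasure arc_length (level_set f \<Omega> t \<inter> patch) < \<infinity>"
proof (cases "t > 0 \<and> ln t \<in> {Re p..Re q}")
  case True
  have "set_integrable lborel {Im p..Im q} (\<lambda>v. norm (deriv g (Complex (ln t) v)))"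
    unfolding set_integrable_def using True by (intro borel_integrable_compact line_continuous) auto
  then have "(\<integral>\<^sup>+v\<in>{Im p..Im q}. ennreal (norm (deriv g (Complex (ln t) v))) \<partial>lborel) < \<infinity>"
    unfolding set_integrable_def integrable_iff_bounded
    by (auto elim!: le_less_trans[rotated] intro!: nn_integral_mono simp: indicator_def)
  then show ?thesis
    using True level_Int_patch[of t] arc_length_line_image[of "ln t" "{Im p..Im q}"] by simp
qed (simp add: level_Int_patch_empty)

end

text \<open>
In a disc about \<open>z0\<close> where \<open>f z / f z0\<close> stays in the right half plane, the principal branch gives
a logarithm \<open>W\<close> of \<open>f\<close>. Its derivative \<open>f' / f\<close> does not vanish at \<open>z0\<close>, so \<open>W\<close> is locally invertible.
\<close>

lemma ex_log_chart:
  assumes "open \<Omega>" "f holomorphic_on \<Omega>" "z0 \<in> \<Omega>" "f z0 \<noteq> 0" "deriv f z0 \<noteq> 0"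
  shows "\<exists>g V p q \<rho>. log_chart f g \<Omega> V p q \<and> 0 < \<rho> \<and> cball z0 \<rho> \<subseteq> g ` box p q"
proof -
  have "isCont f z0"
    using assms(1-3) holomorphic_on_imp_continuous_on continuous_on_eq_continuous_at by blast
  then obtain d where d: "0 < d" "\<And>z. dist z z0 < d \<Longrightarrow> dist (f z) (f z0) < norm (f z0)"
    using assms(4) unfolding continuous_at_eps_delta by (metis zero_less_norm_iff)
  obtain e where e: "0 < e" "ball z0 e \<subseteq> \<Omega>" using assms(1,3) openE by blast
  define B where "B = ball z0 (min d e)"
  have B: "open B" "z0 \<in> B" "B \<subseteq> \<Omega>" using d e by (auto simp: B_def)
  have Re: "0 < Re (f z / f z0)" if "z \<in> B" for z
  proof -
    have "norm (f z / f z0 - 1) = norm (f z - f z0) / norm (f z0)"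
      using assms(4) by (simp add: norm_divide[symmetric] diff_divide_distrib)
    also have "\<dots> < 1" using d(2)[of z] that assms(4) by (simp add: B_def dist_norm norm_minus_commute)
    finally show ?thesis using abs_Re_le_cmod[of "f z / f z0 - 1"] by simp
  qed
  define W where "W = (\<lambda>z. Ln (f z / f z0) + Ln (f z0))"
  have nr: "f z / f z0 \<notin> \<real>\<^sub>\<le>\<^sub>0" if "z \<in> B" for z
    using Re[OF that] complex_nonpos_Reals_iff by force
  have holW: "W holomorphic_on B"
    unfolding W_def using nr holomorphic_on_subset[OF assms(2) B(3)] assms(4)
    by (intro holomorphic_intros) auto
  have expW: "exp (W z) = f z" if "z \<in> B" for z
    using Re[OF that] assms(4) unfolding W_def exp_add
    by (subst exp_Ln, force, subst exp_Ln) auto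
  have "deriv W z0 \<noteq> 0"
  proof
    assume 0: "deriv W z0 = 0"
    have "(W has_field_derivative deriv W z0) (at z0)" using holW B holomorphic_derivI by blast
    then have "((\<lambda>z. exp (W z)) has_field_derivative exp (W z0) * deriv W z0) (at z0)"
      by (rule DERIV_chain2[OF DERIV_exp])
    then have "(f has_field_derivative exp (W z0) * deriv W z0) (at z0)"
      by (rule has_field_derivative_transform_within_open[OF _ B(1,2) expW])
    then show False using 0 assms(5) DERIV_imp_deriv by fastforce
  qed
  then obtain r where r: "0 < r" "ball z0 r \<subseteq> B" "inj_on W (ball z0 r)"
    using has_complex_derivative_locally_injective[OF holW B(2) B(1)] by blast
  have holWr: "W holomorphic_on ball z0 r" using holW r holomorphic_on_subset by blast
  obtain g where g: "g holomorphic_on W ` ball z0 r" "\<And>z. z \<in> ball z0 r \<Longrightarrow> g (W z) = z"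
    using holomorphic_has_inverse[OF holWr open_ball r(3)] by metis
  define V where "V = W ` ball z0 r"
  have V: "open V" unfolding V_def by (rule open_mapping_thm3[OF holWr open_ball r(3)])
  have Wz: "W z0 \<in> V" using r by (auto simp: V_def)
  obtain s where s: "0 < s" "ball (W z0) s \<subseteq> V" using V Wz openE by blast
  \<comment> \<open>The corners are chosen so that the square stays within the disc of radius \<open>s\<close>.\<close>
  define p where "p = W z0 - Complex (s/4) (s/4)"
  define q where "q = W z0 + Complex (s/4) (s/4)"
  have box: "cbox p q \<subseteq> V"
  proof
    fix w assume w: "w \<in> cbox p q"
    have "norm (w - W z0) \<le> \<bar>Re (w - W z0)\<bar> + \<bar>Im (w - W z0)\<bar>" by (rule cmod_le)
    also have "\<dots> \<le> s/4 + s/4"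
      using w by (intro add_mono; simp only: in_cbox_complex_iff p_def q_def abs_le_iff) simp_all
    also have "\<dots> < s" using s by simp
    finally have "w \<in> ball (W z0) s" by (simp add: dist_norm norm_minus_commute)
    then show "w \<in> V" using s by blast
  qed
  have injg: "inj_on g V" unfolding V_def inj_on_def using g(2) by auto
  have chart: "log_chart f g \<Omega> V p q"
    using assms(1,2) V g r B expW box s injg
    by unfold_locales (auto simp: V_def p_def q_def subset_eq)
  have "open (g ` box p q)"
  proof (rule open_mapping_thm3)
    have "box p q \<subseteq> V" using box box_subset_cbox by blast
    then show "g holomorphic_on box p q" "inj_on g (box p q)"
      using g(1) injg holomorphic_on_subset inj_on_subset unfolding V_def by blast+
  qed (rule open_box)
  moreover have "z0 \<in> g ` box p q"
    using g(2)[of z0] r s by (intro image_eqI[of _ _ "W z0"]) (auto simp: in_box_complex_iff p_def q_def)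
  ultimately obtain \<rho> where "0 < \<rho>" "cball z0 \<rho> \<subseteq> g ` box p q"
    using open_contains_cball by blast
  then show ?thesis using chart by blast
qed

section \<open>The signed curvature of level curves\<close>

definition log_deriv :: "(complex \<Rightarrow> complex) \<Rightarrow> complex \<Rightarrow> complex" where
  "log_deriv f z = deriv f z / f z"

text \<open>
The unit vector \<open>\<nabla>\<bar>f\<bar> / \<bar>\<nabla>\<bar>f\<bar>\<bar>\<close>, because \<open>\<nabla>\<bar>f\<bar> = \<bar>f\<bar> cnj (f' / f)\<close> at points where \<open>f\<close> does not vanish.
\<close>
definition outward_normal :: "(complex \<Rightarrow> complex) \<Rightarrow> complex \<Rightarrow> complex" where
  "outward_normal f z = sgn (cnj (log_deriv f z))"

text \<open>
The divergence of the field of outward normals. In a logarithmic chart it equals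
\<open>Re (g'' / g') / \<bar>g'\<bar>\<close>.
\<close>
definition curvature_formula :: "(complex \<Rightarrow> complex) \<Rightarrow> complex \<Rightarrow> real" where
  "curvature_formula f z = - norm (log_deriv f z) * Re (deriv (log_deriv f) z / (log_deriv f z)\<^sup>2)"

lemma cnj_sgn_eq: "z \<noteq> 0 \<Longrightarrow> cnj (sgn z) = of_real (norm z) / z"
  using complex_norm_square[of z] by (simp add: sgn_eq field_simps power2_eq_square)

lemma sgn_cnj_eq: "z \<noteq> 0 \<Longrightarrow> sgn (cnj z) = of_real (norm z) / z"
  using complex_norm_square[of z] by (simp add: sgn_eq field_simps power2_eq_square)

lemma inner_complex_eq_Re: "x \<bullet> y = Re (x * cnj y)"
  by (simp add: inner_complex_def)

lemma gradient_norm_holomorphic: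
  assumes "(f has_field_derivative D) (at z)" "f z \<noteq> 0"
  shows "gradient (\<lambda>w. norm (f w)) z = of_real (norm (f z)) * cnj (D / f z)"
proof -
  have "((\<lambda>w. norm (f w)) has_derivative (\<lambda>h. (D * h) \<bullet> sgn (f z))) (at z)"
    using has_derivative_compose[OF assms(1)[unfolded has_field_derivative_def] has_derivative_norm[OF assms(2)]]
    by simp
  moreover have "(D * h) \<bullet> sgn (f z) = h \<bullet> (of_real (norm (f z)) * cnj (D / f z))" for h
  proof -
    have "(D * h) \<bullet> sgn (f z) = Re (D * h * (of_real (norm (f z)) / f z))"
      by (simp only: inner_complex_eq_Re cnj_sgn_eq[OF assms(2)])
    also have "\<dots> = Re (h * cnj (of_real (norm (f z)) * cnj (D / f z)))"
      by (intro arg_cong[of _ _ Re]) simp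
    finally show ?thesis by (simp only: inner_complex_eq_Re)
  qed
  ultimately have g: "GDERIV (\<lambda>w. norm (f w)) z :> of_real (norm (f z)) * cnj (D / f z)"
    by (simp add: gderiv_def)
  show ?thesis unfolding gradient_def
  proof (rule the_equality, rule g)
    fix E assume "GDERIV (\<lambda>w. norm (f w)) z :> E"
    then have "(\<lambda>h. h \<bullet> E) = (\<lambda>h. h \<bullet> (of_real (norm (f z)) * cnj (D / f z)))"
      using g unfolding gderiv_def by (rule has_derivative_unique)
    then show "E = of_real (norm (f z)) * cnj (D / f z)"
      by (metis inner_commute vector_eq_ldot)
  qed
qed

lemma level_normal_eq:
  assumes "f field_differentiable at z" "f z \<noteq> 0"
  shows "level_normal f z = - outward_normal f z"
    and "level_tangent f z = \<i> * outward_normal f z"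
proof -
  have "(f has_field_derivative deriv f z) (at z)"
    using assms(1) by (simp add: field_differentiable_derivI)
  from gradient_norm_holomorphic[OF this assms(2)]
  have "gradient (\<lambda>w. norm (f w)) z = norm (f z) *\<^sub>R cnj (log_deriv f z)"
    by (simp add: log_deriv_def scaleR_conv_of_real)
  then show N: "level_normal f z = - outward_normal f z"
    using assms(2) by (simp add: level_normal_def outward_normal_def sgn_div_norm)
  show "level_tangent f z = \<i> * outward_normal f z"
    by (simp add: level_tangent_def N)
qed

text \<open>
A unit vector can only turn: writing \<open>y = \<bar>y\<bar> exp (\<i> a)\<close>, the field \<open>sgn (cnj y)\<close> is \<open>exp (- \<i> a)\<close>, and
the rate of change of \<open>a\<close> is \<open>Im (y' / y)\<close>.
\<close>

lemma has_vector_derivative_sgn_cnj: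
  assumes y: "(y has_vector_derivative y') (at s)" and nz: "y s \<noteq> (0::complex)"
  shows "((\<lambda>s. \<i> * sgn (cnj (y s))) has_vector_derivative (Im (y' / y s) *\<^sub>R sgn (cnj (y s)))) (at s)"
proof -
  have yd: "(y has_derivative (\<lambda>h. h *\<^sub>R y')) (at s)" using y by (simp add: has_vector_derivative_def)
  have n: "((\<lambda>s. norm (y s)) has_derivative (\<lambda>h. (h *\<^sub>R y') \<bullet> sgn (y s))) (at s)"
    using has_derivative_compose[OF yd has_derivative_norm[OF nz]] .
  have c: "((\<lambda>s. cnj (y s)) has_derivative (\<lambda>h. cnj (h *\<^sub>R y'))) (at s)"
    by (rule bounded_linear.has_derivative[OF bounded_linear_cnj yd])
  have "((\<lambda>s. \<i> * (inverse (norm (y s)) *\<^sub>R cnj (y s))) has_derivative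
     (\<lambda>h. \<i> * (inverse (norm (y s)) *\<^sub>R cnj (h *\<^sub>R y')
       + (- (inverse (norm (y s)) * ((h *\<^sub>R y') \<bullet> sgn (y s)) * inverse (norm (y s)))) *\<^sub>R cnj (y s)))) (at s)"
    by (intro has_derivative_mult_right has_derivative_scaleR[OF Deriv.has_derivative_inverse[OF _ n] c]) (use nz in simp)
  then have "((\<lambda>s. \<i> * sgn (cnj (y s))) has_derivative
     (\<lambda>h. \<i> * (inverse (norm (y s)) *\<^sub>R cnj (h *\<^sub>R y')
       + (- (inverse (norm (y s)) * ((h *\<^sub>R y') \<bullet> sgn (y s)) * inverse (norm (y s)))) *\<^sub>R cnj (y s)))) (at s)"
    by (simp add: sgn_div_norm)
  moreover have "\<i> * (inverse (norm (y s)) *\<^sub>R cnj (h *\<^sub>R y')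
       + (- (inverse (norm (y s)) * ((h *\<^sub>R y') \<bullet> sgn (y s)) * inverse (norm (y s)))) *\<^sub>R cnj (y s))
      = h *\<^sub>R (Im (y' / y s) *\<^sub>R sgn (cnj (y s)))" for h
  proof -
    let ?n = "norm (y s)"
    have n0: "?n \<noteq> 0" using nz by simp
    have nn: "?n * ?n = Re (y s) * Re (y s) + Im (y s) * Im (y s)"
      using cmod_power2[of "y s"] by (simp add: power2_eq_square)
    have 1: "(h *\<^sub>R y') \<bullet> sgn (y s) = h * (Re y' * Re (y s) + Im y' * Im (y s)) / ?n"
      by (simp add: inner_complex_def sgn_div_norm divide_inverse distrib_left mult_ac)
    have 2: "Im (y' / y s) = (Im y' * Re (y s) - Re y' * Im (y s)) / (?n * ?n)"
      using nn by (simp add: Im_divide power2_eq_square)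
    have key: "?n * ?n * Re y' = (Re y' * Re (y s) + Im y' * Im (y s)) * Re (y s)
         - (Im y' * Re (y s) - Re y' * Im (y s)) * Im (y s)"
      "?n * ?n * Im y' = (Re y' * Re (y s) + Im y' * Im (y s)) * Im (y s)
         + (Im y' * Re (y s) - Re y' * Im (y s)) * Re (y s)"
      unfolding nn by algebra+
    have cube: "x / ?n = ((?n * ?n) * x) / (?n * (?n * ?n))" for x
      using n0 by simp
    show ?thesis unfolding 1 2
    proof (rule complex_eqI, goal_cases)
      case 1
      have "Im y' / ?n - (Re y' * Re (y s) + Im y' * Im (y s)) * Im (y s) / (?n * (?n * ?n))
          = (Im y' * Re (y s) - Re y' * Im (y s)) * Re (y s) / (?n * (?n * ?n))"
        unfolding cube[of "Im y'"] key(2) diff_divide_distrib[symmetric] by simp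
      from arg_cong[OF this, of "(*) h"] show ?case
        by (simp add: sgn_div_norm divide_inverse right_diff_distrib mult_ac)
    next
      case 2
      have "Re y' / ?n - (Re y' * Re (y s) + Im y' * Im (y s)) * Re (y s) / (?n * (?n * ?n))
          = - ((Im y' * Re (y s) - Re y' * Im (y s)) * Im (y s) / (?n * (?n * ?n)))"
        unfolding cube[of "Re y'"] key(1) diff_divide_distrib[symmetric] by simp
      from arg_cong[OF this, of "(*) h"] show ?case
        by (simp add: sgn_div_norm divide_inverse right_diff_distrib mult_ac)
    qed
  qed
  ultimately show ?thesis by (simp add: has_vector_derivative_def)
qed

lemma log_deriv_holomorphic:
  assumes "open \<Omega>" "f holomorphic_on \<Omega>"
  shows "log_deriv f holomorphic_on (\<Omega> - critical_points f \<Omega>)"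
proof -
  have "(\<lambda>z. deriv f z / f z) holomorphic_on (\<Omega> - critical_points f \<Omega>)"
    using assms holomorphic_deriv[OF assms(2,1)]
    by (intro holomorphic_on_divide) (auto simp: critical_points_def elim: holomorphic_on_subset)
  then show ?thesis by (simp add: log_deriv_def[abs_def])
qed

lemma open_regular_points:
  assumes "open \<Omega>" "f holomorphic_on \<Omega>"
  shows "open (\<Omega> - critical_points f \<Omega>)"
proof -
  have "open {z \<in> \<Omega>. f z * deriv f z \<in> - {0}}"
    using assms holomorphic_deriv[OF assms(2,1)]
    by (intro continuous_open_preimage[where f="\<lambda>z. f z * deriv f z", unfolded vimage_def Int_def mem_Collect_eq]
        continuous_intros holomorphic_on_imp_continuous_on) auto
  moreover have "{z \<in> \<Omega>. f z * deriv f z \<in> - {0}} = \<Omega> - critical_points f \<Omega>"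
    by (auto simp: critical_points_def)
  ultimately show ?thesis by simp
qed

lemma log_deriv_nz: "z \<in> \<Omega> - critical_points f \<Omega> \<Longrightarrow> log_deriv f z \<noteq> 0"
  by (auto simp: log_deriv_def critical_points_def)

text \<open>
The unit tangent is a differentiable vector field near a regular point, so the derivative of
\<open>T\<close> along a curve depends only on the velocity of the curve, which is \<open>T\<close> itself. This makes the
curvature unique without any appeal to uniqueness of the curve.
\<close>

lemma has_signed_curvature_imp_formula:
  assumes \<Omega>: "open \<Omega>" "f holomorphic_on \<Omega>" and z: "z \<in> \<Omega> - critical_points f \<Omega>"
    and \<gamma>: "\<gamma> 0 = z" "(\<gamma> has_vector_derivative level_tangent f z) (at 0)"
  shows "((\<lambda>s. level_tangent f (\<gamma> s)) has_vector_derivative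
           curvature_formula f z *\<^sub>R level_normal f z) (at 0)"
proof -
  let ?U = "\<Omega> - critical_points f \<Omega>" and ?h = "log_deriv f"
  have oU: "open ?U" by (rule open_regular_points[OF \<Omega>])
  have nt: "level_normal f w = - outward_normal f w" "level_tangent f w = \<i> * outward_normal f w"
    if "w \<in> ?U" for w
    using that level_normal_eq[of f w] holomorphic_on_imp_differentiable_at[OF \<Omega>(2,1)]
    by (auto simp: critical_points_def)
  have hd: "(?h has_field_derivative deriv ?h z) (at z)"
    using holomorphic_derivI[OF log_deriv_holomorphic[OF \<Omega>] oU z] .
  have nz: "?h z \<noteq> 0" by (rule log_deriv_nz[OF z])
  have "((?h \<circ> \<gamma>) has_vector_derivative level_tangent f z * deriv ?h z) (at 0)"
    using field_vector_diff_chain_at[OF \<gamma>(2)] hd \<gamma>(1) by simp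
  then have "((\<lambda>s. \<i> * sgn (cnj ((?h \<circ> \<gamma>) s))) has_vector_derivative
      Im (level_tangent f z * deriv ?h z / (?h \<circ> \<gamma>) 0) *\<^sub>R sgn (cnj ((?h \<circ> \<gamma>) 0))) (at 0)"
    by (rule has_vector_derivative_sgn_cnj) (simp add: \<gamma>(1) nz)
  moreover have "Im (level_tangent f z * deriv ?h z / ?h z) *\<^sub>R sgn (cnj (?h z))
      = curvature_formula f z *\<^sub>R level_normal f z"
  proof -
    have "level_tangent f z * deriv ?h z / ?h z
        = \<i> * (of_real (norm (?h z)) * (deriv ?h z / (?h z)\<^sup>2))"
      using nt(2)[OF z] by (simp add: outward_normal_def sgn_cnj_eq[OF nz] power2_eq_square)
    then have "Im (level_tangent f z * deriv ?h z / ?h z) = - curvature_formula f z"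
    proof -
      have gen: "Im (\<i> * (of_real r * c)) = r * Re c" for r c by simp
      show ?thesis
        unfolding \<open>level_tangent f z * deriv ?h z / ?h z = _\<close> curvature_formula_def gen by simp
    qed
    then show ?thesis by (simp add: nt(1)[OF z] outward_normal_def)
  qed
  ultimately have d: "((\<lambda>s. \<i> * sgn (cnj (?h (\<gamma> s)))) has_vector_derivative
      curvature_formula f z *\<^sub>R level_normal f z) (at 0)"
    using \<gamma>(1) by (simp add: o_def)
  have "isCont \<gamma> 0" using \<gamma>(2) has_vector_derivative_continuous by blast
  then have ev: "\<forall>\<^sub>F s in at 0. \<gamma> s \<in> ?U"
    using oU z \<gamma>(1) topological_tendstoD unfolding isCont_def by metis
  show ?thesis
    using d unfolding has_vector_derivative_def
    by (rule has_derivative_transform_eventually)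
      (use ev nt z \<gamma> in \<open>auto simp: outward_normal_def elim!: eventually_mono\<close>)
qed

context log_chart begin

lemma log_deriv_g: "w \<in> V \<Longrightarrow> log_deriv f (g w) = inverse (deriv g w)"
  using deriv_f_g[of w] f_g[of w] deriv_g_nz[of w] by (simp add: log_deriv_def field_simps)

lemma outward_normal_g: "w \<in> V \<Longrightarrow> outward_normal f (g w) = sgn (deriv g w)"
proof -
  assume w: "w \<in> V"
  have "cnj (inverse (deriv g w)) = inverse ((norm (deriv g w))\<^sup>2) *\<^sub>R deriv g w"
    using deriv_g_nz[OF w] complex_norm_square[of "deriv g w"]
    by (simp add: scaleR_conv_of_real field_simps)
  then show ?thesis
    using deriv_g_nz[OF w] by (simp add: outward_normal_def log_deriv_g[OF w] sgn_scaleR)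
qed

lemma V_regular: "w \<in> V \<Longrightarrow> g w \<in> \<Omega> - critical_points f \<Omega>"
  using deriv_f_nz[of w] f_g[of w] g_into by (auto simp: critical_points_def)

text \<open>
The logarithmic derivative of \<open>f\<close> pulls back to \<open>1 / g'\<close>. Since
\<open>Re (g'' / g')\<close> is the derivative of \<open>ln \<bar>g'\<bar>\<close> in the direction of \<open>u\<close>, the curvature is the relative growth
of arc length from one level to the next.
\<close>

lemma curvature_formula_g:
  assumes "w \<in> V"
  shows "curvature_formula f (g w) = Re (deriv (deriv g) w / deriv g w) / norm (deriv g w)"
proof -
  have hd: "(log_deriv f has_field_derivative deriv (log_deriv f) (g w)) (at (g w))"
    using holomorphic_derivI[OF log_deriv_holomorphic[OF open_domain holo] open_regular_points[OF open_domain holo] V_regular[OF assms]] .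
  have "((\<lambda>w. log_deriv f (g w)) has_field_derivative deriv (log_deriv f) (g w) * deriv g w) (at w)"
    by (rule DERIV_chain2[OF hd g_has_deriv[OF assms]])
  moreover have gg: "(deriv g has_field_derivative deriv (deriv g) w) (at w)"
    using holomorphic_derivI[OF holomorphic_deriv[OF holo_g open_V] open_V assms] .
  have "((\<lambda>w. inverse (deriv g w)) has_field_derivative - (inverse (deriv g w) * deriv (deriv g) w * inverse (deriv g w))) (at w)"
    by (rule DERIV_inverse'[OF gg deriv_g_nz[OF assms]])
  then have "((\<lambda>w. log_deriv f (g w)) has_field_derivative - (inverse (deriv g w) * deriv (deriv g) w * inverse (deriv g w))) (at w)"
    by (rule has_field_derivative_transform_within_open[OF _ open_V assms]) (simp add: log_deriv_g)
  ultimately have "deriv (log_deriv f) (g w) * deriv g w = - (inverse (deriv g w) * deriv (deriv g) w * inverse (deriv g w))"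
    by (rule DERIV_unique)
  then have "deriv (log_deriv f) (g w) / (log_deriv f (g w))\<^sup>2 = - (deriv (deriv g) w / deriv g w)"
  proof -
    have "deriv (log_deriv f) (g w) / (log_deriv f (g w))\<^sup>2
        = (deriv (log_deriv f) (g w) * deriv g w) * deriv g w"
      by (simp add: log_deriv_g[OF assms] power2_eq_square divide_inverse)
    also have "\<dots> = - (deriv (deriv g) w / deriv g w)"
      unfolding \<open>deriv (log_deriv f) (g w) * deriv g w = _\<close>
      using deriv_g_nz[OF assms] by (simp add: field_simps)
    finally show ?thesis .
  qed
  then show ?thesis
    by (simp add: curvature_formula_def log_deriv_g[OF assms] norm_inverse norm_divide field_simps)
qed

text \<open>
A curve with unit speed on the level is obtained from the vertical line through \<open>w0\<close> by
inverting its arc length function \<open>\<sigma>\<close>.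
\<close>

lemma ex_signed_curvature:
  assumes w0: "w0 \<in> box p q"
  shows "has_signed_curvature f (g w0) (curvature_formula f (g w0))"
proof -
  define u where "u = Re w0"
  define v0 where "v0 = Im w0"
  have uI: "u \<in> {Re p..Re q}" and v0: "Im p < v0" "v0 < Im q"
    using w0 by (auto simp: in_box_complex_iff u_def v0_def)
  define j where "j = (\<lambda>v. norm (deriv g (Complex u v)))"
  have V: "Complex u v \<in> V" if "v \<in> {Im p..Im q}" for v
    using box_V uI that Complex_in_box by blast
  have cj: "continuous_on {Im p..Im q} j" unfolding j_def by (rule line_continuous(2)[OF uI])
  have j0: "0 < j v" if "v \<in> {Im p..Im q}" for v
    using deriv_g_nz[OF V[OF that]] by (simp add: j_def)
  define \<sigma> where "\<sigma> = (\<lambda>v. integral {Im p..v} j - integral {Im p..v0} j)"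
  have ds: "(\<sigma> has_real_derivative j v) (at v)" if "v \<in> {Im p<..<Im q}" for v
  proof -
    have "((\<lambda>v. integral {Im p..v} j) has_real_derivative j v) (at v within {Im p..Im q})"
      by (rule integral_has_real_derivative[OF cj]) (use that in auto)
    moreover have "at v within {Im p..Im q} = at v"
      by (rule at_within_interior) (use that in \<open>simp add: interior_atLeastAtMost_real\<close>)
    ultimately show ?thesis unfolding \<sigma>_def by (auto intro!: derivative_eq_intros)
  qed
  \<comment> \<open>An interval strictly inside the chart, so that \<open>\<sigma>\<close> is differentiable at its end points too.\<close>
  define a where "a = (Im p + v0) / 2"
  define b where "b = (v0 + Im q) / 2"
  have ab: "Im p < a" "a < v0" "v0 < b" "b < Im q" using v0 by (auto simp: a_def b_def)
  have mono: "\<sigma> x < \<sigma> y" if "a \<le> x" "x < y" "y \<le> b" for x y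
  proof (rule DERIV_pos_imp_increasing[OF that(2)])
    fix z assume "x \<le> z" "z \<le> y"
    then have "z \<in> {Im p<..<Im q}" using that ab by auto
    then show "\<exists>D. (\<sigma> has_real_derivative D) (at z) \<and> 0 < D"
      using ds[of z] j0[of z] by (intro exI[of _ "j z"]) auto
  qed
  have c\<sigma>: "isCont \<sigma> x" if "a \<le> x" "x \<le> b" for x
    using ds[of x] DERIV_isCont that ab by auto
  have inj: "inj_on \<sigma> {a..b}"
    by (rule inj_onI) (metis atLeastAtMost_iff linorder_neqE_linordered_idom mono order_less_irrefl)
  define \<theta> where "\<theta> = the_inv_into {a..b} \<sigma>"
  have \<theta>\<sigma>: "\<theta> (\<sigma> x) = x" if "a \<le> x" "x \<le> b" for x
    using the_inv_into_f_f[OF inj, of x] that by (simp add: \<theta>_def)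
  have \<sigma>0: "\<sigma> v0 = 0" by (simp add: \<sigma>_def)
  have in_range: "\<exists>x. a < x \<and> x < b \<and> \<sigma> x = s" if "\<sigma> a < s" "s < \<sigma> b" for s
  proof -
    have "\<exists>x\<ge>a. x \<le> b \<and> \<sigma> x = s"
      by (rule IVT) (use that ab c\<sigma> in auto)
    then obtain x where "a \<le> x" "x \<le> b" "\<sigma> x = s" by blast
    then show ?thesis using that by (metis order_less_irrefl order_le_imp_less_or_eq)
  qed
  have d\<theta>: "(\<theta> has_real_derivative inverse (j (\<theta> s))) (at s)" and \<theta>in: "a < \<theta> s" "\<theta> s < b"
    if s: "\<sigma> a < s" "s < \<sigma> b" for s
  proof -
    obtain x where x: "a < x" "x < b" "\<sigma> x = s" using in_range[OF s] by blast
    have tx: "\<theta> s = x" using \<theta>\<sigma>[of x] x by simp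
    then show "a < \<theta> s" "\<theta> s < b" using x by auto
    have "isCont \<theta> (\<sigma> x)"
      by (rule isCont_inverse_function2[OF x(1,2)]) (use \<theta>\<sigma> c\<sigma> in auto)
    then have ct: "isCont \<theta> s" using x by simp
    have xi: "x \<in> {Im p<..<Im q}" using x ab by auto
    show "(\<theta> has_real_derivative inverse (j (\<theta> s))) (at s)"
    proof (rule DERIV_inverse_function[OF _ _ s _ ct])
      show "(\<sigma> has_real_derivative j (\<theta> s)) (at (\<theta> s))" using ds[OF xi] tx by simp
      show "j (\<theta> s) \<noteq> 0" using j0[of x] xi tx by auto
      show "\<sigma> (\<theta> y) = y" if "\<sigma> a < y" "y < \<sigma> b" for y
        using in_range[OF that] \<theta>\<sigma> by force
    qed
  qed
  define \<epsilon> where "\<epsilon> = min (\<sigma> b) (- \<sigma> a)"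
  have \<epsilon>: "0 < \<epsilon>" using mono[of a v0] mono[of v0 b] ab \<sigma>0 by (auto simp: \<epsilon>_def)
  define \<gamma> where "\<gamma> = (\<lambda>s. line u (\<theta> s))"
  have g0: "\<gamma> 0 = g w0"
    using \<theta>\<sigma>[of v0] ab \<sigma>0 by (simp add: \<gamma>_def line_def u_def v0_def)
  have curve: "norm (f (\<gamma> s)) = norm (f (g w0)) \<and> (\<gamma> has_vector_derivative level_tangent f (\<gamma> s)) (at s)"
    if "s \<in> {-\<epsilon><..<\<epsilon>}" for s
  proof -
    have s: "\<sigma> a < s" "s < \<sigma> b" using that by (auto simp: \<epsilon>_def)
    have wV: "Complex u (\<theta> s) \<in> V" using V \<theta>in[OF s] ab by auto
    have w0V: "w0 \<in> V" using w0 box_V box_subset_cbox by blast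
    have n: "norm (f (\<gamma> s)) = norm (f (g w0))"
      using norm_f_g[OF wV] norm_f_g[OF w0V] by (simp add: \<gamma>_def line_def u_def)
    have "(\<theta> has_vector_derivative inverse (j (\<theta> s))) (at s)"
      using d\<theta>[OF s] by (simp add: has_real_derivative_iff_has_vector_derivative)
    then have "((line u \<circ> \<theta>) has_vector_derivative inverse (j (\<theta> s)) *\<^sub>R (\<i> * deriv g (Complex u (\<theta> s)))) (at s)"
      by (rule vector_diff_chain_at) (rule line_has_vector_derivative[OF wV])
    moreover have "inverse (j (\<theta> s)) *\<^sub>R (\<i> * deriv g (Complex u (\<theta> s))) = level_tangent f (\<gamma> s)"
    proof -
      have "\<gamma> s \<in> \<Omega>" "f (\<gamma> s) \<noteq> 0" using V_regular[OF wV] by (auto simp: \<gamma>_def line_def critical_points_def)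
      then have "level_tangent f (\<gamma> s) = \<i> * outward_normal f (\<gamma> s)"
        using level_normal_eq(2) holomorphic_on_imp_differentiable_at[OF holo open_domain] by blast
      then show ?thesis using outward_normal_g[OF wV]
        by (simp add: \<gamma>_def line_def j_def sgn_div_norm)
    qed
    ultimately show ?thesis using n by (simp add: \<gamma>_def o_def)
  qed
  have w0V: "w0 \<in> V" using w0 box_V box_subset_cbox by blast
  have "((\<lambda>s. level_tangent f (\<gamma> s)) has_vector_derivative
           curvature_formula f (g w0) *\<^sub>R level_normal f (g w0)) (at 0)"
    by (rule has_signed_curvature_imp_formula[where \<gamma>=\<gamma> and \<Omega>=\<Omega>, OF open_domain holo V_regular[OF w0V] g0])
      (use curve[of 0] \<epsilon> g0 in auto)
  then show ?thesis unfolding has_signed_curvature_def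
    using g0 \<epsilon> curve by (intro exI[of _ \<gamma>] exI[of _ \<epsilon>]) auto
qed

end

lemma signed_curvature_eq_formula:
  assumes \<Omega>: "open \<Omega>" "f holomorphic_on \<Omega>" and z: "z \<in> \<Omega> - critical_points f \<Omega>"
  shows "signed_curvature f z = curvature_formula f z"
proof -
  have "z \<in> \<Omega>" "f z \<noteq> 0" "deriv f z \<noteq> 0" using z by (auto simp: critical_points_def)
  then obtain g V p q \<rho> where c: "log_chart f g \<Omega> V p q" "0 < \<rho>" "cball z \<rho> \<subseteq> g ` box p q"
    using ex_log_chart[OF \<Omega>] by blast
  then obtain w0 where w0: "w0 \<in> box p q" "z = g w0" by (metis centre_in_cball imageE less_imp_le subsetD)
  have ex: "has_signed_curvature f z (curvature_formula f z)"
    using log_chart.ex_signed_curvature[OF c(1) w0(1)] w0 by simp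
  show ?thesis unfolding signed_curvature_def
  proof (rule the_equality, rule ex)
    fix k assume "has_signed_curvature f z k"
    then obtain \<gamma> :: "real \<Rightarrow> complex" and e where g: "0 < e" "\<gamma> 0 = z"
      "\<And>s. s \<in> {-e<..<e} \<Longrightarrow> (\<gamma> has_vector_derivative level_tangent f (\<gamma> s)) (at s)"
      "((\<lambda>s. level_tangent f (\<gamma> s)) has_vector_derivative k *\<^sub>R level_normal f z) (at 0)"
      unfolding has_signed_curvature_def by blast
    have "(\<gamma> has_vector_derivative level_tangent f z) (at 0)" using g(1,2) g(3)[of 0] by simp
    from has_signed_curvature_imp_formula[OF \<Omega> z g(2) this] g(4)
    have "curvature_formula f z *\<^sub>R level_normal f z = k *\<^sub>R level_normal f z"
      by (rule vector_derivative_unique_at)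
    moreover have "level_normal f z \<noteq> 0"
      using level_normal_eq(1)[of f z] z log_deriv_nz[OF z] holomorphic_on_imp_differentiable_at[OF \<Omega>(2,1)]
      by (auto simp: outward_normal_def sgn_zero_iff critical_points_def)
    ultimately show "k = curvature_formula f z" by simp
  qed
qed

section \<open>The coarea formula on a compact band\<close>

locale analytic_band =
  fixes f :: "complex \<Rightarrow> complex" and \<Omega> :: "complex set" and a b :: real
  assumes open_domain: "open \<Omega>" and connected_domain: "connected \<Omega>"
    and holo: "f holomorphic_on \<Omega>" and nonconst: "\<not> f constant_on \<Omega>"
    and a_less_b: "a < b" and compact_band: "compact (level_band f \<Omega> a b)"
begin

abbreviation band :: "complex set" where "band \<equiv> level_band f \<Omega> a b"
abbreviation level :: "real \<Rightarrow> complex set" where "level \<equiv> level_set f \<Omega>"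
abbreviation crit :: "complex set" where "crit \<equiv> critical_points f \<Omega>"
abbreviation regular_part :: "complex set" where "regular_part \<equiv> \<Omega> - crit"

lemma open_regular_part: "open regular_part"
  by (rule open_regular_points[OF open_domain holo])

lemma band_subset: "band \<subseteq> \<Omega>" by (auto simp: level_band_def)

lemma deriv_not_identically_zero: "\<exists>z\<in>\<Omega>. deriv f z \<noteq> 0"
proof (rule ccontr)
  assume "\<not> ?thesis"
  then have "(f has_field_derivative 0) (at z)" if "z \<in> \<Omega>" for z
    using holomorphic_derivI[OF holo open_domain that] that by auto
  then have "f constant_on \<Omega>"
    by (intro DERIV_zero_connected_constant_on[OF connected_domain open_domain, of "{}"]
        holomorphic_on_imp_continuous_on[OF holo]) auto
  then show False using nonconst by contradiction
qed

lemma finite_band_crit: "finite (band \<inter> crit)"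
proof -
  have "finite {z \<in> band. f z = 0}"
    by (rule holomorphic_compact_finite_zeros[OF holo open_domain connected_domain compact_band band_subset nonconst])
  moreover have "finite {z \<in> band. deriv f z = 0}"
  proof (cases "deriv f constant_on \<Omega>")
    case True
    then have "{z \<in> band. deriv f z = 0} = {}"
      using deriv_not_identically_zero band_subset unfolding constant_on_def by auto
    then show ?thesis by (simp only: finite.emptyI)
  next
    case False
    then show ?thesis
      by (intro holomorphic_compact_finite_zeros[OF _ open_domain connected_domain compact_band band_subset]
          holomorphic_deriv[OF holo open_domain])
  qed
  moreover have "band \<inter> crit \<subseteq> {z \<in> band. f z = 0} \<union> {z \<in> band. deriv f z = 0}"
    by (auto simp: critical_points_def)
  ultimately show ?thesis using finite_subset by blast
qed

lemma level_subset_band: "t \<in> {a..b} \<Longrightarrow> level t \<subseteq> band"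
  by (auto simp: level_set_def level_band_def)

lemma finite_critical_levels: "finite {t \<in> {a..b}. \<not> regular_level f \<Omega> t}"
proof -
  have "{t \<in> {a..b}. \<not> regular_level f \<Omega> t} \<subseteq> (\<lambda>z. norm (f z)) ` (band \<inter> crit)"
    by (auto simp: regular_level_def level_set_def level_band_def critical_points_def)
  then show ?thesis using finite_band_crit finite_surj by blast
qed

lemma continuous_f: "continuous_on \<Omega> f"
  by (rule holomorphic_on_imp_continuous_on[OF holo])

lemma continuous_deriv_f: "continuous_on \<Omega> (deriv f)"
  by (rule holomorphic_on_imp_continuous_on[OF holomorphic_deriv[OF holo open_domain]])

lemma deriv_f_measurable: "(\<lambda>z. indicator \<Omega> z *\<^sub>R deriv f z) \<in> borel_measurable borel"
  by (rule borel_measurable_continuous_on_indicator[OF _ continuous_deriv_f]) (use open_domain in auto)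

lemma level_borel [measurable, simp]: "level t \<in> sets borel"
proof -
  have [measurable]: "(\<lambda>z. indicator \<Omega> z *\<^sub>R f z) \<in> borel_measurable borel"
    by (rule borel_measurable_continuous_on_indicator[OF _ continuous_f]) (use open_domain in auto)
  have [measurable]: "\<Omega> \<in> sets borel" using open_domain by auto
  have "level t = {z \<in> space borel. z \<in> \<Omega> \<and> norm (indicator \<Omega> z *\<^sub>R f z) = t}"
    by (auto simp: level_set_def)
  also have "\<dots> \<in> sets borel" by measurable
  finally show ?thesis .
qed

lemma band_borel [measurable, simp]: "band \<in> sets borel"
  by (rule borel_compact[OF compact_band])

lemma compact_level:
  assumes "t \<in> {a..b}"
  shows "compact (level t)"
proof -
  have "level t = {z \<in> band. norm (f z) = t}"
    using assms by (auto simp: level_set_def level_band_def)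
  moreover have "closed {z \<in> band. norm (f z) = t}"
    using continuous_closed_preimage_constant[of band "\<lambda>z. norm (f z)" t] compact_imp_closed[OF compact_band]
      continuous_on_subset[OF continuous_f band_subset] by (auto intro: continuous_intros)
  ultimately show ?thesis
    using compact_Int_closed[OF compact_band, of "level t"] by (simp add: Int_absorb1)
qed

definition is_patch :: "complex set \<Rightarrow> bool" where
  "is_patch P \<longleftrightarrow> (\<exists>g V p q. log_chart f g \<Omega> V p q \<and> P = g ` cbox p q)"

text \<open>
The disc lies in the image of the open rectangle, so a function supported in it vanishes on the
boundary of the chart.
\<close>
definition chart_ball :: "complex \<Rightarrow> real \<Rightarrow> bool" where
  "chart_ball z \<rho> \<longleftrightarrow>
     0 < \<rho> \<and> (\<exists>g V p q. log_chart f g \<Omega> V p q \<and> cball z \<rho> \<subseteq> g ` box p q)"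

lemma ex_chart_ball: "z \<in> regular_part \<Longrightarrow> \<exists>\<rho>. chart_ball z \<rho>"
proof -
  assume "z \<in> regular_part"
  then have "z \<in> \<Omega>" "f z \<noteq> 0" "deriv f z \<noteq> 0" by (auto simp: critical_points_def)
  from ex_log_chart[OF open_domain holo this] show ?thesis unfolding chart_ball_def by metis
qed

lemma chart_ball_patch:
  assumes "chart_ball z \<rho>"
  shows "\<exists>P. is_patch P \<and> cball z \<rho> \<subseteq> P"
proof -
  obtain g V p q where c: "log_chart f g \<Omega> V p q" "cball z \<rho> \<subseteq> g ` box p q"
    using assms by (auto simp: chart_ball_def)
  moreover have "g ` box p q \<subseteq> g ` cbox p q" by (intro image_mono box_subset_cbox)
  ultimately show ?thesis unfolding is_patch_def by blast
qed

text \<open>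
The chart itself is no longer visible in these statements, so that patches can be cut into
disjoint Borel pieces.
\<close>

lemma is_patchD:
  assumes "is_patch P"
  shows "P \<in> sets borel" "P \<subseteq> regular_part" "emeasure arc_length (level t \<inter> P) < \<infinity>"
    "h \<in> borel_measurable borel \<Longrightarrow> (\<lambda>t. \<integral>\<^sup>+z\<in>level t \<inter> P. h z \<partial>arc_length) \<in> borel_measurable borel"
    "h \<in> borel_measurable borel \<Longrightarrow> (\<integral>\<^sup>+t. (\<integral>\<^sup>+z\<in>level t \<inter> P. h z \<partial>arc_length) \<partial>lborel)
       = (\<integral>\<^sup>+z\<in>P. h z * ennreal (norm (deriv f z)) \<partial>lborel)"
proof -
  obtain g V p q where c: "log_chart f g \<Omega> V p q" and P: "P = g ` cbox p q"
    using assms by (auto simp: is_patch_def)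
  have P': "P = log_chart.patch g p q" unfolding P log_chart.patch_def[OF c] ..
  show "P \<in> sets borel" unfolding P' by (rule log_chart.patch_borel[OF c])
  show "P \<subseteq> regular_part"
    unfolding P' using log_chart.patch_subset[OF c] log_chart.patch_regular[OF c] by (auto simp: critical_points_def)
  show "emeasure arc_length (level t \<inter> P) < \<infinity>" unfolding P' by (rule log_chart.level_length_patch_finite[OF c])
  show "h \<in> borel_measurable borel \<Longrightarrow> (\<lambda>t. \<integral>\<^sup>+z\<in>level t \<inter> P. h z \<partial>arc_length) \<in> borel_measurable borel"
    unfolding P' by (rule log_chart.local_coarea(1)[OF c])
  show "h \<in> borel_measurable borel \<Longrightarrow> (\<integral>\<^sup>+t. (\<integral>\<^sup>+z\<in>level t \<inter> P. h z \<partial>arc_length) \<partial>lborel)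
       = (\<integral>\<^sup>+z\<in>P. h z * ennreal (norm (deriv f z)) \<partial>lborel)"
    unfolding P' by (rule log_chart.local_coarea(2)[OF c])
qed

lemma countable_patch_cover:
  "\<exists>P :: nat \<Rightarrow> complex set. (\<forall>n. is_patch (P n) \<or> P n = {}) \<and> (\<Union>n. P n) = regular_part"
proof -
  define F where "F = {ball z \<rho> |z \<rho>. \<exists>P. is_patch P \<and> ball z \<rho> \<subseteq> P}"
  have "\<And>S. S \<in> F \<Longrightarrow> open S" by (auto simp: F_def)
  then obtain F' where F': "F' \<subseteq> F" "countable F'" "\<Union>F' = \<Union>F" using Lindelof by metis
  have cover: "regular_part \<subseteq> \<Union>F"
  proof
    fix z assume "z \<in> regular_part"
    then obtain P \<rho> where P: "is_patch P" "0 < \<rho>" "cball z \<rho> \<subseteq> P"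
      using ex_chart_ball chart_ball_patch by (metis chart_ball_def)
    then have "ball z \<rho> \<in> F" unfolding F_def using ball_subset_cball[of z \<rho>] by blast
    moreover have "z \<in> ball z \<rho>" using P by simp
    ultimately show "z \<in> \<Union>F" by blast
  qed
  have "\<forall>S\<in>F'. \<exists>P. is_patch P \<and> S \<subseteq> P" using F'(1) by (auto simp: F_def)
  then obtain Q where Q: "\<And>S. S \<in> F' \<Longrightarrow> is_patch (Q S) \<and> S \<subseteq> Q S" by metis
  define P where "P = (\<lambda>n. if F' = {} then {} else Q (from_nat_into F' n))"
  have P: "is_patch (P n) \<or> P n = {}" for n
    using Q from_nat_into[of F' n] by (auto simp: P_def)
  have "(\<Union>n. P n) = regular_part"
  proof
    show "(\<Union>n. P n) \<subseteq> regular_part"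
    proof (rule UN_least)
      fix n show "P n \<subseteq> regular_part" using P[of n] is_patchD(2)[of "P n"] by auto
    qed
    show "regular_part \<subseteq> (\<Union>n. P n)"
    proof
      fix z assume "z \<in> regular_part"
      then obtain S where S: "S \<in> F'" "z \<in> S" using cover F'(3) by blast
      obtain n where "from_nat_into F' n = S" using from_nat_into_surj[OF F'(2) S(1)] by blast
      then have "z \<in> P n" using S Q by (auto simp: P_def)
      then show "z \<in> (\<Union>n. P n)" by blast
    qed
  qed
  then show ?thesis using P by blast
qed

text \<open>
Countably many patches cover the regular points. Cutting them into disjoint Borel sets, the local
formula can be summed.
\<close>

lemma regular_coarea:
  assumes h[measurable]: "h \<in> borel_measurable borel"
  shows "(\<lambda>t. \<integral>\<^sup>+z\<in>level t \<inter> regular_part. h z \<partial>arc_length) \<in> borel_measurable borel"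
    and "(\<integral>\<^sup>+t. (\<integral>\<^sup>+z\<in>level t \<inter> regular_part. h z \<partial>arc_length) \<partial>lborel)
       = (\<integral>\<^sup>+z\<in>regular_part. h z * ennreal (norm (deriv f z)) \<partial>lborel)"
proof -
  obtain P where P: "\<And>n::nat. is_patch (P n) \<or> P n = {}" "(\<Union>n. P n) = regular_part"
    using countable_patch_cover by blast
  have PB: "P n \<in> sets borel" for n using P(1)[of n] is_patchD(1) by auto
  define E where "E = disjointed P"
  have E: "E n \<in> sets borel" "E n \<subseteq> P n" for n
    using PB by (auto simp: E_def disjointed_def)
  have EU: "(\<Union>n. E n) = regular_part" and disj: "disjoint_family E"
    using P(2) UN_disjointed_eq[of P] disjoint_family_disjointed[of P] by (auto simp: E_def)
  have [measurable]: "E n \<in> sets borel" for n by (rule E)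
  note [measurable] = deriv_f_measurable
  have ind: "indicator (S \<inter> regular_part) z = (\<Sum>n. indicator (S \<inter> E n) z :: ennreal)" for z S
  proof -
    have "disjoint_family (\<lambda>n. S \<inter> E n)" by (rule disjoint_family_subset[OF disj]) auto
    moreover have "(\<Union>n. S \<inter> E n) = S \<inter> regular_part" using EU by blast
    ultimately show ?thesis using suminf_indicator[of "\<lambda>n. S \<inter> E n" z] by simp
  qed
  have hn: "(\<lambda>z. h z * indicator (E n) z) \<in> borel_measurable borel" for n by measurable
  have piece: "(\<integral>\<^sup>+z\<in>level t \<inter> E n. h z \<partial>arc_length) = (\<integral>\<^sup>+z\<in>level t \<inter> P n. h z * indicator (E n) z \<partial>arc_length)" for t n
    using E(2)[of n] by (intro nn_integral_cong) (auto simp: indicator_def)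
  have m: "(\<lambda>t. \<integral>\<^sup>+z\<in>level t \<inter> E n. h z \<partial>arc_length) \<in> borel_measurable borel" for n
    unfolding piece using P(1)[of n] is_patchD(4)[OF _ hn] by auto
  have e: "(\<integral>\<^sup>+t. (\<integral>\<^sup>+z\<in>level t \<inter> E n. h z \<partial>arc_length) \<partial>lborel) = (\<integral>\<^sup>+z\<in>E n. h z * ennreal (norm (deriv f z)) \<partial>lborel)" for n
  proof (cases "P n = {}")
    case False
    then have "is_patch (P n)" using P(1) by blast
    from is_patchD(5)[OF this hn[of n]] show ?thesis
      unfolding piece using E(2)[of n]
      by (auto intro!: nn_integral_cong simp: indicator_def)
  qed (use E(2)[of n] in auto)
  have s: "(\<integral>\<^sup>+z\<in>level t \<inter> regular_part. h z \<partial>arc_length) = (\<Sum>n. \<integral>\<^sup>+z\<in>level t \<inter> E n. h z \<partial>arc_length)" for t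
    unfolding ind ennreal_suminf_cmult[symmetric]
    by (rule nn_integral_suminf) (simp cong: measurable_cong_sets)
  show "(\<lambda>t. \<integral>\<^sup>+z\<in>level t \<inter> regular_part. h z \<partial>arc_length) \<in> borel_measurable borel"
    unfolding s using m by measurable
  have "(\<integral>\<^sup>+t. (\<integral>\<^sup>+z\<in>level t \<inter> regular_part. h z \<partial>arc_length) \<partial>lborel)
     = (\<Sum>n. \<integral>\<^sup>+z\<in>E n. h z * ennreal (norm (deriv f z)) \<partial>lborel)"
    unfolding s e[symmetric] by (rule nn_integral_suminf) (use m in simp)
  also have "\<dots> = (\<Sum>n. \<integral>\<^sup>+z\<in>E n. h z * ennreal (norm (indicator \<Omega> z *\<^sub>R deriv f z)) \<partial>lborel)"
  proof (intro suminf_cong nn_integral_cong)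
    fix n z
    have "E n \<subseteq> \<Omega>" using EU by blast
    then show "h z * ennreal (norm (deriv f z)) * indicator (E n) z
       = h z * ennreal (norm (indicator \<Omega> z *\<^sub>R deriv f z)) * indicator (E n) z"
      by (auto simp: indicator_def)
  qed
  also have "\<dots> = (\<integral>\<^sup>+z\<in>regular_part. h z * ennreal (norm (indicator \<Omega> z *\<^sub>R deriv f z)) \<partial>lborel)"
  proof -
    have "(\<integral>\<^sup>+z\<in>regular_part. h z * ennreal (norm (indicator \<Omega> z *\<^sub>R deriv f z)) \<partial>lborel)
        = (\<integral>\<^sup>+z. (\<Sum>n. h z * ennreal (norm (indicator \<Omega> z *\<^sub>R deriv f z)) * indicator (E n) z) \<partial>lborel)"
      using ind[of UNIV] by simp
    also have "\<dots> = (\<Sum>n. \<integral>\<^sup>+z\<in>E n. h z * ennreal (norm (indicator \<Omega> z *\<^sub>R deriv f z)) \<partial>lborel)"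
      by (rule nn_integral_suminf) measurable
    finally show ?thesis by simp
  qed
  also have "\<dots> = (\<integral>\<^sup>+z\<in>regular_part. h z * ennreal (norm (deriv f z)) \<partial>lborel)"
    by (intro nn_integral_cong) (auto simp: indicator_def)
  finally show "(\<integral>\<^sup>+t. (\<integral>\<^sup>+z\<in>level t \<inter> regular_part. h z \<partial>arc_length) \<partial>lborel)
       = (\<integral>\<^sup>+z\<in>regular_part. h z * ennreal (norm (deriv f z)) \<partial>lborel)" .
qed

lemma AE_arc_length_not_band_crit: "AE z in arc_length. z \<notin> band \<inter> crit"
proof (rule AE_I')
  show "band \<inter> crit \<in> null_sets arc_length"
    using finite_band_crit by (auto simp: null_sets_def intro: finite_imp_closed borel_closed)
qed auto

lemma AE_lborel_not_band_crit: "AE z in lborel. z \<notin> band \<inter> crit"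
  by (rule AE_I'[OF finite_imp_null_set_lborel[OF finite_band_crit]]) auto

text \<open>
The finitely many critical points in the band are null sets for area and for arc length.
\<close>

lemma band_coarea:
  assumes h[measurable]: "h \<in> borel_measurable borel"
  shows "(\<lambda>t. (\<integral>\<^sup>+z\<in>level t. h z \<partial>arc_length) * indicator {a..b} t) \<in> borel_measurable borel" (is "?J \<in> _")
    and "(\<integral>\<^sup>+t\<in>{a..b}. (\<integral>\<^sup>+z\<in>level t. h z \<partial>arc_length) \<partial>lborel)
       = (\<integral>\<^sup>+z\<in>band. h z * ennreal (norm (deriv f z)) \<partial>lborel)"
proof -
  have hb: "(\<lambda>z. h z * indicator band z) \<in> borel_measurable borel" by measurable
  have J: "?J t = (\<integral>\<^sup>+z\<in>level t \<inter> regular_part. h z * indicator band z \<partial>arc_length)" for t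
  proof (cases "t \<in> {a..b}")
    case True
    have "(\<integral>\<^sup>+z\<in>level t. h z \<partial>arc_length) = (\<integral>\<^sup>+z\<in>level t \<inter> regular_part. h z * indicator band z \<partial>arc_length)"
      using AE_arc_length_not_band_crit level_subset_band[OF True] band_subset
      by (intro nn_integral_cong_AE) (auto simp: indicator_def elim!: eventually_mono)
    then show ?thesis using True by simp
  next
    case False
    then have "level t \<inter> band = {}" by (auto simp: level_set_def level_band_def)
    then have "(\<integral>\<^sup>+z\<in>level t \<inter> regular_part. h z * indicator band z \<partial>arc_length) = (\<integral>\<^sup>+z. 0 \<partial>arc_length)"
      by (intro nn_integral_cong) (auto simp: indicator_def)
    then show ?thesis using False by simp
  qed
  show "?J \<in> borel_measurable borel" unfolding J by (rule regular_coarea(1)[OF hb])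
  have "(\<integral>\<^sup>+t. ?J t \<partial>lborel) = (\<integral>\<^sup>+z\<in>regular_part. h z * indicator band z * ennreal (norm (deriv f z)) \<partial>lborel)"
    unfolding J by (rule regular_coarea(2)[OF hb])
  also have "\<dots> = (\<integral>\<^sup>+z\<in>band. h z * ennreal (norm (deriv f z)) \<partial>lborel)"
    using AE_lborel_not_band_crit band_subset
    by (intro nn_integral_cong_AE) (auto simp: indicator_def elim!: eventually_mono)
  finally show "(\<integral>\<^sup>+t. ?J t \<partial>lborel) = (\<integral>\<^sup>+z\<in>band. h z * ennreal (norm (deriv f z)) \<partial>lborel)" .
qed

lemma finite_chart_ball_cover:
  assumes "compact K" "K \<subseteq> regular_part"
  shows "\<exists>C r. finite C \<and> (\<forall>c\<in>C. chart_ball c (r c)) \<and> K \<subseteq> (\<Union>c\<in>C. ball c (r c))"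
proof -
  obtain r where r: "\<And>z. z \<in> regular_part \<Longrightarrow> chart_ball z (r z)"
    using ex_chart_ball by metis
  then have pos: "\<And>z. z \<in> regular_part \<Longrightarrow> 0 < r z" by (simp add: chart_ball_def)
  have "K \<subseteq> (\<Union>c\<in>K. ball c (r c))" using pos assms(2) by force
  then obtain C where "C \<subseteq> K" "finite C" "K \<subseteq> (\<Union>c\<in>C. ball c (r c))"
    using compactE_image[OF assms(1), of K "\<lambda>c. ball c (r c)"] by (metis open_ball)
  then show ?thesis using r assms(2)
    by (intro exI[of _ C] exI[of _ r]) auto
qed

lemma level_compact_finite_length:
  assumes "compact K" "K \<subseteq> regular_part"
  shows "emeasure arc_length (level t \<inter> K) < \<infinity>"
proof -
  obtain C r where C0: "finite C" "\<forall>c\<in>C. chart_ball c (r c)"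
    "K \<subseteq> (\<Union>c\<in>C. ball c (r c))"
    using finite_chart_ball_cover[OF assms] by metis
  have "\<forall>c\<in>C. \<exists>P. is_patch P \<and> cball c (r c) \<subseteq> P" using C0(2) chart_ball_patch by blast
  then obtain P where "\<forall>c\<in>C. is_patch (P c) \<and> cball c (r c) \<subseteq> P c" by metis
  with C0 have C: "finite C" "\<And>c. c \<in> C \<Longrightarrow> is_patch (P c) \<and> cball c (r c) \<subseteq> P c"
    "K \<subseteq> (\<Union>c\<in>C. ball c (r c))" by auto
  have PB: "P c \<in> sets borel" if "c \<in> C" for c using C(2)[OF that] is_patchD(1) by blast
  have "level t \<inter> K \<subseteq> (\<Union>c\<in>C. level t \<inter> P c)"
  proof
    fix z assume z: "z \<in> level t \<inter> K"
    then obtain c where "c \<in> C" "z \<in> ball c (r c)" using C(3) by blast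
    then show "z \<in> (\<Union>c\<in>C. level t \<inter> P c)" using C(2)[of c] z ball_subset_cball[of c "r c"] by blast
  qed
  then have "emeasure arc_length (level t \<inter> K) \<le> emeasure arc_length (\<Union>c\<in>C. level t \<inter> P c)"
    using C(1) PB by (intro emeasure_mono) auto
  also have "\<dots> \<le> (\<Sum>c\<in>C. emeasure arc_length (level t \<inter> P c))"
    using C(1) PB by (intro emeasure_subadditive_finite) auto
  also have "\<dots> < \<infinity>"
    using C is_patchD(3) by (simp add: less_top)
  finally show ?thesis .
qed

lemma regular_level_finite_length:
  assumes "t \<in> {a..b}" "regular_level f \<Omega> t"
  shows "emeasure arc_length (level t) < \<infinity>"
proof -
  have "level t \<subseteq> regular_part"
    using assms(2) by (auto simp: regular_level_def level_set_def)
  from level_compact_finite_length[OF compact_level[OF assms(1)] this, of t] show ?thesis by simp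
qed

lemma regular_level_set_integrable:
  assumes "t \<in> {a..b}" "regular_level f \<Omega> t"
  shows "set_integrable arc_length (level t) (\<lambda>z. 1 / norm (deriv f z))"
proof -
  have c: "continuous_on (level t) (\<lambda>z. 1 / norm (deriv f z))"
    using assms(2) by (intro continuous_intros continuous_on_subset[OF continuous_deriv_f])
       (auto simp: regular_level_def level_set_def critical_points_def)
  obtain B where B: "\<And>z. z \<in> level t \<Longrightarrow> norm (1 / norm (deriv f z)) \<le> B"
    using compact_imp_bounded[OF compact_continuous_image[OF c compact_level[OF assms(1)]]]
    by (auto simp: bounded_iff)
  have m: "(\<lambda>z. indicator (level t) z *\<^sub>R (1 / norm (deriv f z))) \<in> borel_measurable arc_length"
    using borel_measurable_continuous_on_indicator[OF level_borel c] by (simp cong: measurable_cong_sets)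
  show ?thesis unfolding set_integrable_def
  proof (rule integrableI_bounded_set[OF _ m])
    show "level t \<in> sets arc_length" by simp
    show "emeasure arc_length (level t) < \<infinity>" by (rule regular_level_finite_length[OF assms])
    show "AE z\<in>level t in arc_length. norm (indicator (level t) z *\<^sub>R (1 / norm (deriv f z))) \<le> B"
      using B by (auto intro!: AE_I2)
  qed auto
qed

text \<open>
The coarea formula with \<open>h = 1 / \<bar>f'\<bar>\<close>.
\<close>

lemma area_formula:
  "((\<lambda>t. LINT z:level t|arc_length. 1 / norm (deriv f z)) has_integral measure lebesgue band)
     {t \<in> {a..b}. regular_level f \<Omega> t}"
proof -
  define S where "S = {t \<in> {a..b}. regular_level f \<Omega> t}"
  have SB: "S \<in> sets borel"
  proof -
    have "S = {a..b} - {t \<in> {a..b}. \<not> regular_level f \<Omega> t}" by (auto simp: S_def)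
    moreover have "{t \<in> {a..b}. \<not> regular_level f \<Omega> t} \<in> sets borel"
      by (intro borel_closed finite_imp_closed finite_critical_levels)
    ultimately show ?thesis by (simp only: sets.Diff atLeastAtMost_borel)
  qed
  define df where "df = (\<lambda>z. indicator \<Omega> z *\<^sub>R deriv f z)"
  have mdf [measurable]: "df \<in> borel_measurable borel" unfolding df_def
    by (rule deriv_f_measurable)
  define h where "h = (\<lambda>z. ennreal (1 / norm (df z)))"
  have mh: "h \<in> borel_measurable borel" unfolding h_def by measurable
  define J where "J = (\<lambda>t. \<integral>\<^sup>+z\<in>level t. h z \<partial>arc_length)"
  define F where "F = (\<lambda>t. LINT z:level t|arc_length. 1 / norm (deriv f z))"
  have mJ: "(\<lambda>t. J t * indicator {a..b} t) \<in> borel_measurable borel"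
    unfolding J_def by (rule band_coarea(1)[OF mh])
  have JF: "J t = ennreal (F t)" if "t \<in> S" for t
  proof -
    have i: "set_integrable arc_length (level t) (\<lambda>z. 1 / norm (deriv f z))"
      using that by (intro regular_level_set_integrable) (auto simp: S_def)
    have "J t = (\<integral>\<^sup>+z. ennreal (indicator (level t) z *\<^sub>R (1 / norm (deriv f z))) \<partial>arc_length)"
      unfolding J_def by (intro nn_integral_cong) (auto simp: h_def df_def indicator_def level_set_def)
    also have "\<dots> = ennreal (F t)"
      unfolding F_def set_lebesgue_integral_def
      using i unfolding set_integrable_def by (intro nn_integral_eq_integral) auto
    finally show ?thesis .
  qed
  have F0: "0 \<le> F t" for t unfolding F_def set_lebesgue_integral_def
    by (intro Bochner_Integration.integral_nonneg) auto
  define G where "G = (\<lambda>t. if t \<in> S then F t else 0)"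
  have G: "G t = enn2real (J t * indicator {a..b} t) * indicator S t" for t
    using JF F0 by (auto simp: G_def S_def)
  have mG: "G \<in> borel_measurable borel"
    unfolding G using mJ SB by measurable
  have "(\<integral>\<^sup>+t. ennreal (G t) \<partial>lborel) = (\<integral>\<^sup>+t\<in>{a..b}. J t \<partial>lborel)"
  proof (rule nn_integral_cong_AE)
    have "AE t in lborel. t \<notin> {t \<in> {a..b}. \<not> regular_level f \<Omega> t}"
      by (rule AE_I'[OF finite_imp_null_set_lborel[OF finite_critical_levels]]) auto
    then show "AE t in lborel. ennreal (G t) = J t * indicator {a..b} t"
      by (rule eventually_mono) (auto simp: G_def JF S_def)
  qed
  also have "\<dots> = (\<integral>\<^sup>+z\<in>band. h z * ennreal (norm (deriv f z)) \<partial>lborel)"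
    unfolding J_def by (rule band_coarea(2)[OF mh])
  also have "\<dots> = (\<integral>\<^sup>+z. indicator band z \<partial>lborel)"
  proof (rule nn_integral_cong_AE)
    show "AE z in lborel. h z * ennreal (norm (deriv f z)) * indicator band z = indicator band z"
      using AE_lborel_not_band_crit
    proof (rule eventually_mono)
      fix z assume z: "z \<notin> band \<inter> crit"
      show "h z * ennreal (norm (deriv f z)) * indicator band z = indicator band z"
      proof (cases "z \<in> band")
        case True
        then have "z \<in> \<Omega>" "deriv f z \<noteq> 0" using z band_subset by (auto simp: critical_points_def)
        then have "h z * ennreal (norm (deriv f z)) = 1"
          by (simp add: h_def df_def ennreal_mult[symmetric])
        then show ?thesis by simp
      qed simp
    qed
  qed
  also have "\<dots> = emeasure lborel band" by simp
  also have "\<dots> = ennreal (measure lebesgue band)"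
    using emeasure_compact_finite[OF compact_band] emeasure_eq_ennreal_measure[of lborel band]
    by (simp add: less_top)
  finally have "(G has_integral measure lebesgue band) UNIV"
    using mG F0 by (intro nn_integral_has_integral) (auto simp: G_def)
  then show ?thesis
    unfolding G_def has_integral_restrict_UNIV F_def S_def .
qed

end

section \<open>Partitions of unity and cutoff functions\<close>

lemma GDERIV_unique:
  assumes "GDERIV \<psi> z :> D" "GDERIV \<psi> z :> E"
  shows "D = E"
proof -
  have "(\<lambda>h. h \<bullet> D) = (\<lambda>h. h \<bullet> E)"
    using assms unfolding gderiv_def by (rule has_derivative_unique)
  then show ?thesis by (metis inner_commute vector_eq_ldot)
qed

lemma GDERIV_transform_open:
  assumes "GDERIV \<psi> z :> D" "open U" "z \<in> U" "\<And>y. y \<in> U \<Longrightarrow> \<phi> y = \<psi> y"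
  shows "GDERIV \<phi> z :> D"
  using has_derivative_transform_within_open[OF assms(1)[unfolded gderiv_def] assms(2,3)] assms(4)
  by (simp add: gderiv_def)

lemma GDERIV_sum:
  assumes "\<And>c. c \<in> C \<Longrightarrow> GDERIV (\<psi> c) z :> D c"
  shows "GDERIV (\<lambda>z. \<Sum>c\<in>C. \<psi> c z) z :> (\<Sum>c\<in>C. D c)"
  using has_derivative_sum[of C \<psi> "\<lambda>c h. h \<bullet> D c" "at z"] assms
  by (simp add: gderiv_def inner_sum_right)

lemma continuous_on_GDERIV:
  assumes "\<And>z. z \<in> S \<Longrightarrow> GDERIV \<psi> z :> G z"
  shows "continuous_on S \<psi>"
  using assms by (auto simp: gderiv_def intro!: continuous_at_imp_continuous_on has_derivative_continuous)

text \<open>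
A continuously differentiable function that vanishes exactly on a half line; the bump functions
below are built from it.
\<close>
definition pos_sq :: "real \<Rightarrow> real" where "pos_sq x = (max 0 x)\<^sup>2"

lemma DERIV_pos_sq: "(pos_sq has_real_derivative 2 * max 0 x) (at x)"
proof (cases x "0::real" rule: linorder_cases)
  case less
  have "((\<lambda>x. 0) has_real_derivative 2 * max 0 x) (at x)" using less by simp
  then show ?thesis
    by (rule has_field_derivative_transform_within_open[of _ _ _ "{..<0}"]) (use less in \<open>auto simp: pos_sq_def\<close>)
next
  case greater
  have "((\<lambda>x. x\<^sup>2) has_real_derivative 2 * max 0 x) (at x)"
    using greater by (auto intro!: derivative_eq_intros)
  then show ?thesis
    by (rule has_field_derivative_transform_within_open[of _ _ _ "{0<..}"]) (use greater in \<open>auto simp: pos_sq_def\<close>)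
next
  case equal
  have "((\<lambda>y. (pos_sq y - pos_sq 0) / (y - 0)) \<longlongrightarrow> 0) (at 0)"
  proof (rule Lim_null_comparison)
    show "\<forall>\<^sub>F y in at 0. norm ((pos_sq y - pos_sq 0) / (y - 0)) \<le> \<bar>y\<bar>"
      by (rule always_eventually) (auto simp: pos_sq_def power2_eq_square max_def)
    show "((\<lambda>y. \<bar>y\<bar>) \<longlongrightarrow> 0) (at (0::real))"
      by (intro tendsto_rabs_zero tendsto_ident_at)
  qed
  then show ?thesis using equal by (simp add: has_field_derivative_iff)
qed

lemma pos_sq_nonneg [simp]: "0 \<le> pos_sq x"
  and pos_sq_pos_iff [simp]: "0 < pos_sq x \<longleftrightarrow> 0 < x"
  and pos_sq_eq_0: "x \<le> 0 \<Longrightarrow> pos_sq x = 0"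
  by (auto simp: pos_sq_def max_def)

lemma GDERIV_norm_diff_sq: "GDERIV (\<lambda>z. (norm (z - c))\<^sup>2) z :> 2 *\<^sub>R (z - c)" for z :: complex
  unfolding gderiv_def power2_norm_eq_inner
  by (auto intro!: derivative_eq_intros simp: inner_commute)

lemma GDERIV_compose_real:
  assumes "GDERIV u z :> D" "(g has_real_derivative d) (at (u z))"
  shows "GDERIV (\<lambda>z. g (u z)) z :> d *\<^sub>R D"
  using GDERIV_DERIV_compose[OF assms] by simp

text \<open>
Each \<open>\<beta> c\<close> is positive exactly on the disc \<open>ball c (r c)\<close>. Near \<open>K\<close> the functions are divided by
their sum \<open>B\<close>, which has a positive lower bound \<open>\<delta>\<close> there.
\<close>

lemma C1_partition_of_unity:
  fixes K C :: "complex set" and r :: "complex \<Rightarrow> real"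
  assumes K: "compact K" "finite C" "K \<subseteq> (\<Union>c\<in>C. ball c (r c))" and r: "\<And>c. c \<in> C \<Longrightarrow> 0 < r c"
  shows "\<exists>\<eta> H U. (\<forall>c z. GDERIV (\<eta> c) z :> H c z) \<and> (\<forall>c. continuous_on UNIV (H c)) \<and>
    (\<forall>c\<in>C. \<forall>z. z \<notin> cball c (r c) \<longrightarrow> \<eta> c z = 0) \<and>
    open U \<and> K \<subseteq> U \<and> (\<forall>z\<in>U. (\<Sum>c\<in>C. \<eta> c z) = (1::real))"
proof -
  define u where "u = (\<lambda>c z. (r c)\<^sup>2 - (norm (z - c))\<^sup>2)"
  define \<beta> where "\<beta> = (\<lambda>c z. pos_sq (u c z))"
  define \<beta>' where "\<beta>' = (\<lambda>c z. (2 * max 0 (u c z)) *\<^sub>R (- (2 *\<^sub>R (z - c))))"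
  have du: "GDERIV (u c) z :> - (2 *\<^sub>R (z - c))" for c z
    using GDERIV_diff[OF GDERIV_const GDERIV_norm_diff_sq] unfolding u_def by simp
  have d\<beta>: "GDERIV (\<beta> c) z :> \<beta>' c z" for c z
    unfolding \<beta>_def \<beta>'_def by (rule GDERIV_compose_real[OF du DERIV_pos_sq])
  have cu: "continuous_on UNIV (u c)" for c unfolding u_def by (intro continuous_intros)
  have c\<beta>': "continuous_on UNIV (\<beta>' c)" for c
    unfolding \<beta>'_def by (intro continuous_intros cu)
  have c\<beta>: "continuous_on UNIV (\<beta> c)" for c
    unfolding \<beta>_def pos_sq_def by (intro continuous_intros cu)
  define B where "B = (\<lambda>z. \<Sum>c\<in>C. \<beta> c z)"
  define B' where "B' = (\<lambda>z. \<Sum>c\<in>C. \<beta>' c z)"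
  have dB: "GDERIV B z :> B' z" for z unfolding B_def B'_def by (rule GDERIV_sum) (rule d\<beta>)
  have cB: "continuous_on UNIV B" and cB': "continuous_on UNIV B'"
    unfolding B_def B'_def by (intro continuous_intros c\<beta> c\<beta>')+
  have Bpos: "0 < B z" if zK: "z \<in> K" for z
  proof -
    obtain c where c: "c \<in> C" "z \<in> ball c (r c)" using subsetD[OF K(3) zK] by (rule UN_E)
    then have "norm (z - c) < r c" by (simp add: dist_norm norm_minus_commute)
    then have "0 < u c z" by (simp add: u_def power_strict_mono)
    then have "0 < \<beta> c z" by (simp add: \<beta>_def)
    then show ?thesis unfolding B_def
      by (intro sum_pos2[OF K(2) c(1)]) (auto simp: \<beta>_def)
  qed
  have "\<exists>\<delta>>0. \<forall>z\<in>K. \<delta> < B z"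
  proof (cases "K = {}")
    case False
    obtain z0 where "z0 \<in> K" "\<And>z. z \<in> K \<Longrightarrow> B z0 \<le> B z"
      using continuous_attains_inf[OF K(1) False, of B] cB continuous_on_subset by blast
    then show ?thesis using Bpos[of z0] by (intro exI[of _ "B z0 / 2"]) force
  qed (auto intro: exI[of _ 1])
  then obtain \<delta> where \<delta>: "0 < \<delta>" "\<And>z. z \<in> K \<Longrightarrow> \<delta> < B z" by blast
  \<comment> \<open>Adding the second term keeps the denominator positive off \<open>K\<close> without changing it near \<open>K\<close>.\<close>
  define E where "E = (\<lambda>z. B z + pos_sq (\<delta> - B z))"
  define E' where "E' = (\<lambda>z. B' z + (2 * max 0 (\<delta> - B z)) *\<^sub>R (- B' z))"
  have dE: "GDERIV E z :> E' z" for z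
    unfolding E_def E'_def
    using GDERIV_add[OF dB GDERIV_compose_real[OF GDERIV_diff[OF GDERIV_const dB] DERIV_pos_sq]]
    by simp
  have cE: "continuous_on UNIV E" unfolding E_def pos_sq_def by (intro continuous_intros cB)
  have cE': "continuous_on UNIV E'" unfolding E'_def by (intro continuous_intros cB cB')
  have B0: "0 \<le> B z" for z unfolding B_def by (intro sum_nonneg) (simp add: \<beta>_def)
  have Epos: "E z \<noteq> 0" for z
  proof (cases "B z < \<delta>")
    case True
    then have "0 < pos_sq (\<delta> - B z)" by simp
    then have "0 < E z" using B0[of z] unfolding E_def by linarith
    then show ?thesis by simp
  next
    case False
    then show ?thesis using \<delta>(1) pos_sq_nonneg[of "\<delta> - B z"] unfolding E_def by linarith
  qed
  define \<eta> where "\<eta> = (\<lambda>c z. \<beta> c z * inverse (E z))"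
  define H where "H = (\<lambda>c z. \<beta> c z *\<^sub>R (- (inverse (E z))\<^sup>2 *\<^sub>R E' z) + inverse (E z) *\<^sub>R \<beta>' c z)"
  have "GDERIV (\<eta> c) z :> H c z" for c z
    unfolding \<eta>_def H_def by (rule GDERIV_mult[OF d\<beta> GDERIV_inverse[OF dE Epos]])
  moreover have "continuous_on UNIV (H c)" for c
    unfolding H_def by (intro continuous_intros c\<beta> c\<beta>' cE cE') (use Epos in auto)
  moreover have "\<eta> c z = 0" if "c \<in> C" "z \<notin> cball c (r c)" for c z
  proof -
    have "r c < norm (z - c)" using that by (simp add: dist_norm norm_minus_commute)
    then have "(r c)\<^sup>2 < (norm (z - c))\<^sup>2" using r[OF that(1)] by (intro power_strict_mono) auto
    then show ?thesis by (simp add: \<eta>_def \<beta>_def u_def pos_sq_eq_0)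
  qed
  moreover have "open {z. \<delta> < B z}"
    using cB by (intro open_Collect_less continuous_intros)
  moreover have "(\<Sum>c\<in>C. \<eta> c z) = 1" if "\<delta> < B z" for z
  proof -
    have "E z = B z" using that by (simp add: E_def pos_sq_eq_0)
    moreover have "(\<Sum>c\<in>C. \<eta> c z) = B z * inverse (E z)"
      by (simp add: \<eta>_def B_def sum_distrib_right)
    ultimately show ?thesis using Epos[of z] by simp
  qed
  moreover have "K \<subseteq> {z. \<delta> < B z}" using \<delta>(2) by blast
  ultimately show ?thesis
    by (intro exI[of _ \<eta>] exI[of _ H] exI[of _ "{z. \<delta> < B z}"] conjI allI ballI impI) auto
qed

text \<open>
Around each point of \<open>Z\<close> sits a bump \<open>\<theta>\<close> that is \<open>1\<close> up to distance \<open>\<epsilon>\<close> and \<open>0\<close> beyond \<open>2 \<epsilon>\<close>; the separation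
of \<open>Z\<close> makes these supports disjoint, so \<open>1\<close> minus their sum stays between \<open>0\<close> and \<open>1\<close>. The gradient is
of size \<open>1 / \<epsilon>\<close> on a set of area of order \<open>\<epsilon>\<^sup>2\<close>, so its integral tends to \<open>0\<close> with \<open>\<epsilon>\<close>.
\<close>

lemma C1_cutoff:
  fixes Z :: "complex set"
  assumes Z: "finite Z" and e: "0 < \<epsilon>"
    and sep: "\<And>c c'. c \<in> Z \<Longrightarrow> c' \<in> Z \<Longrightarrow> c \<noteq> c' \<Longrightarrow> 4 * \<epsilon> \<le> dist c c'"
  shows "\<exists>\<psi> G. (\<forall>z. GDERIV \<psi> z :> G z) \<and> continuous_on UNIV G \<and> (\<forall>z. 0 \<le> \<psi> z \<and> \<psi> z \<le> (1::real)) \<and>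
    (\<forall>z. (\<forall>c\<in>Z. 2 * \<epsilon> \<le> dist c z) \<longrightarrow> \<psi> z = 1) \<and> (\<forall>c\<in>Z. \<forall>z\<in>ball c \<epsilon>. \<psi> z = 0) \<and>
    (\<forall>z. norm (G z) \<le> (\<Sum>c\<in>Z. 16 / \<epsilon> * indicator (cball c (2 * \<epsilon>)) z))"
proof -
  define s where "s = (\<lambda>c (z::complex). (norm (z - c))\<^sup>2 / \<epsilon>\<^sup>2 - 1)"
  define \<theta> where "\<theta> = (\<lambda>c z. pos_sq (1 - pos_sq (s c z)))"
  define \<theta>' where "\<theta>' = (\<lambda>c z. (2 * max 0 (1 - pos_sq (s c z))) *\<^sub>R (- ((2 * max 0 (s c z)) *\<^sub>R ((1 / \<epsilon>\<^sup>2) *\<^sub>R (2 *\<^sub>R (z - c))))))"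
  have ds: "GDERIV (s c) z :> (1 / \<epsilon>\<^sup>2) *\<^sub>R (2 *\<^sub>R (z - c))" for c z
  proof -
    have "((\<lambda>x. x / \<epsilon>\<^sup>2 - 1) has_real_derivative 1 / \<epsilon>\<^sup>2) (at x)" for x
      using DERIV_diff[OF DERIV_cdivide[OF DERIV_ident] DERIV_const] by simp
    from GDERIV_compose_real[OF GDERIV_norm_diff_sq this] show ?thesis unfolding s_def .
  qed
  have d\<theta>: "GDERIV (\<theta> c) z :> \<theta>' c z" for c z
    unfolding \<theta>_def \<theta>'_def
    using GDERIV_compose_real[OF GDERIV_diff[OF GDERIV_const[of 1] GDERIV_compose_real[OF ds DERIV_pos_sq]] DERIV_pos_sq]
    by simp
  have cs: "continuous_on UNIV (s c)" for c unfolding s_def using e by (intro continuous_intros) auto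
  have c\<theta>': "continuous_on UNIV (\<theta>' c)" for c
    unfolding \<theta>'_def pos_sq_def using e by (intro continuous_intros cs)
  have \<theta>01: "0 \<le> \<theta> c z" "\<theta> c z \<le> 1" for c z
  proof -
    have "max 0 (1 - pos_sq (s c z)) \<le> 1" by simp
    then show "\<theta> c z \<le> 1" unfolding \<theta>_def pos_sq_def[of "1 - _"] by (intro power_le_one) auto
  qed (simp add: \<theta>_def)
  have out: "1 \<le> s c z" if "2 * \<epsilon> \<le> dist c z" for c z
  proof -
    have "(2 * \<epsilon>)\<^sup>2 \<le> (norm (z - c))\<^sup>2" using that e by (intro power_mono) (auto simp: dist_norm norm_minus_commute)
    then have "2 * \<epsilon>\<^sup>2 \<le> (norm (z - c))\<^sup>2"
    proof -
      have "(2 * \<epsilon>)\<^sup>2 = 4 * \<epsilon>\<^sup>2" by (simp add: power_mult_distrib)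
      then show ?thesis using \<open>(2 * \<epsilon>)\<^sup>2 \<le> _\<close> zero_le_power2[of \<epsilon>] by linarith
    qed
    then show ?thesis using e by (simp add: s_def field_simps)
  qed
  have far: "pos_sq x \<ge> 1" if "1 \<le> x" for x using that by (simp add: pos_sq_def)
  have \<theta>0: "\<theta> c z = 0" and \<theta>'0: "\<theta>' c z = 0" if "2 * \<epsilon> \<le> dist c z" for c z
    using far[OF out[OF that]] by (simp_all add: \<theta>_def \<theta>'_def pos_sq_eq_0)
  have \<theta>1: "\<theta> c z = 1" if "dist c z < \<epsilon>" for c z
  proof -
    have "(norm (z - c))\<^sup>2 \<le> \<epsilon>\<^sup>2" using that e by (intro power_mono) (auto simp: dist_norm norm_minus_commute)
    then have "s c z \<le> 0" using e by (simp add: s_def field_simps)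
    then show ?thesis by (simp add: \<theta>_def pos_sq_eq_0) (simp add: pos_sq_def)
  qed
  have n\<theta>': "norm (\<theta>' c z) \<le> 16 / \<epsilon> * indicator (cball c (2 * \<epsilon>)) z" for c z
  proof (cases "2 * \<epsilon> \<le> dist c z")
    case True
    then show ?thesis using e by (simp add: \<theta>'0)
  next
    case False
    then have zc: "norm (z - c) \<le> 2 * \<epsilon>" by (simp add: dist_norm norm_minus_commute)
    have m: "max 0 (1 - pos_sq (s c z)) * max 0 (s c z) \<le> 1"
    proof (cases "1 \<le> s c z")
      case True
      then show ?thesis using far[OF True] by simp
    next
      case False
      then show ?thesis by (intro mult_le_one) auto
    qed
    \<comment> \<open>One factor \<open>2\<close> from each of the two derivatives of \<open>pos_sq\<close> and one from the squared distance.\<close>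
    have "norm (\<theta>' c z) = 8 * ((max 0 (1 - pos_sq (s c z)) * max 0 (s c z)) * (norm (z - c) / \<epsilon>\<^sup>2))"
      unfolding \<theta>'_def by (simp add: abs_mult)
    also have "\<dots> \<le> 8 * (1 * (2 * \<epsilon> / \<epsilon>\<^sup>2))"
      using m zc e by (intro mult_left_mono mult_mono divide_right_mono) auto
    also have "\<dots> = 16 / \<epsilon>" using e by (simp add: power2_eq_square)
    finally show ?thesis using False by simp
  qed
  have uniq: "c = c'" if "c \<in> Z" "c' \<in> Z" "dist c z < 2 * \<epsilon>" "dist c' z < 2 * \<epsilon>" for c c' z
    using sep[OF that(1,2)] dist_triangle2[of c c' z] that(3,4) by force
  have single: "(\<Sum>c\<in>Z. \<theta> c z) = \<theta> c0 z" if "c0 \<in> Z" "dist c0 z < 2 * \<epsilon>" for c0 z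
  proof -
    have "(\<Sum>c\<in>Z. \<theta> c z) = (\<Sum>c\<in>{c0}. \<theta> c z)"
    proof (rule sum.mono_neutral_right[OF Z])
      show "\<forall>c\<in>Z - {c0}. \<theta> c z = 0"
        using uniq[OF _ that(1) _ that(2)] \<theta>0 by (metis DiffE insertI1 not_le)
    qed (use that in auto)
    then show ?thesis by simp
  qed
  define \<psi> where "\<psi> = (\<lambda>z. 1 - (\<Sum>c\<in>Z. \<theta> c z))"
  define G where "G = (\<lambda>z. 0 - (\<Sum>c\<in>Z. \<theta>' c z))"
  have sum01: "0 \<le> (\<Sum>c\<in>Z. \<theta> c z) \<and> (\<Sum>c\<in>Z. \<theta> c z) \<le> 1" for z
  proof (cases "\<exists>c0\<in>Z. dist c0 z < 2 * \<epsilon>")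
    case True
    then show ?thesis using single \<theta>01 by auto
  next
    case False
    then have "(\<Sum>c\<in>Z. \<theta> c z) = 0" by (intro sum.neutral ballI \<theta>0) (auto simp: not_less)
    then show ?thesis by simp
  qed
  have "GDERIV \<psi> z :> G z" for z
    unfolding \<psi>_def G_def by (intro GDERIV_diff GDERIV_const GDERIV_sum d\<theta>)
  moreover have "continuous_on UNIV G" unfolding G_def by (intro continuous_intros c\<theta>')
  moreover have "0 \<le> \<psi> z \<and> \<psi> z \<le> 1" for z using sum01[of z] by (simp add: \<psi>_def)
  moreover have "\<psi> z = 1" if "\<forall>c\<in>Z. 2 * \<epsilon> \<le> dist c z" for z
    unfolding \<psi>_def using that \<theta>0 by simp
  moreover have "\<psi> z = 0" if "c \<in> Z" "z \<in> ball c \<epsilon>" for c z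
    using single[OF that(1), of z] \<theta>1[of c z] that e by (simp add: \<psi>_def)
  moreover have "norm (G z) \<le> (\<Sum>c\<in>Z. 16 / \<epsilon> * indicator (cball c (2 * \<epsilon>)) z)" for z
    unfolding G_def using sum_norm_le[of Z "\<lambda>c. \<theta>' c z"] n\<theta>' by simp
  ultimately show ?thesis
    by (intro exI[of _ \<psi>] exI[of _ G] conjI allI ballI impI) auto
qed

section \<open>The divergence theorem in a chart\<close>

text \<open>
The divergence of the vector field \<open>\<psi> \<nu>\<close>, where \<open>\<nu>\<close> is the outward normal and \<open>G\<close> the gradient
of \<open>\<psi>\<close>: the product rule gives \<open>\<psi> div \<nu> + \<nabla>\<psi> \<bullet> \<nu>\<close>, and \<open>div \<nu>\<close> is the curvature.
\<close>
definition normal_divergence ::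
    "(complex \<Rightarrow> complex) \<Rightarrow> (complex \<Rightarrow> real) \<Rightarrow> (complex \<Rightarrow> complex) \<Rightarrow> complex \<Rightarrow> real" where
  "normal_divergence f \<psi> G z = \<psi> z * curvature_formula f z + G z \<bullet> outward_normal f z"

lemma continuous_on_outward_normal:
  assumes "open \<Omega>" "f holomorphic_on \<Omega>"
  shows "continuous_on (\<Omega> - critical_points f \<Omega>) (outward_normal f)"
proof -
  have "continuous_on (\<Omega> - critical_points f \<Omega>) (log_deriv f)"
    by (rule holomorphic_on_imp_continuous_on[OF log_deriv_holomorphic[OF assms]])
  then have "continuous_on (\<Omega> - critical_points f \<Omega>) (\<lambda>z. sgn (cnj (log_deriv f z)))"
    unfolding sgn_div_norm using log_deriv_nz[of _ \<Omega> f]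
    by (intro continuous_intros) auto
  then show ?thesis by (simp add: outward_normal_def[abs_def])
qed

lemma continuous_on_curvature_formula:
  assumes "open \<Omega>" "f holomorphic_on \<Omega>"
  shows "continuous_on (\<Omega> - critical_points f \<Omega>) (curvature_formula f)"
proof -
  let ?U = "\<Omega> - critical_points f \<Omega>"
  have 1: "continuous_on ?U (log_deriv f)" "continuous_on ?U (deriv (log_deriv f))"
    using log_deriv_holomorphic[OF assms] open_regular_points[OF assms]
    by (auto intro!: holomorphic_on_imp_continuous_on holomorphic_deriv)
  show ?thesis
    unfolding curvature_formula_def[abs_def] using log_deriv_nz[of _ \<Omega> f]
    by (intro continuous_intros 1) auto
qed

context log_chart begin

text \<open>
The flux of \<open>\<psi> \<nu>\<close> through a level is the integral of \<open>\<psi>\<close> along it, which in the chart is the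
integral over \<open>v\<close> of \<open>A u v = \<psi> \<bar>g'\<bar>\<close> at \<open>u = ln t\<close>. The divergence times the Jacobian \<open>\<bar>g'\<bar>\<^sup>2\<close> is the derivative
of \<open>A\<close> with respect to \<open>u\<close>, so the identity is the fundamental theorem of calculus on each
horizontal segment, integrated over \<open>v\<close>. Where a segment leaves the rectangle before it reaches one of
the two levels, \<open>\<psi>\<close> vanishes at its end.
\<close>

lemma local_divergence:
  fixes \<psi> :: "complex \<Rightarrow> real" and G :: "complex \<Rightarrow> complex"
  assumes t12: "t1 \<le> t2"
    and der: "\<And>z. z \<in> level_band f \<Omega> t1 t2 \<Longrightarrow> GDERIV \<psi> z :> G z"
    and contG: "continuous_on (level_band f \<Omega> t1 t2) G"
    and supp: "\<And>z. z \<notin> g ` box p q \<Longrightarrow> \<psi> z = 0"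
  shows "set_integrable lborel (level_band f \<Omega> t1 t2) (normal_divergence f \<psi> G)"
    and "t \<in> {t1..t2} \<Longrightarrow> set_integrable arc_length (level_set f \<Omega> t) \<psi>"
    and "(LINT z:level_set f \<Omega> t2|arc_length. \<psi> z) - (LINT z:level_set f \<Omega> t1|arc_length. \<psi> z)
       = (LINT z:level_band f \<Omega> t1 t2|lborel. normal_divergence f \<psi> G z)"
proof -
  let ?B = "level_band f \<Omega> t1 t2" and ?R = "cbox p q"
  define \<Phi> where "\<Phi> = normal_divergence f \<psi> G"
  define Q where "Q = {w \<in> ?R. t1 \<le> exp (Re w) \<and> exp (Re w) \<le> t2}"
  have QR: "Q \<subseteq> ?R" by (auto simp: Q_def)
  have QV: "Q \<subseteq> V" using QR box_V by blast
  have cQ: "compact Q"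
  proof -
    have "closed {w. t1 \<le> exp (Re w) \<and> exp (Re w) \<le> t2}"
      by (intro closed_Collect_conj closed_Collect_le continuous_intros)
    then have "compact (?R \<inter> {w. t1 \<le> exp (Re w) \<and> exp (Re w) \<le> t2})"
      by (intro compact_Int_closed compact_cbox)
    then show ?thesis by (simp add: Q_def Int_def)
  qed
  have gQ: "g ` Q = ?B \<inter> patch"
    using norm_f_g g_into box_V by (auto simp: Q_def patch_def level_band_def subset_eq)
  have c\<psi>: "continuous_on ?B \<psi>"
    using der by (rule continuous_on_GDERIV)
  have patch0: "\<psi> z = 0" if "z \<notin> patch" for z
    using that box_subset_cbox[of p q] by (intro supp) (auto simp: patch_def)
  have G0: "G z = 0" if "z \<in> ?B" "z \<notin> patch" for z
  proof (rule GDERIV_unique[OF der[OF that(1)]])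
    show "GDERIV \<psi> z :> 0"
      by (rule GDERIV_transform_open[OF GDERIV_const[of 0], of "- patch"])
        (use that patch0 compact_imp_closed[OF compact_patch] in auto)
  qed
  have reg: "g ` Q \<subseteq> \<Omega> - critical_points f \<Omega>" using V_regular QV by blast
  have c\<Phi>: "continuous_on (g ` Q) \<Phi>"
    unfolding \<Phi>_def normal_divergence_def
    by (intro continuous_intros continuous_on_subset[OF c\<psi>] continuous_on_subset[OF contG]
        continuous_on_subset[OF continuous_on_curvature_formula[OF open_domain holo] reg]
        continuous_on_subset[OF continuous_on_outward_normal[OF open_domain holo] reg]) (auto simp: gQ)
  have ind\<Phi>: "indicator ?B z *\<^sub>R \<Phi> z = indicator (g ` Q) z *\<^sub>R \<Phi> z" for z
    unfolding gQ using patch0[of z] G0[of z] by (auto simp: indicator_def \<Phi>_def normal_divergence_def)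
  define j where "j = (\<lambda>w. (norm (deriv g w))\<^sup>2)"
  have area: "E \<in> sets borel \<Longrightarrow> E \<subseteq> Q \<Longrightarrow> emeasure lborel (g ` E) = (\<integral>\<^sup>+w\<in>E. ennreal (j w) \<partial>lborel)" for E
    unfolding j_def using QR by (intro area_image) auto
  have cj: "continuous_on Q j" unfolding j_def by (intro continuous_intros continuous_deriv_g QV)
  have "injective_parametrization g j Q lborel"
    by unfold_locales (use cQ continuous_g[OF QV] inj_on_subset[OF inj_box QR] cj area in \<open>auto simp: j_def\<close>)
  note param = injective_parametrization.integral_image[OF this c\<Phi>]
  note int\<Phi> = param(1) and eq\<Phi> = param(2)
  show "set_integrable lborel ?B (normal_divergence f \<psi> G)"
    using int\<Phi> unfolding set_integrable_def \<Phi>_def[symmetric] ind\<Phi> .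
  have level_sub: "level_set f \<Omega> t \<subseteq> ?B" if "t \<in> {t1..t2}" for t
    using that by (auto simp: level_set_def level_band_def)
  have ind\<psi>: "indicator (level_set f \<Omega> t) z *\<^sub>R \<psi> z = indicator (level_set f \<Omega> t \<inter> patch) z *\<^sub>R \<psi> z" for t z
    using patch0[of z] by (auto simp: indicator_def)

  define A where "A = (\<lambda>u v. \<psi> (g (Complex u v)) * norm (deriv g (Complex u v)))"
  define M where "M = (\<lambda>u. LINT v:{Im p..Im q}|lborel. A u v)"
  \<comment> \<open>The coordinate \<open>ln t\<close> of the level \<open>t\<close>, moved to the nearest point of the rectangle; the level
    \<open>0\<close>, where \<open>ln t\<close> would be \<open>-\<infinity>\<close>, goes to the left side.\<close>
  define cl where "cl = (\<lambda>t. if t > 0 then max (Re p) (min (Re q) (ln t)) else Re p)"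
  have A0: "A u v = 0" if "u = Re p \<or> u = Re q" "v \<in> {Im p..Im q}" for u v
  proof -
    have "Complex u v \<in> V" using that box_V Complex_in_box[of u v] Re_less by auto
    moreover have "Complex u v \<notin> box p q" using that by (auto simp: in_box_complex_iff)
    ultimately have "g (Complex u v) \<notin> g ` box p q"
      using inj_g box_V box_subset_cbox[of p q] by (auto simp: inj_on_def)
    then show ?thesis by (simp add: A_def supp)
  qed
  have M0: "M u = 0" if "u = Re p \<or> u = Re q" for u
    unfolding M_def set_lebesgue_integral_def
    using A0[OF that] by (intro integral_eq_zero_AE always_eventually) (auto simp: indicator_def)
  have level_M: "set_integrable arc_length (level_set f \<Omega> t) \<psi> \<and>
      (LINT z:level_set f \<Omega> t|arc_length. \<psi> z) = M (cl t)" if t: "t \<in> {t1..t2}" for t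
  proof (cases "t > 0 \<and> ln t \<in> {Re p..Re q}")
    case True
    then have cl: "cl t = ln t" by (auto simp: cl_def)
    have im: "level_set f \<Omega> t \<inter> patch = line (ln t) ` {Im p..Im q}"
      using True by (intro level_Int_patch) auto
    have "continuous_on (line (ln t) ` {Im p..Im q}) \<psi>"
      unfolding im[symmetric] using level_sub[OF t] by (intro continuous_on_subset[OF c\<psi>]) auto
    moreover have "injective_parametrization (line (ln t)) (\<lambda>v. norm (deriv g (Complex (ln t) v))) {Im p..Im q} arc_length"
      using line_continuous[OF conjunct2[OF True]] arc_length_line_image[OF conjunct2[OF True]]
      by unfold_locales auto
    ultimately have cv: "set_integrable arc_length (line (ln t) ` {Im p..Im q}) \<psi>"
      "(LINT z:line (ln t) ` {Im p..Im q}|arc_length. \<psi> z)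
        = (LINT v:{Im p..Im q}|lborel. norm (deriv g (Complex (ln t) v)) * \<psi> (line (ln t) v))"
      using injective_parametrization.integral_image by blast+
    show ?thesis
      using cv unfolding set_integrable_def set_lebesgue_integral_def ind\<psi> im cl M_def A_def line_def
      by (simp add: mult.commute)
  next
    case False
    then have "cl t = Re p \<or> cl t = Re q" by (auto simp: cl_def)
    then show ?thesis
      using M0 level_Int_patch_empty[OF False]
      unfolding set_integrable_def set_lebesgue_integral_def ind\<psi> by simp
  qed
  show "t \<in> {t1..t2} \<Longrightarrow> set_integrable arc_length (level_set f \<Omega> t) \<psi>"
    using level_M by blast

  \<comment> \<open>The chain rule, using that \<open>g'\<close> is \<open>\<bar>g'\<bar>\<close> times the outward normal.\<close>
  have dA: "((\<lambda>u. A u v) has_real_derivative j (Complex u v) * \<Phi> (g (Complex u v))) (at u)"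
    if w: "Complex u v \<in> Q" for u v
  proof -
    let ?w = "Complex u v"
    have wV: "?w \<in> V" using w QV by blast
    have nz: "deriv g ?w \<noteq> 0" by (rule deriv_g_nz[OF wV])
    have zB: "g ?w \<in> ?B" using w gQ by blast
    have c: "((\<lambda>u. Complex u v) has_derivative (\<lambda>h. of_real h)) (at u)"
      unfolding Complex_eq by (auto intro!: derivative_eq_intros)
    have gu: "((\<lambda>u. g (Complex u v)) has_derivative (\<lambda>h. deriv g ?w * of_real h)) (at u)"
      using has_derivative_compose[OF c] g_has_deriv[OF wV] unfolding has_field_derivative_def by blast
    have gu': "((\<lambda>u. deriv g (Complex u v)) has_derivative (\<lambda>h. deriv (deriv g) ?w * of_real h)) (at u)"
      using has_derivative_compose[OF c] holomorphic_derivI[OF holomorphic_deriv[OF holo_g open_V] open_V wV]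
      unfolding has_field_derivative_def by blast
    have 1: "((\<lambda>u. \<psi> (g (Complex u v))) has_derivative (\<lambda>h. (deriv g ?w * of_real h) \<bullet> G (g ?w))) (at u)"
      using has_derivative_compose[OF gu der[OF zB, unfolded gderiv_def]] .
    have 2: "((\<lambda>u. norm (deriv g (Complex u v))) has_derivative
        (\<lambda>h. (deriv (deriv g) ?w * of_real h) \<bullet> sgn (deriv g ?w))) (at u)"
      using has_derivative_compose[OF gu' has_derivative_norm[OF nz]] .
    have 3: "((\<lambda>u. A u v) has_derivative
        (\<lambda>h. \<psi> (g ?w) * ((deriv (deriv g) ?w * of_real h) \<bullet> sgn (deriv g ?w))
           + ((deriv g ?w * of_real h) \<bullet> G (g ?w)) * norm (deriv g ?w))) (at u)"
      unfolding A_def by (rule has_derivative_mult[OF 1 2])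
    have e1: "(deriv (deriv g) ?w * of_real h) \<bullet> sgn (deriv g ?w)
        = norm (deriv g ?w) * Re (deriv (deriv g) ?w / deriv g ?w) * h" for h
    proof -
      have "(deriv (deriv g) ?w * of_real h) \<bullet> sgn (deriv g ?w) =
          Re (of_real (norm (deriv g ?w) * h) * (deriv (deriv g) ?w / deriv g ?w))"
        unfolding inner_complex_eq_Re cnj_sgn_eq[OF nz] by (simp add: mult_ac)
      also have "\<dots> = norm (deriv g ?w) * h * Re (deriv (deriv g) ?w / deriv g ?w)"
      proof -
        have "Re (of_real r * c) = r * Re c" for r c by simp
        then show ?thesis by blast
      qed
      finally show ?thesis by simp
    qed
    have e2: "(deriv g ?w * of_real h) \<bullet> G (g ?w) = norm (deriv g ?w) * (G (g ?w) \<bullet> outward_normal f (g ?w)) * h" for h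
    proof -
      have "deriv g ?w * of_real h = (norm (deriv g ?w) * h) *\<^sub>R outward_normal f (g ?w)"
        using nz by (simp add: outward_normal_g[OF wV] sgn_div_norm scaleR_conv_of_real)
      then show ?thesis by (simp add: inner_commute)
    qed
    have "\<psi> (g ?w) * ((deriv (deriv g) ?w * of_real h) \<bullet> sgn (deriv g ?w))
           + ((deriv g ?w * of_real h) \<bullet> G (g ?w)) * norm (deriv g ?w) = j ?w * \<Phi> (g ?w) * h" for h
      unfolding e1 e2 \<Phi>_def normal_divergence_def j_def curvature_formula_g[OF wV]
      using nz by (simp add: power2_eq_square algebra_simps)
    with 3 show ?thesis by (simp add: has_field_derivative_def)
  qed

  have cj\<Phi>: "continuous_on Q (\<lambda>w. j w * \<Phi> (g w))"
    by (intro continuous_on_mult cj continuous_on_compose2[OF c\<Phi> continuous_g[OF QV]]) auto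
  have slice: "Complex u v \<in> Q \<longleftrightarrow> v \<in> {Im p..Im q} \<and> u \<in> {Re p..Re q} \<and> t1 \<le> exp u \<and> exp u \<le> t2" for u v
    unfolding Q_def by (auto simp: in_cbox_complex_iff)
  have cl_mono: "cl t1 \<le> cl t2"
    using t12 Re_less by (auto simp: cl_def max_def min_def dest: ln_mono)
  have inner: "(\<integral>u. indicator Q (Complex u v) *\<^sub>R (j (Complex u v) * \<Phi> (g (Complex u v))) \<partial>lborel)
      = indicator {Im p..Im q} v *\<^sub>R (A (cl t2) v - A (cl t1) v)" for v
  proof (cases "v \<in> {Im p..Im q}")
    case v: True
    show ?thesis
    proof (cases "t1 \<le> exp (Re q) \<and> exp (Re p) \<le> t2")
      case True
      have I: "Complex u v \<in> Q \<longleftrightarrow> u \<in> {cl t1..cl t2}" for u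
      proof -
        have t2: "0 < t2" using True exp_gt_zero[of "Re p"] by linarith
        have L1: "ln t \<le> x \<longleftrightarrow> t \<le> exp x" and L2: "x \<le> ln t \<longleftrightarrow> exp x \<le> t" if "0 < t" for t x :: real
          using exp_le_cancel_iff[of "ln t" x] exp_le_cancel_iff[of x "ln t"] that by auto
        have "exp u \<le> t2 \<longleftrightarrow> u \<le> ln t2" using L2[OF t2] by simp
        moreover have "t1 \<le> exp u \<longleftrightarrow> (t1 \<le> 0 \<or> ln t1 \<le> u)"
        proof (cases "t1 \<le> 0")
          case True
          then show ?thesis using exp_gt_zero[of u] by (simp del: exp_gt_zero)
        next
          case False
          then show ?thesis using L1[of t1 u] by simp
        qed
        moreover have "Re p \<le> ln t2" using True L2[OF t2] by simp
        moreover have "ln t1 \<le> Re q" if "0 < t1" using True L1[OF that] by simp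
        ultimately show ?thesis using v t2 Re_less unfolding slice cl_def by auto
      qed
      have cC: "continuous_on S (\<lambda>u. Complex u v)" for S
        unfolding Complex_eq by (intro continuous_intros)
      have "(\<integral>u. indicator {cl t1..cl t2} u *\<^sub>R (j (Complex u v) * \<Phi> (g (Complex u v))) \<partial>lborel)
          = A (cl t2) v - A (cl t1) v"
      proof (rule integral_FTC_atLeastAtMost[OF cl_mono])
        fix u assume "cl t1 \<le> u" "u \<le> cl t2"
        then have "Complex u v \<in> Q" using I by auto
        from dA[OF this] show "((\<lambda>u. A u v) has_vector_derivative j (Complex u v) * \<Phi> (g (Complex u v))) (at u within {cl t1..cl t2})"
          by (simp add: has_real_derivative_iff_has_vector_derivative has_vector_derivative_at_within)
      next
        show "continuous_on {cl t1..cl t2} (\<lambda>u. j (Complex u v) * \<Phi> (g (Complex u v)))"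
        proof (rule continuous_on_compose2[OF cj\<Phi> cC])
          show "(\<lambda>u. Complex u v) ` {cl t1..cl t2} \<subseteq> Q" using I by (simp only: image_subset_iff) blast
        qed
      qed
      moreover have "indicator Q (Complex u v) = (indicator {cl t1..cl t2} u :: real)" for u
        using I by (auto simp: indicator_def)
      ultimately show ?thesis using v by simp
    next
      case False
      have "Complex u v \<notin> Q" for u
      proof
        assume "Complex u v \<in> Q"
        then have "exp (Re p) \<le> exp u" "exp u \<le> exp (Re q)" "t1 \<le> exp u" "exp u \<le> t2"
          unfolding slice by auto
        then show False using False by linarith
      qed
      moreover have "cl t1 = cl t2"
      proof (cases "t2 < exp (Re p)")
        case True
        have "cl t = Re p" if "t \<le> t2" for t
        proof (cases "0 < t")
          case pos: True
          then have "exp (ln t) < exp (Re p)" using that True by simp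
          then have "ln t < Re p" by (simp only: exp_less_cancel_iff)
          then show ?thesis using pos Re_less by (simp add: cl_def)
        qed (simp add: cl_def)
        then show ?thesis using t12 by simp
      next
        case notlow: False
        then have high: "exp (Re q) < t1" using False by auto
        have "cl t = Re q" if "t1 \<le> t" for t
        proof -
          have pos: "0 < t" using high that exp_gt_zero[of "Re q"] by linarith
          then have "exp (Re q) < exp (ln t)" using that high by simp
          then have "Re q < ln t" by (simp only: exp_less_cancel_iff)
          then show ?thesis using pos Re_less by (simp add: cl_def)
        qed
        then show ?thesis using t12 by simp
      qed
      ultimately show ?thesis by simp
    qed
  next
    case False
    then have "Complex u v \<notin> Q" for u unfolding slice by blast
    then show ?thesis using False by simp
  qed
  have iA: "set_integrable lborel {Im p..Im q} (A (cl t))" if "t = t1 \<or> t = t2" for t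
  proof (cases "cl t = Re p \<or> cl t = Re q")
    case True
    then show ?thesis unfolding set_integrable_def
      using A0[OF True] by (subst Bochner_Integration.integrable_cong[where g="\<lambda>_. 0"]) (auto simp: indicator_def)
  next
    case False
    then have t: "0 < t" "cl t = ln t" and "ln t \<in> {Re p..Re q}" by (auto simp: cl_def max_def min_def split: if_splits)
    have cC: "continuous_on S (\<lambda>v. Complex (cl t) v)" for S
      unfolding Complex_eq by (intro continuous_intros)
    have Q: "Complex (cl t) v \<in> Q" if "v \<in> {Im p..Im q}" for v
      unfolding slice using that t \<open>ln t \<in> _\<close> \<open>t = t1 \<or> t = t2\<close> t12 by auto
    have "continuous_on Q (\<lambda>w. \<psi> (g w) * norm (deriv g w))"
      by (intro continuous_intros continuous_on_compose2[OF c\<psi> continuous_g[OF QV]] continuous_deriv_g[OF QV]) (auto simp: gQ)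
    then have "continuous_on {Im p..Im q} (A (cl t))"
      unfolding A_def[abs_def] by (rule continuous_on_compose2[OF _ cC]) (use Q in auto)
    then show ?thesis unfolding set_integrable_def by (intro borel_integrable_compact compact_Icc)
  qed
  have "(LINT z:?B|lborel. \<Phi> z) = (LINT w:Q|lborel. j w * \<Phi> (g w))"
    unfolding eq\<Phi>[symmetric] by (simp only: set_lebesgue_integral_def ind\<Phi>)
  also have "\<dots> = (\<integral>v. \<integral>u. indicator Q (Complex u v) *\<^sub>R (j (Complex u v) * \<Phi> (g (Complex u v))) \<partial>lborel \<partial>lborel)"
    unfolding set_lebesgue_integral_def
    by (rule integral_lborel_complex) (rule borel_integrable_compact[OF cQ cj\<Phi>])
  also have "\<dots> = (LINT v:{Im p..Im q}|lborel. A (cl t2) v - A (cl t1) v)"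
    unfolding inner set_lebesgue_integral_def ..
  also have "\<dots> = M (cl t2) - M (cl t1)"
    unfolding M_def by (rule set_integral_diff(2)) (use iA in auto)
  finally show "(LINT z:level_set f \<Omega> t2|arc_length. \<psi> z) - (LINT z:level_set f \<Omega> t1|arc_length. \<psi> z)
       = (LINT z:?B|lborel. normal_divergence f \<psi> G z)"
    using level_M[of t1] level_M[of t2] t12 by (simp add: \<Phi>_def)
qed

end

section \<open>Integrability of the curvature\<close>

lemma emeasure_cball_complex_le:
  assumes "0 \<le> r"
  shows "emeasure lborel (cball c r :: complex set) \<le> ennreal (4 * r\<^sup>2)"
proof -
  let ?l = "c - Complex r r" and ?u = "c + Complex r r"
  have "cball c r \<subseteq> cbox ?l ?u"
  proof
    fix z assume "z \<in> cball c r"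
    then have "norm (z - c) \<le> r" by (simp add: dist_norm norm_minus_commute)
    then have "\<bar>Re (z - c)\<bar> \<le> r" "\<bar>Im (z - c)\<bar> \<le> r"
      using abs_Re_le_cmod[of "z - c"] abs_Im_le_cmod[of "z - c"] by linarith+
    then show "z \<in> cbox ?l ?u" unfolding in_cbox_complex_iff by (simp add: abs_le_iff)
  qed
  then have "emeasure lborel (cball c r) \<le> emeasure lborel (cbox ?l ?u)"
    by (intro emeasure_mono) auto
  also have "\<dots> = ennreal (4 * r\<^sup>2)"
    using assms by (subst emeasure_lborel_cbox) (auto simp: Basis_complex_def power2_eq_square)
  finally show ?thesis .
qed

text \<open>
A dyadic estimate: on the ring between the radii \<open>r / 2 ^ (k + 1)\<close> and \<open>r / 2 ^ k\<close> the integrand is at most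
\<open>2 ^ (k + 1) / r\<close> while the area is of order \<open>r\<^sup>2 / 4 ^ k\<close>.
\<close>

lemma nn_integral_inverse_norm_finite:
  fixes c :: complex
  assumes r: "0 < r"
  shows "(\<integral>\<^sup>+z\<in>cball c r. ennreal (1 / norm (z - c)) \<partial>lborel) < \<infinity>"
proof -
  have "(\<integral>\<^sup>+z\<in>cball c r. ennreal (1 / norm (z - c)) \<partial>lborel)
      \<le> (\<integral>\<^sup>+z. (\<Sum>k. ennreal (2 ^ Suc k / r) * indicator (cball c (r / 2 ^ k)) z) \<partial>lborel)"
  proof (intro nn_integral_mono)
    fix z :: complex
    let ?x = "norm (z - c)"
    show "ennreal (1 / ?x) * indicator (cball c r) z \<le> (\<Sum>k. ennreal (2 ^ Suc k / r) * indicator (cball c (r / 2 ^ k)) z)"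
    proof (cases "z \<in> cball c r \<and> z \<noteq> c")
      case True
      then have x: "0 < ?x" "?x \<le> r" by (auto simp: dist_norm norm_minus_commute)
      obtain N where N: "r / ?x < 2 ^ N" using real_arch_pow[of 2 "r / ?x"] by auto
      \<comment> \<open>\<open>z\<close> lies in the ring of index \<open>j - 1\<close>.\<close>
      define j where "j = (LEAST j. r / ?x < 2 ^ j)"
      have j: "r / ?x < 2 ^ j" unfolding j_def by (rule LeastI[of _ N]) (rule N)
      have "j \<noteq> 0"
      proof
        assume "j = 0"
        then have "r < ?x" using j x by (simp add: divide_less_eq)
        then show False using x by simp
      qed
      then obtain k where k: "j = Suc k" by (cases j) auto
      have "\<not> r / ?x < 2 ^ k" using not_less_Least[of k "\<lambda>j. r / ?x < 2 ^ j"] k unfolding j_def by auto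
      then have zk: "z \<in> cball c (r / 2 ^ k)" using x by (simp add: dist_norm norm_minus_commute field_simps)
      have "1 / ?x \<le> 2 ^ Suc k / r" using j k x r by (simp add: field_simps)
      then have "ennreal (1 / ?x) * indicator (cball c r) z \<le> ennreal (2 ^ Suc k / r) * indicator (cball c (r / 2 ^ k)) z"
        using True zk by (simp add: ennreal_leI)
      also have "\<dots> \<le> (\<Sum>k. ennreal (2 ^ Suc k / r) * indicator (cball c (r / 2 ^ k)) z)"
      proof -
        have "F k \<le> suminf F" for F :: "nat \<Rightarrow> ennreal" using sum_le_suminf[of F "{k}"] by simp
        then show ?thesis .
      qed
      finally show ?thesis .
    qed auto
  qed
  also have "\<dots> = (\<Sum>k. \<integral>\<^sup>+z. ennreal (2 ^ Suc k / r) * indicator (cball c (r / 2 ^ k)) z \<partial>lborel)"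
    by (rule nn_integral_suminf) (auto intro!: borel_measurable_times_ennreal borel_measurable_indicator)
  also have "\<dots> \<le> (\<Sum>k. ennreal (8 * r * (1 / 2) ^ k))"
  proof (intro suminf_le summableI)
    fix k
    have "(\<integral>\<^sup>+z. ennreal (2 ^ Suc k / r) * indicator (cball c (r / 2 ^ k)) z \<partial>lborel)
        = ennreal (2 ^ Suc k / r) * emeasure lborel (cball c (r / 2 ^ k))"
      by (rule nn_integral_cmult_indicator) simp
    also have "\<dots> \<le> ennreal (2 ^ Suc k / r) * ennreal (4 * (r / 2 ^ k)\<^sup>2)"
      using r by (intro mult_left_mono emeasure_cball_complex_le) auto
    also have "\<dots> = ennreal (8 * r * (1 / 2) ^ k)"
      using r by (simp add: ennreal_mult[symmetric] power2_eq_square field_simps)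
    finally show "(\<integral>\<^sup>+z. ennreal (2 ^ Suc k / r) * indicator (cball c (r / 2 ^ k)) z \<partial>lborel)
        \<le> ennreal (8 * r * (1 / 2) ^ k)" .
  qed
  also have "\<dots> = ennreal (\<Sum>k. 8 * r * (1 / 2) ^ k)"
    using r by (intro suminf_ennreal2) (auto intro!: summable_mult summable_geometric)
  also have "\<dots> < \<infinity>" by simp
  finally show ?thesis .
qed

text \<open>
With \<open>F z = g z * (z - c) ^ m\<close> and \<open>g\<close> free of zeros, \<open>F' / F = g' / g + m / (z - c)\<close>.
\<close>

lemma log_deriv_simple_pole_bound:
  assumes F: "F holomorphic_on \<Omega>" "open \<Omega>" "connected \<Omega>" "c \<in> \<Omega>" and nz: "\<exists>w\<in>\<Omega>. F w \<noteq> 0"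
  shows "\<exists>C r. 0 < r \<and> cball c r \<subseteq> \<Omega> \<and> 0 \<le> C \<and>
     (\<forall>z\<in>cball c r - {c}. F z \<noteq> 0 \<and> norm (deriv F z / F z) \<le> C / norm (z - c))"
proof -
  define m where "m = nat (zorder F c)"
  define g where "g = zor_poly F c"
  obtain r where r: "0 < r" "cball c r \<subseteq> \<Omega>" "g holomorphic_on cball c r"
    "\<And>w. w \<in> cball c r \<Longrightarrow> F w = g w * (w - c) ^ m \<and> g w \<noteq> 0"
    using zorder_exist_zero[OF F nz] unfolding m_def g_def by metis
  define s where "s = r / 2"
  have s: "0 < s" "s < r" "cball c s \<subseteq> ball c r" using r by (auto simp: s_def)
  have gb: "g holomorphic_on ball c r" using r(3) holomorphic_on_subset ball_subset_cball by blast
  have "continuous_on (cball c s) (\<lambda>z. deriv g z / g z)"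
  proof (intro continuous_intros)
    show "continuous_on (cball c s) (deriv g)"
      using holomorphic_on_imp_continuous_on[OF holomorphic_deriv[OF gb open_ball]] s(3) continuous_on_subset by blast
    show "continuous_on (cball c s) g"
      using holomorphic_on_imp_continuous_on[OF gb] s(3) continuous_on_subset by blast
    show "\<forall>z\<in>cball c s. g z \<noteq> 0" using r(4) s by auto
  qed
  then have "bounded ((\<lambda>z. deriv g z / g z) ` cball c s)"
    by (intro compact_imp_bounded compact_continuous_image compact_cball)
  then obtain M where M: "0 < M" "\<And>z. z \<in> cball c s \<Longrightarrow> norm (deriv g z / g z) \<le> M"
    unfolding bounded_pos by blast
  have "F z \<noteq> 0 \<and> norm (deriv F z / F z) \<le> (M * s + real m) / norm (z - c)" if z: "z \<in> cball c s - {c}" for z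
  proof -
    have zb: "z \<in> ball c r" and zc: "z - c \<noteq> 0" using z s(3) by auto
    have Fz: "F z = g z * (z - c) ^ m" "g z \<noteq> 0" using r(4)[of z] zb by auto
    have "((\<lambda>w. g w * (w - c) ^ m) has_field_derivative (deriv g z * (z - c) ^ m + g z * (of_nat m * (z - c) ^ (m - 1)))) (at z)"
      using holomorphic_derivI[OF gb open_ball zb] by (auto intro!: derivative_eq_intros)
    then have "(F has_field_derivative (deriv g z * (z - c) ^ m + g z * (of_nat m * (z - c) ^ (m - 1)))) (at z)"
      by (rule has_field_derivative_transform_within_open[OF _ open_ball zb]) (use r(4) in auto)
    then have "deriv F z = deriv g z * (z - c) ^ m + g z * (of_nat m * (z - c) ^ (m - 1))"
      by (rule DERIV_imp_deriv)
    moreover have "(D * t ^ m + G * (of_nat m * t ^ (m - 1))) / (G * t ^ m) = D / G + of_nat m / t"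
      if "t \<noteq> 0" "G \<noteq> 0" for D G t :: complex
      using that by (cases m) (simp_all add: field_simps)
    ultimately have "deriv F z / F z = deriv g z / g z + of_nat m / (z - c)"
      using Fz zc by simp
    then have "norm (deriv F z / F z) \<le> norm (deriv g z / g z) + real m / norm (z - c)"
      using norm_triangle_ineq[of "deriv g z / g z" "of_nat m / (z - c)"] by (simp add: norm_divide)
    also have "\<dots> \<le> M * s / norm (z - c) + real m / norm (z - c)"
    proof (intro add_right_mono)
      have "norm (z - c) \<le> s" using z by (simp add: dist_norm norm_minus_commute)
      then have "M \<le> M * s / norm (z - c)" using M(1) zc by (simp add: field_simps)
      then show "norm (deriv g z / g z) \<le> M * s / norm (z - c)" using M(2)[of z] z by auto
    qed
    finally show ?thesis using Fz zc by (simp add: add_divide_distrib)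
  qed
  then show ?thesis using s r M
    by (intro exI[of _ "M * s + real m"] exI[of _ s]) auto
qed

context analytic_band begin

text \<open>
With \<open>h = f' / f\<close> the curvature is \<open>- \<bar>h\<bar> Re (h' / h\<^sup>2)\<close>, so it is at most \<open>\<bar>h' / h\<bar>\<close>, and
\<open>h' / h = f'' / f' - f' / f\<close> has at most simple poles.
\<close>

lemma abs_curvature_le:
  assumes "z \<in> regular_part"
  shows "\<bar>curvature_formula f z\<bar> \<le> norm (deriv (deriv f) z / deriv f z) + norm (deriv f z / f z)"
proof -
  have nz: "f z \<noteq> 0" "deriv f z \<noteq> 0" "z \<in> \<Omega>" using assms by (auto simp: critical_points_def)
  have d1: "(f has_field_derivative deriv f z) (at z)" using holomorphic_derivI[OF holo open_domain nz(3)] .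
  have d2: "(deriv f has_field_derivative deriv (deriv f) z) (at z)"
    using holomorphic_derivI[OF holomorphic_deriv[OF holo open_domain] open_domain nz(3)] .
  have "(log_deriv f has_field_derivative ((deriv (deriv f) z * f z - deriv f z * deriv f z) / (f z * f z))) (at z)"
    unfolding log_deriv_def[abs_def] by (rule DERIV_divide[OF d2 d1 nz(1)])
  then have "deriv (log_deriv f) z = (deriv (deriv f) z * f z - deriv f z * deriv f z) / (f z * f z)"
    by (rule DERIV_imp_deriv)
  then have q: "deriv (log_deriv f) z / log_deriv f z = deriv (deriv f) z / deriv f z - deriv f z / f z"
    using nz by (simp add: log_deriv_def field_simps)
  have "\<bar>curvature_formula f z\<bar> \<le> norm (log_deriv f z) * norm (deriv (log_deriv f) z / (log_deriv f z)\<^sup>2)"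
    unfolding curvature_formula_def abs_mult using abs_Re_le_cmod by (simp add: mult_left_mono)
  also have "\<dots> = norm (deriv (log_deriv f) z / log_deriv f z)"
    using log_deriv_nz[OF assms] by (simp add: norm_divide norm_mult power2_eq_square)
  also have "\<dots> \<le> norm (deriv (deriv f) z / deriv f z) + norm (deriv f z / f z)"
    unfolding q by (rule norm_triangle_ineq4)
  finally show ?thesis .
qed

lemma curvature_bound_near:
  assumes "c \<in> \<Omega>"
  shows "\<exists>C r. 0 < r \<and> 0 \<le> C \<and> cball c r - {c} \<subseteq> regular_part \<and>
     (\<forall>z\<in>cball c r - {c}. \<bar>curvature_formula f z\<bar> \<le> C / norm (z - c))"
proof -
  have "\<exists>w\<in>\<Omega>. f w \<noteq> 0" using nonconst unfolding constant_on_def by auto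
  from log_deriv_simple_pole_bound[OF holo open_domain connected_domain assms this]
  obtain C1 r1 where 1: "0 < r1" "cball c r1 \<subseteq> \<Omega>" "0 \<le> C1"
    "\<And>z. z \<in> cball c r1 - {c} \<Longrightarrow> f z \<noteq> 0 \<and> norm (deriv f z / f z) \<le> C1 / norm (z - c)" by metis
  from log_deriv_simple_pole_bound[OF holomorphic_deriv[OF holo open_domain] open_domain connected_domain assms deriv_not_identically_zero]
  obtain C2 r2 where 2: "0 < r2" "cball c r2 \<subseteq> \<Omega>" "0 \<le> C2"
    "\<And>z. z \<in> cball c r2 - {c} \<Longrightarrow> deriv f z \<noteq> 0 \<and> norm (deriv (deriv f) z / deriv f z) \<le> C2 / norm (z - c)" by metis
  have *: "z \<in> regular_part \<and> \<bar>curvature_formula f z\<bar> \<le> (C2 + C1) / norm (z - c)" if "z \<in> cball c (min r1 r2) - {c}" for z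
  proof -
    have z: "z \<in> cball c r1 - {c}" "z \<in> cball c r2 - {c}" using that by auto
    have "z \<in> regular_part" using 1(4)[OF z(1)] 2(4)[OF z(2)] 1(2) z(1) by (auto simp: critical_points_def)
    then show ?thesis
      using abs_curvature_le[of z] 1(4)[OF z(1)] 2(4)[OF z(2)] by (simp add: add_divide_distrib)
  qed
  then show ?thesis using 1(1,3) 2(1,3)
    by (intro exI[of _ "C2 + C1"] exI[of _ "min r1 r2"]) (auto simp del: mem_cball)
qed

lemma regular_part_borel [measurable, simp]: "regular_part \<in> sets borel"
  using open_regular_part by simp

lemma curvature_measurable:
  "(\<lambda>z. indicator regular_part z * curvature_formula f z) \<in> borel_measurable borel"
  using borel_measurable_continuous_on_indicator[OF regular_part_borel continuous_on_curvature_formula[OF open_domain holo]]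
  by simp

text \<open>
At a positive distance from the critical points the curvature is bounded; near each of them it
grows at most like the inverse distance, which is integrable in the plane.
\<close>

lemma curvature_integrable: "set_integrable lborel (band - crit) (curvature_formula f)"
proof -
  define Z where "Z = band \<inter> crit"
  have finZ: "finite Z" unfolding Z_def by (rule finite_band_crit)
  have "\<forall>c\<in>Z. \<exists>C r. 0 < r \<and> 0 \<le> C \<and> cball c r - {c} \<subseteq> regular_part \<and>
     (\<forall>z\<in>cball c r - {c}. \<bar>curvature_formula f z\<bar> \<le> C / norm (z - c))"
    using curvature_bound_near band_subset by (auto simp: Z_def)
  then obtain C r where Cr: "\<And>c. c \<in> Z \<Longrightarrow> 0 < r c" "\<And>c. c \<in> Z \<Longrightarrow> 0 \<le> C c"
    "\<And>c z. c \<in> Z \<Longrightarrow> z \<in> cball c (r c) - {c} \<Longrightarrow> \<bar>curvature_formula f z\<bar> \<le> C c / norm (z - c)" by metis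
  define K where "K = band - (\<Union>c\<in>Z. ball c (r c))"
  have K: "compact K" "K \<subseteq> regular_part"
  proof -
    show "compact K" unfolding K_def by (intro compact_diff compact_band open_UN) auto
    show "K \<subseteq> regular_part" using Cr(1) band_subset by (force simp: K_def Z_def)
  qed
  obtain M where M: "0 < M" "\<And>z. z \<in> K \<Longrightarrow> \<bar>curvature_formula f z\<bar> \<le> M"
    using compact_imp_bounded[OF compact_continuous_image[OF continuous_on_subset[OF continuous_on_curvature_formula[OF open_domain holo] K(2)] K(1)]]
    unfolding bounded_pos by auto
  have iM: "integrable lborel (\<lambda>z. M * indicator band z)"
    using emeasure_compact_finite[OF compact_band] by (intro integrable_mult_right) simp
  have ic: "integrable lborel (\<lambda>z. C c * (1 / norm (z - c) * indicator (cball c (r c)) z))" if "c \<in> Z" for c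
  proof (rule integrable_mult_right, rule integrableI_nonneg)
    have [measurable]: "cball c (r c) \<in> sets borel" by simp
    show "(\<lambda>z. 1 / norm (z - c) * indicator (cball c (r c)) z) \<in> borel_measurable lborel" by measurable
    have "(\<integral>\<^sup>+z. ennreal (1 / norm (z - c) * indicator (cball c (r c)) z) \<partial>lborel)
        = (\<integral>\<^sup>+z\<in>cball c (r c). ennreal (1 / norm (z - c)) \<partial>lborel)"
      by (intro nn_integral_cong) (auto simp: indicator_def)
    also have "\<dots> < \<infinity>" by (rule nn_integral_inverse_norm_finite[OF Cr(1)[OF that]])
    finally show "(\<integral>\<^sup>+z. ennreal (1 / norm (z - c) * indicator (cball c (r c)) z) \<partial>lborel) < \<infinity>" .
  qed (auto simp: indicator_def)
  have iS: "integrable lborel (\<lambda>z. M * indicator band z + (\<Sum>c\<in>Z. C c * (1 / norm (z - c) * indicator (cball c (r c)) z)))"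
    by (intro Bochner_Integration.integrable_add Bochner_Integration.integrable_sum iM ic)
  show ?thesis unfolding set_integrable_def
  proof (rule Bochner_Integration.integrable_bound[OF iS])
    have "(\<lambda>z. indicator band z * (indicator regular_part z * curvature_formula f z)) \<in> borel_measurable borel"
      using curvature_measurable by measurable
    also have "(\<lambda>z. indicator band z * (indicator regular_part z * curvature_formula f z))
        = (\<lambda>z. indicator (band - crit) z *\<^sub>R curvature_formula f z)"
      using band_subset by (auto simp: indicator_def fun_eq_iff)
    finally show "(\<lambda>z. indicator (band - crit) z *\<^sub>R curvature_formula f z) \<in> borel_measurable lborel" by simp
    show "AE z in lborel. norm (indicator (band - crit) z *\<^sub>R curvature_formula f z)
        \<le> norm (M * indicator band z + (\<Sum>c\<in>Z. C c * (1 / norm (z - c) * indicator (cball c (r c)) z)))"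
    proof (rule AE_I2)
      fix z
      have term0: "0 \<le> C c * (1 / norm (z - c) * indicator (cball c (r c)) z)" if "c \<in> Z" for c
        using Cr(2)[OF that] by (auto simp: indicator_def)
      then have s0: "0 \<le> (\<Sum>c\<in>Z. C c * (1 / norm (z - c) * indicator (cball c (r c)) z))"
        by (rule sum_nonneg)
      have "\<bar>indicator (band - crit) z * curvature_formula f z\<bar>
        \<le> M * indicator band z + (\<Sum>c\<in>Z. C c * (1 / norm (z - c) * indicator (cball c (r c)) z))"
      proof (cases "z \<in> band - crit")
        case True
        show ?thesis
        proof (cases "z \<in> K")
          case zK: True
          then show ?thesis using M(2)[OF zK] True s0 by simp
        next
          case False
          then obtain c where c: "c \<in> Z" "z \<in> ball c (r c)" using True by (auto simp: K_def)
          then have zc: "z \<in> cball c (r c) - {c}" using True by (auto simp: Z_def)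
          have "\<bar>curvature_formula f z\<bar> \<le> C c * (1 / norm (z - c) * indicator (cball c (r c)) z)"
            using Cr(3)[OF c(1) zc] zc by simp
          also have "\<dots> \<le> (\<Sum>c\<in>Z. C c * (1 / norm (z - c) * indicator (cball c (r c)) z))"
            by (rule member_le_sum[OF c(1) _ finZ]) (use term0 in auto)
          finally show ?thesis using True M(1) by simp
        qed
      next
        case False
        then show ?thesis using s0 M(1) by (simp add: indicator_def)
      qed
      then show "norm (indicator (band - crit) z *\<^sub>R curvature_formula f z)
        \<le> norm (M * indicator band z + (\<Sum>c\<in>Z. C c * (1 / norm (z - c) * indicator (cball c (r c)) z)))"
        by simp
    qed
  qed
qed

end

section \<open>Total curvature and the lengths of the levels\<close>

context analytic_band begin

text \<open>
A partition of unity writes \<open>\<psi>\<close> as a finite sum of functions each supported in one chart. Their gradients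
add up to that of \<open>\<psi>\<close> because the partition functions sum to \<open>1\<close> in a neighbourhood of the part of
the band where \<open>\<psi>\<close> is not known to vanish.
\<close>

lemma band_divergence:
  fixes \<psi> :: "complex \<Rightarrow> real" and G :: "complex \<Rightarrow> complex"
  assumes t12: "t1 \<in> {a..b}" "t2 \<in> {a..b}" "t1 \<le> t2"
    and der: "\<And>z. z \<in> band \<Longrightarrow> GDERIV \<psi> z :> G z" and contG: "continuous_on band G"
    and W: "open W" "band \<inter> crit \<subseteq> W" "\<And>z. z \<in> W \<Longrightarrow> \<psi> z = 0"
  shows "set_integrable lborel (level_band f \<Omega> t1 t2) (normal_divergence f \<psi> G)"
    and "t \<in> {t1..t2} \<Longrightarrow> set_integrable arc_length (level t) \<psi>"
    and "(LINT z:level t2|arc_length. \<psi> z) - (LINT z:level t1|arc_length. \<psi> z)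
       = (LINT z:level_band f \<Omega> t1 t2|lborel. normal_divergence f \<psi> G z)"
proof -
  let ?B = "level_band f \<Omega> t1 t2"
  let ?\<Phi> = "normal_divergence f"
  have B: "?B \<subseteq> band" using t12 by (auto simp: level_band_def)
  define K where "K = band - W"
  have K: "compact K" "K \<subseteq> regular_part"
    unfolding K_def using W band_subset by (auto intro: compact_diff compact_band)
  obtain C r where C: "finite C" "\<forall>c\<in>C. chart_ball c (r c)" "K \<subseteq> (\<Union>c\<in>C. ball c (r c))"
    using finite_chart_ball_cover[OF K] by metis
  have rpos: "0 < r c" if "c \<in> C" for c using C(2) that by (simp add: chart_ball_def)
  obtain \<eta> H U where \<eta>: "\<forall>c z. GDERIV (\<eta> c) z :> H c z" "\<forall>c. continuous_on UNIV (H c)"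
    "\<forall>c\<in>C. \<forall>z. z \<notin> cball c (r c) \<longrightarrow> \<eta> c z = 0" "open U" "K \<subseteq> U" "\<forall>z\<in>U. (\<Sum>c\<in>C. \<eta> c z) = (1::real)"
    using C1_partition_of_unity[OF K(1) C(1,3) rpos] by metis
  define \<phi> where "\<phi> = (\<lambda>c z. \<eta> c z * \<psi> z)"
  define G\<phi> where "G\<phi> = (\<lambda>c z. \<eta> c z *\<^sub>R G z + \<psi> z *\<^sub>R H c z)"
  have sum\<phi>: "(\<Sum>c\<in>C. \<phi> c z) = \<psi> z" if "z \<in> U \<union> W" for z
    using that \<eta>(6) W(3) by (auto simp: \<phi>_def sum_distrib_right[symmetric])
  have bUW: "band \<subseteq> U \<union> W" using \<eta>(5) by (auto simp: K_def)
  have d\<phi>: "GDERIV (\<phi> c) z :> G\<phi> c z" if "z \<in> band" for c z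
    unfolding \<phi>_def G\<phi>_def using \<eta>(1) der[OF that] by (intro GDERIV_mult) auto
  have sumG: "(\<Sum>c\<in>C. G\<phi> c z) = G z" if "z \<in> band" for z
  proof (rule GDERIV_unique)
    show "GDERIV (\<lambda>z. \<Sum>c\<in>C. \<phi> c z) z :> (\<Sum>c\<in>C. G\<phi> c z)" by (rule GDERIV_sum) (rule d\<phi>[OF that])
    show "GDERIV (\<lambda>z. \<Sum>c\<in>C. \<phi> c z) z :> G z"
      by (rule GDERIV_transform_open[OF der[OF that], of "U \<union> W"]) (use W \<eta>(4) bUW that sum\<phi> in auto)
  qed
  have c\<psi>: "continuous_on band \<psi>"
    using der by (rule continuous_on_GDERIV)
  have c\<eta>: "continuous_on S (\<eta> c)" for S c
    by (rule continuous_on_GDERIV) (use \<eta>(1) in blast)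
  have cG\<phi>: "continuous_on band (G\<phi> c)" for c
    unfolding G\<phi>_def using \<eta>(2)
    by (intro continuous_intros c\<eta> contG c\<psi>) (auto intro: continuous_on_subset)
  have loc: "set_integrable lborel ?B (?\<Phi> (\<phi> c) (G\<phi> c)) \<and>
      (\<forall>t\<in>{t1..t2}. set_integrable arc_length (level t) (\<phi> c)) \<and>
      (LINT z:level t2|arc_length. \<phi> c z) - (LINT z:level t1|arc_length. \<phi> c z) = (LINT z:?B|lborel. ?\<Phi> (\<phi> c) (G\<phi> c) z)"
    if c: "c \<in> C" for c
  proof -
    obtain g V p q where ch: "log_chart f g \<Omega> V p q" and sub: "cball c (r c) \<subseteq> g ` box p q"
      using C(2) c by (auto simp: chart_ball_def)
    have d: "\<And>z. z \<in> ?B \<Longrightarrow> GDERIV (\<phi> c) z :> G\<phi> c z" using d\<phi> B by blast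
    have cc: "continuous_on ?B (G\<phi> c)" using cG\<phi> B continuous_on_subset by blast
    have s: "\<phi> c z = 0" if "z \<notin> g ` box p q" for z
    proof -
      have "z \<notin> cball c (r c)" using that sub by blast
      then have "\<eta> c z = 0" using \<eta>(3) c by blast
      then show ?thesis by (simp add: \<phi>_def)
    qed
    show ?thesis
      using log_chart.local_divergence[OF ch t12(3) d cc s] by blast
  qed
  have level_sub: "level t \<subseteq> band" if "t \<in> {t1..t2}" for t
    using that t12 by (intro level_subset_band) auto
  have ind_level: "indicator (level t) z *\<^sub>R \<psi> z = (\<Sum>c\<in>C. indicator (level t) z *\<^sub>R \<phi> c z)" if "t \<in> {t1..t2}" for t z
    using sum\<phi>[of z] bUW level_sub[OF that] by (auto simp: indicator_def)
  have ind_band: "indicator ?B z *\<^sub>R ?\<Phi> \<psi> G z = (\<Sum>c\<in>C. indicator ?B z *\<^sub>R ?\<Phi> (\<phi> c) (G\<phi> c) z)" for z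
  proof (cases "z \<in> ?B")
    case True
    then have "?\<Phi> \<psi> G z = (\<Sum>c\<in>C. \<phi> c z) * curvature_formula f z + (\<Sum>c\<in>C. G\<phi> c z) \<bullet> outward_normal f z"
    proof -
      have zb: "z \<in> band" "z \<in> U \<union> W" using True B bUW by auto
      show ?thesis unfolding normal_divergence_def sum\<phi>[OF zb(2)] sumG[OF zb(1)] ..
    qed
    also have "\<dots> = (\<Sum>c\<in>C. ?\<Phi> (\<phi> c) (G\<phi> c) z)"
      by (simp add: normal_divergence_def sum.distrib sum_distrib_right inner_sum_left)
    finally show ?thesis using True by simp
  qed simp
  show "set_integrable lborel ?B (?\<Phi> \<psi> G)"
    using loc unfolding set_integrable_def ind_band by (intro Bochner_Integration.integrable_sum) auto
  show "t \<in> {t1..t2} \<Longrightarrow> set_integrable arc_length (level t) \<psi>" for t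
    using loc unfolding set_integrable_def by (simp only: ind_level) (intro Bochner_Integration.integrable_sum; blast)
  have lint: "(LINT z:level t|arc_length. \<psi> z) = (\<Sum>c\<in>C. LINT z:level t|arc_length. \<phi> c z)" if "t \<in> {t1..t2}" for t
    using loc that unfolding set_lebesgue_integral_def set_integrable_def ind_level[OF that]
    by (intro Bochner_Integration.integral_sum) auto
  have bint: "(LINT z:?B|lborel. ?\<Phi> \<psi> G z) = (\<Sum>c\<in>C. LINT z:?B|lborel. ?\<Phi> (\<phi> c) (G\<phi> c) z)"
    using loc unfolding set_lebesgue_integral_def set_integrable_def ind_band
    by (intro Bochner_Integration.integral_sum) auto
  show "(LINT z:level t2|arc_length. \<psi> z) - (LINT z:level t1|arc_length. \<psi> z) = (LINT z:?B|lborel. ?\<Phi> \<psi> G z)"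
    using loc lint[of t1] lint[of t2] t12 unfolding bint by (simp add: sum_subtractf[symmetric])
qed

text \<open>
Cutoffs around the critical points of the band for radii shrinking to \<open>0\<close>, in the form in which
the limit argument uses them.
\<close>

lemma cutoff_sequence:
  "\<exists>(\<psi> :: nat \<Rightarrow> complex \<Rightarrow> real) G W M. (\<forall>n z. GDERIV (\<psi> n) z :> G n z) \<and> (\<forall>n. continuous_on UNIV (G n)) \<and>
    (\<forall>n z. 0 \<le> \<psi> n z \<and> \<psi> n z \<le> 1) \<and> (\<forall>z. z \<notin> band \<inter> crit \<longrightarrow> (\<lambda>n. \<psi> n z) \<longlonglongrightarrow> 1) \<and>
    (\<forall>n. open (W n) \<and> band \<inter> crit \<subseteq> W n \<and> (\<forall>z\<in>W n. \<psi> n z = 0)) \<and>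
    (\<forall>n. (\<integral>\<^sup>+z. ennreal (norm (G n z)) \<partial>lborel) \<le> ennreal (M n)) \<and> M \<longlonglongrightarrow> 0 \<and> (\<forall>n. 0 \<le> M n \<and> M n \<le> M 0)"
proof -
  define Z where "Z = band \<inter> crit"
  have Z: "finite Z" unfolding Z_def by (rule finite_band_crit)
  have "\<exists>d>0. \<forall>c\<in>Z. \<forall>c'\<in>Z. c \<noteq> c' \<longrightarrow> d \<le> dist c c'"
  proof -
    have "\<forall>c\<in>Z. \<exists>d>0. \<forall>c'\<in>Z. c' \<noteq> c \<longrightarrow> d \<le> dist c c'" using finite_set_avoid[OF Z] by blast
    then obtain d where d: "\<And>c. c \<in> Z \<Longrightarrow> 0 < d c" "\<And>c c'. c \<in> Z \<Longrightarrow> c' \<in> Z \<Longrightarrow> c' \<noteq> c \<Longrightarrow> d c \<le> dist c c'"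
      by metis
    show ?thesis
    proof (cases "Z = {}")
      case False
      then have "0 < Min (d ` Z)" using Z d(1) by simp
      moreover have "Min (d ` Z) \<le> dist c c'" if "c \<in> Z" "c' \<in> Z" "c \<noteq> c'" for c c'
        using d(2)[of c c'] that Z by (intro order_trans[OF Min_le d(2)]) auto
      ultimately show ?thesis by blast
    qed (auto intro: exI[of _ 1])
  qed
  then obtain d where d: "0 < d" "\<And>c c'. c \<in> Z \<Longrightarrow> c' \<in> Z \<Longrightarrow> c \<noteq> c' \<Longrightarrow> d \<le> dist c c'" by blast
  \<comment> \<open>The factor \<open>1 / 4\<close> keeps the discs of radius \<open>2 \<epsilon>\<close> disjoint from the start.\<close>
  define \<epsilon> where "\<epsilon> = (\<lambda>n::nat. d / 4 * inverse (real (Suc n)))"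
  have \<epsilon>: "0 < \<epsilon> n" "4 * \<epsilon> n \<le> d" for n
    using d(1) by (auto simp: \<epsilon>_def field_simps)
  have \<epsilon>lim: "\<epsilon> \<longlonglongrightarrow> 0"
    unfolding \<epsilon>_def using tendsto_mult[OF tendsto_const LIMSEQ_inverse_real_of_nat, of "d / 4"] by simp
  have \<epsilon>0: "\<epsilon> n \<le> \<epsilon> 0" for n using d(1) by (simp add: \<epsilon>_def field_simps)
  have "\<exists>\<psi> G. (\<forall>z. GDERIV \<psi> z :> G z) \<and> continuous_on UNIV G \<and> (\<forall>z. 0 \<le> \<psi> z \<and> \<psi> z \<le> (1::real)) \<and>
    (\<forall>z. (\<forall>c\<in>Z. 2 * \<epsilon> n \<le> dist c z) \<longrightarrow> \<psi> z = 1) \<and> (\<forall>c\<in>Z. \<forall>z\<in>ball c (\<epsilon> n). \<psi> z = 0) \<and>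
    (\<forall>z. norm (G z) \<le> (\<Sum>c\<in>Z. 16 / \<epsilon> n * indicator (cball c (2 * \<epsilon> n)) z))" for n
    by (rule C1_cutoff[OF Z \<epsilon>(1)]) (use d(2) \<epsilon>(2) order_trans in blast)
  then obtain \<psi> G where \<psi>: "\<And>n z. GDERIV (\<psi> n) z :> G n z" "\<And>n. continuous_on UNIV (G n)"
    "\<And>n z. 0 \<le> \<psi> n z \<and> \<psi> n z \<le> (1::real)"
    "\<And>n z. (\<forall>c\<in>Z. 2 * \<epsilon> n \<le> dist c z) \<Longrightarrow> \<psi> n z = 1" "\<And>n c z. c \<in> Z \<Longrightarrow> z \<in> ball c (\<epsilon> n) \<Longrightarrow> \<psi> n z = 0"
    "\<And>n z. norm (G n z) \<le> (\<Sum>c\<in>Z. 16 / \<epsilon> n * indicator (cball c (2 * \<epsilon> n)) z)"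
    by metis
  define W where "W = (\<lambda>n. \<Union>c\<in>Z. ball c (\<epsilon> n))"
  \<comment> \<open>For each point of \<open>Z\<close>, the gradient bound \<open>16 / \<epsilon>\<close> times the area bound \<open>4 (2 \<epsilon>)\<^sup>2\<close>.\<close>
  define M where "M = (\<lambda>n. real (card Z) * (256 * \<epsilon> n))"
  have W: "open (W n) \<and> Z \<subseteq> W n \<and> (\<forall>z\<in>W n. \<psi> n z = 0)" for n
    using \<psi>(5) \<epsilon>(1) by (auto simp: W_def)
  have lim: "(\<lambda>n. \<psi> n z) \<longlonglongrightarrow> 1" if "z \<notin> Z" for z
  proof (rule tendsto_eventually)
    have "\<forall>\<^sub>F n in sequentially. 2 * \<epsilon> n < dist c z" if "c \<in> Z" for c
    proof -
      have "(\<lambda>n. 2 * \<epsilon> n) \<longlonglongrightarrow> 2 * 0" by (intro tendsto_mult tendsto_const \<epsilon>lim)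
      moreover have "2 * 0 < dist c z" using that \<open>z \<notin> Z\<close> by auto
      ultimately show ?thesis by (rule order_tendstoD(2))
    qed
    then have "\<forall>\<^sub>F n in sequentially. \<forall>c\<in>Z. 2 * \<epsilon> n < dist c z"
      by (intro eventually_ball_finite Z) auto
    then show "\<forall>\<^sub>F n in sequentially. \<psi> n z = 1"
      by (rule eventually_mono) (use \<psi>(4) less_imp_le in blast)
  qed
  have Mb: "(\<integral>\<^sup>+z. ennreal (norm (G n z)) \<partial>lborel) \<le> ennreal (M n)" for n
  proof -
    have "(\<integral>\<^sup>+z. ennreal (norm (G n z)) \<partial>lborel) \<le> (\<integral>\<^sup>+z. (\<Sum>c\<in>Z. ennreal (16 / \<epsilon> n) * indicator (cball c (2 * \<epsilon> n)) z) \<partial>lborel)"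
    proof (intro nn_integral_mono)
      fix z
      have "ennreal (norm (G n z)) \<le> ennreal (\<Sum>c\<in>Z. 16 / \<epsilon> n * indicator (cball c (2 * \<epsilon> n)) z)"
        by (intro ennreal_leI \<psi>(6))
      also have "\<dots> = (\<Sum>c\<in>Z. ennreal (16 / \<epsilon> n * indicator (cball c (2 * \<epsilon> n)) z))"
        using \<epsilon>(1)[of n] by (intro sum_ennreal[symmetric]) (auto simp: indicator_def)
      also have "\<dots> = (\<Sum>c\<in>Z. ennreal (16 / \<epsilon> n) * indicator (cball c (2 * \<epsilon> n)) z)"
        by (intro sum.cong refl) (auto simp: indicator_def)
      finally show "ennreal (norm (G n z)) \<le> (\<Sum>c\<in>Z. ennreal (16 / \<epsilon> n) * indicator (cball c (2 * \<epsilon> n)) z)" .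
    qed
    also have "\<dots> = (\<Sum>c\<in>Z. \<integral>\<^sup>+z. ennreal (16 / \<epsilon> n) * indicator (cball c (2 * \<epsilon> n)) z \<partial>lborel)"
      by (rule nn_integral_sum) (auto intro!: borel_measurable_times_ennreal borel_measurable_indicator)
    also have "\<dots> = (\<Sum>c\<in>Z. ennreal (16 / \<epsilon> n) * emeasure lborel (cball c (2 * \<epsilon> n)))"
      by (intro sum.cong refl nn_integral_cmult_indicator) simp
    also have "\<dots> \<le> (\<Sum>c\<in>Z. ennreal (16 / \<epsilon> n) * ennreal (4 * (2 * \<epsilon> n)\<^sup>2))"
      using \<epsilon>(1)[of n] by (intro sum_mono mult_left_mono emeasure_cball_complex_le) auto
    also have "\<dots> = (\<Sum>c\<in>Z. ennreal (256 * \<epsilon> n))"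
      using \<epsilon>(1)[of n] by (intro sum.cong refl) (simp add: ennreal_mult[symmetric] power2_eq_square field_simps)
    also have "\<dots> = ennreal (M n)"
      using \<epsilon>(1)[of n] by (simp add: M_def ennreal_of_nat_eq_real_of_nat ennreal_mult[symmetric])
    finally show ?thesis .
  qed
  have Mlim: "M \<longlonglongrightarrow> 0"
    unfolding M_def using tendsto_mult[OF tendsto_const tendsto_mult[OF tendsto_const \<epsilon>lim], of "real (card Z)" 256] by simp
  have M0: "0 \<le> M n \<and> M n \<le> M 0" for n
    using \<epsilon>(1)[of n] \<epsilon>0[of n] by (auto simp: M_def intro!: mult_right_mono)
  show ?thesis unfolding Z_def[symmetric]
    by (intro exI[of _ \<psi>] exI[of _ G] exI[of _ W] exI[of _ M] conjI allI impI) (use \<psi> lim W Mb Mlim M0 in auto)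
qed

lemma ex_regular_level: "\<exists>t\<in>{a..b}. regular_level f \<Omega> t"
proof (rule ccontr)
  assume "\<not> ?thesis"
  then have "{t \<in> {a..b}. \<not> regular_level f \<Omega> t} = {a..b}" by auto
  then show False using finite_critical_levels a_less_b infinite_Icc by metis
qed

lemma abs_inner_outward_normal_le: "\<bar>v \<bullet> outward_normal f z\<bar> \<le> norm v"
proof -
  have "norm (outward_normal f z) \<le> 1" by (simp add: outward_normal_def norm_sgn)
  then show ?thesis
    using Cauchy_Schwarz_ineq2[of v "outward_normal f z"] by (meson mult_left_le norm_ge_zero order_trans)
qed

text \<open>
The divergence identity for the cutoffs \<open>\<psi> n\<close> compares any two levels, with an error that is bounded
uniformly in \<open>n\<close> since the curvature is integrable. Starting from a regular level, whose length is
finite by compactness, Fatou's lemma shows that critical levels have finite length as well. Once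
lengths are finite, dominated convergence passes to the limit in the identity between the levels
\<open>a\<close> and \<open>b\<close>; the gradient term disappears because its integral is at most \<open>M n\<close>.
\<close>

lemma finite_length_and_total_curvature:
  shows "t \<in> {a..b} \<Longrightarrow> emeasure arc_length (level t) < \<infinity>"
    and "level_length f \<Omega> b - level_length f \<Omega> a = (LINT z:(band - crit)|lborel. curvature_formula f z)"
proof -
  obtain \<psi> G W M where \<psi>: "\<And>n z. GDERIV (\<psi> n) z :> G n z" "\<And>n. continuous_on UNIV (G n)"
    "\<And>n z. 0 \<le> \<psi> n z \<and> \<psi> n z \<le> (1::real)" "\<And>z. z \<notin> band \<inter> crit \<Longrightarrow> (\<lambda>n. \<psi> n z) \<longlonglongrightarrow> 1"
    "\<And>n. open (W n) \<and> band \<inter> crit \<subseteq> W n \<and> (\<forall>z\<in>W n. \<psi> n z = 0)"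
    "\<And>n::nat. (\<integral>\<^sup>+z. ennreal (norm (G n z)) \<partial>lborel) \<le> ennreal (M n)" "M \<longlonglongrightarrow> 0" "\<And>n. 0 \<le> M n \<and> M n \<le> M 0"
    using cutoff_sequence by metis
  have c\<psi>: "continuous_on S (\<psi> n)" for S n
    by (rule continuous_on_GDERIV) (rule \<psi>(1))
  have m\<psi> [measurable]: "\<psi> n \<in> borel_measurable borel" for n
    by (rule borel_measurable_continuous_onI[OF c\<psi>])
  have mG [measurable]: "G n \<in> borel_measurable borel" for n
    by (rule borel_measurable_continuous_onI[OF \<psi>(2)])
  define F where "F = (\<lambda>n t. LINT z:level t|arc_length. \<psi> n z)"
  define k where "k = (\<lambda>z. indicator (band - crit) z * curvature_formula f z)"
  have ik: "integrable lborel k"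
    using curvature_integrable by (simp add: set_integrable_def k_def)
  then have mk [measurable]: "k \<in> borel_measurable borel" by auto
  have iG: "integrable lborel (\<lambda>z. norm (G n z))" and IG: "(\<integral>z. norm (G n z) \<partial>lborel) \<le> M n" for n
  proof -
    show i: "integrable lborel (\<lambda>z. norm (G n z))"
      using \<psi>(6)[of n] by (intro integrableI_nonneg) (auto intro: le_less_trans)
    have "ennreal (\<integral>z. norm (G n z) \<partial>lborel) \<le> ennreal (M n)"
      using \<psi>(6)[of n] by (subst nn_integral_eq_integral[symmetric, OF i]) auto
    then show "(\<integral>z. norm (G n z) \<partial>lborel) \<le> M n" using \<psi>(8)[of n] by (simp add: ennreal_le_iff)
  qed
  have div: "set_integrable lborel (level_band f \<Omega> t1 t2) (normal_divergence f (\<psi> n) (G n))"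
       "t \<in> {t1..t2} \<Longrightarrow> set_integrable arc_length (level t) (\<psi> n)"
       "F n t2 - F n t1 = (LINT z:level_band f \<Omega> t1 t2|lborel. normal_divergence f (\<psi> n) (G n) z)"
    if "t1 \<in> {a..b}" "t2 \<in> {a..b}" "t1 \<le> t2" for t1 t2 t n
  proof -
    have cG: "continuous_on band (G n)" using continuous_on_subset[OF \<psi>(2)[of n] subset_UNIV] .
    have W: "open (W n)" "band \<inter> crit \<subseteq> W n" "\<And>z. z \<in> W n \<Longrightarrow> \<psi> n z = 0" using \<psi>(5)[of n] by auto
    show "set_integrable lborel (level_band f \<Omega> t1 t2) (normal_divergence f (\<psi> n) (G n))"
      by (rule band_divergence(1)[OF that \<psi>(1) cG W])
    show "t \<in> {t1..t2} \<Longrightarrow> set_integrable arc_length (level t) (\<psi> n)"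
      by (rule band_divergence(2)[OF that \<psi>(1) cG W])
    show "F n t2 - F n t1 = (LINT z:level_band f \<Omega> t1 t2|lborel. normal_divergence f (\<psi> n) (G n) z)"
      unfolding F_def by (rule band_divergence(3)[OF that \<psi>(1) cG W])
  qed
  define A where "A = (\<integral>z. \<bar>k z\<bar> \<partial>lborel) + M 0"
  have bound: "\<bar>F n t2 - F n t1\<bar> \<le> A" if t: "t1 \<in> {a..b}" "t2 \<in> {a..b}" "t1 \<le> t2" for t1 t2 n
  proof -
    let ?B = "level_band f \<Omega> t1 t2"
    have B: "?B \<subseteq> band" using t by (auto simp: level_band_def)
    have "\<bar>F n t2 - F n t1\<bar> \<le> (\<integral>z. \<bar>k z\<bar> + norm (G n z) \<partial>lborel)"
      unfolding div(3)[OF t] set_lebesgue_integral_def real_norm_def[symmetric]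
    proof (rule Bochner_Integration.integral_norm_bound_integral)
      show "integrable lborel (\<lambda>z. indicator ?B z *\<^sub>R (normal_divergence f (\<psi> n) (G n) z))"
        using div(1)[OF t] by (simp add: set_integrable_def)
      show "integrable lborel (\<lambda>z. norm (k z) + norm (G n z))"
        by (rule Bochner_Integration.integrable_add[OF integrable_norm[OF ik] iG])
      fix z
      show "norm (indicator ?B z *\<^sub>R (normal_divergence f (\<psi> n) (G n) z)) \<le> norm (k z) + norm (G n z)"
      proof (cases "z \<in> ?B")
        case True
        have "\<bar>\<psi> n z * curvature_formula f z\<bar> \<le> \<bar>k z\<bar>"
        proof (cases "z \<in> crit")
          case True
          then have "\<psi> n z = 0" using \<psi>(5)[of n] B \<open>z \<in> ?B\<close> by auto
          then show ?thesis by simp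
        next
          case False
          then have "k z = curvature_formula f z" using B True by (auto simp: k_def)
          then show ?thesis using \<psi>(3)[of n z] by (simp add: abs_mult mult_left_le_one_le)
        qed
        moreover have "\<bar>G n z \<bullet> outward_normal f z\<bar> \<le> norm (G n z)"
          by (rule abs_inner_outward_normal_le)
        ultimately show ?thesis using True by (simp add: normal_divergence_def)
      qed simp
    qed
    also have "\<dots> = (\<integral>z. \<bar>k z\<bar> \<partial>lborel) + (\<integral>z. norm (G n z) \<partial>lborel)"
      by (rule Bochner_Integration.integral_add[OF integrable_norm[OF ik, unfolded real_norm_def] iG])
    also have "\<dots> \<le> A" using IG[of n] \<psi>(8)[of n] by (simp add: A_def)
    finally show ?thesis .
  qed
  have F_nn: "ennreal (F n t) = (\<integral>\<^sup>+z\<in>level t. ennreal (\<psi> n z) \<partial>arc_length)" if "t \<in> {a..b}" for n t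
  proof -
    have "integrable arc_length (\<lambda>z. indicator (level t) z *\<^sub>R \<psi> n z)"
      using div(2)[OF that that order_refl, of t n] by (simp add: set_integrable_def)
    then have "ennreal (F n t) = (\<integral>\<^sup>+z. ennreal (indicator (level t) z *\<^sub>R \<psi> n z) \<partial>arc_length)"
      unfolding F_def set_lebesgue_integral_def using \<psi>(3)
      by (intro nn_integral_eq_integral[symmetric]) auto
    also have "\<dots> = (\<integral>\<^sup>+z\<in>level t. ennreal (\<psi> n z) \<partial>arc_length)"
      by (intro nn_integral_cong) (auto simp: indicator_def)
    finally show ?thesis .
  qed
  \<comment> \<open>A level of known finite length, from which the others are bounded.\<close>
  obtain t0 where t0: "t0 \<in> {a..b}" "regular_level f \<Omega> t0" using ex_regular_level by blast
  have fin0: "emeasure arc_length (level t0) < \<infinity>" by (rule regular_level_finite_length[OF t0])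
  have F0: "F n t0 \<le> measure arc_length (level t0)" for n
  proof -
    have "ennreal (F n t0) \<le> (\<integral>\<^sup>+z. indicator (level t0) z \<partial>arc_length)"
      unfolding F_nn[OF t0(1)] using \<psi>(3)[of n] by (intro nn_integral_mono) (auto simp: indicator_def)
    also have "\<dots> = ennreal (measure arc_length (level t0))"
      using fin0 by (simp add: emeasure_eq_ennreal_measure less_top)
    finally show ?thesis by (subst (asm) ennreal_le_iff) auto
  qed
  \<comment> \<open>This bound on the integrals of the cutoffs depends neither on \<open>n\<close> nor on the level.\<close>
  define L0 where "L0 = measure arc_length (level t0) + A"
  have FL0: "F n t \<le> L0" if "t \<in> {a..b}" for n t
    using bound[of t0 t n] bound[of t t0 n] F0[of n] t0(1) that unfolding L0_def by (cases "t0 \<le> t") force+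
  have AEz: "AE z in arc_length. (\<lambda>n. \<psi> n z) \<longlonglongrightarrow> 1"
    using AE_arc_length_not_band_crit by (rule eventually_mono) (rule \<psi>(4))
  have fin: "emeasure arc_length (level t) < \<infinity>" if t: "t \<in> {a..b}" for t
  proof -
    have "emeasure arc_length (level t) = (\<integral>\<^sup>+z. indicator (level t) z \<partial>arc_length)" by simp
    also have "\<dots> = (\<integral>\<^sup>+z. liminf (\<lambda>n. ennreal (\<psi> n z) * indicator (level t) z) \<partial>arc_length)"
    proof (rule nn_integral_cong_AE, rule eventually_mono[OF AEz])
      fix z assume "(\<lambda>n. \<psi> n z) \<longlonglongrightarrow> 1"
      then have "(\<lambda>n. ennreal (\<psi> n z) * indicator (level t) z) \<longlonglongrightarrow> ennreal 1 * indicator (level t) z"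
        by (cases "z \<in> level t") (auto intro: tendsto_ennrealI simp del: ennreal_1)
      then have "liminf (\<lambda>n. ennreal (\<psi> n z) * indicator (level t) z) = ennreal 1 * indicator (level t) z"
        by (intro lim_imp_Liminf) auto
      then show "indicator (level t) z = liminf (\<lambda>n. ennreal (\<psi> n z) * indicator (level t) z)" by simp
    qed
    also have "\<dots> \<le> liminf (\<lambda>n. \<integral>\<^sup>+z\<in>level t. ennreal (\<psi> n z) \<partial>arc_length)"
      by (rule nn_integral_liminf) (simp cong: measurable_cong_sets)
    also have "\<dots> \<le> liminf (\<lambda>n::nat. ennreal L0)"
      using FL0[OF t] by (intro Liminf_mono always_eventually allI) (simp add: F_nn[OF t, symmetric] ennreal_leI)
    also have "\<dots> = ennreal L0" by (simp add: Liminf_const)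
    finally show ?thesis using ennreal_less_top le_less_trans unfolding infinity_ennreal_def by blast
  qed
  show "t \<in> {a..b} \<Longrightarrow> emeasure arc_length (level t) < \<infinity>" by (rule fin)
  have Flim: "(\<lambda>n. F n t) \<longlonglongrightarrow> level_length f \<Omega> t" if t: "t \<in> {a..b}" for t
  proof -
    have il: "integrable arc_length (indicator (level t) :: complex \<Rightarrow> real)"
      using fin[OF t] by simp
    have "(\<lambda>n. \<integral>z. indicator (level t) z *\<^sub>R \<psi> n z \<partial>arc_length) \<longlonglongrightarrow> (\<integral>z. indicator (level t) z \<partial>arc_length)"
    proof (rule integral_dominated_convergence[where w="indicator (level t)"])
      show "AE z in arc_length. (\<lambda>n. indicator (level t) z *\<^sub>R \<psi> n z) \<longlonglongrightarrow> indicator (level t) z"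
      proof (rule eventually_mono[OF AEz])
        fix z assume "(\<lambda>n. \<psi> n z) \<longlonglongrightarrow> 1"
        then have "(\<lambda>n. indicator (level t) z *\<^sub>R \<psi> n z) \<longlonglongrightarrow> indicator (level t) z *\<^sub>R 1"
          by (intro tendsto_scaleR tendsto_const)
        then show "(\<lambda>n. indicator (level t) z *\<^sub>R \<psi> n z) \<longlonglongrightarrow> indicator (level t) z" by simp
      qed
      show "AE z in arc_length. norm (indicator (level t) z *\<^sub>R \<psi> n z) \<le> indicator (level t) z" for n
        using \<psi>(3)[of n] by (intro AE_I2) (auto simp: indicator_def)
      show "(\<lambda>z. indicator (level t) z *\<^sub>R \<psi> n z) \<in> borel_measurable arc_length" for n
        by (simp cong: measurable_cong_sets)
      show "(indicator (level t) :: complex \<Rightarrow> real) \<in> borel_measurable arc_length"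
        by (simp cong: measurable_cong_sets)
    qed (rule il)
    then show ?thesis by (simp add: F_def set_lebesgue_integral_def level_length_def)
  qed
  have dec: "F n b - F n a = (\<integral>z. \<psi> n z * k z \<partial>lborel) + (\<integral>z. indicator band z * (G n z \<bullet> outward_normal f z) \<partial>lborel)"
    and small: "\<bar>\<integral>z. indicator band z * (G n z \<bullet> outward_normal f z) \<partial>lborel\<bar> \<le> M n" for n
  proof -
    have ab: "a \<in> {a..b}" "b \<in> {a..b}" "a \<le> b" using a_less_b by auto
    have i1: "integrable lborel (\<lambda>z. \<psi> n z * k z)"
    proof (rule Bochner_Integration.integrable_bound[OF ik])
      show "AE z in lborel. norm (\<psi> n z * k z) \<le> norm (k z)"
        using \<psi>(3)[of n] by (intro AE_I2) (simp add: abs_mult mult_left_le_one_le)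
    qed measurable
    have eq: "indicator band z *\<^sub>R (normal_divergence f (\<psi> n) (G n) z)
        = \<psi> n z * k z + indicator band z * (G n z \<bullet> outward_normal f z)" for z
      using \<psi>(5)[of n] by (cases "z \<in> band"; cases "z \<in> crit") (auto simp: k_def normal_divergence_def)
    have i12: "integrable lborel (\<lambda>z. \<psi> n z * k z + indicator band z * (G n z \<bullet> outward_normal f z))"
      using div(1)[OF ab, of n] unfolding set_integrable_def eq .
    from Bochner_Integration.integrable_diff[OF i12 i1]
    have i2: "integrable lborel (\<lambda>z. indicator band z * (G n z \<bullet> outward_normal f z))" by simp
    show "F n b - F n a = (\<integral>z. \<psi> n z * k z \<partial>lborel) + (\<integral>z. indicator band z * (G n z \<bullet> outward_normal f z) \<partial>lborel)"
      unfolding div(3)[OF ab] set_lebesgue_integral_def eq by (rule Bochner_Integration.integral_add[OF i1 i2])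
    have "\<bar>\<integral>z. indicator band z * (G n z \<bullet> outward_normal f z) \<partial>lborel\<bar> \<le> (\<integral>z. norm (G n z) \<partial>lborel)"
      unfolding real_norm_def[symmetric]
    proof (rule Bochner_Integration.integral_norm_bound_integral[OF i2 iG])
      fix z
      have "\<bar>G n z \<bullet> outward_normal f z\<bar> \<le> norm (G n z)"
        by (rule abs_inner_outward_normal_le)
      then show "norm (indicator band z * (G n z \<bullet> outward_normal f z)) \<le> norm (G n z)"
        by (simp add: abs_mult indicator_def)
    qed
    then show "\<bar>\<integral>z. indicator band z * (G n z \<bullet> outward_normal f z) \<partial>lborel\<bar> \<le> M n" using IG[of n] by linarith
  qed
  have lim1: "(\<lambda>n. \<integral>z. \<psi> n z * k z \<partial>lborel) \<longlonglongrightarrow> (\<integral>z. k z \<partial>lborel)"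
  proof (rule integral_dominated_convergence[where w="\<lambda>z. norm (k z)"])
    show "AE z in lborel. (\<lambda>n. \<psi> n z * k z) \<longlonglongrightarrow> k z"
    proof (rule eventually_mono[OF AE_lborel_not_band_crit])
      fix z assume "z \<notin> band \<inter> crit"
      from tendsto_mult[OF \<psi>(4)[OF this] tendsto_const[of "k z"]] show "(\<lambda>n. \<psi> n z * k z) \<longlonglongrightarrow> k z" by simp
    qed
    show "AE z in lborel. norm (\<psi> n z * k z) \<le> norm (k z)" for n
      using \<psi>(3)[of n] by (intro AE_I2) (simp add: abs_mult mult_left_le_one_le)
  qed (use ik in auto)
  have lim2: "(\<lambda>n. \<integral>z. indicator band z * (G n z \<bullet> outward_normal f z) \<partial>lborel) \<longlonglongrightarrow> 0"
    by (rule Lim_null_comparison[OF _ \<psi>(7)]) (use small in auto)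
  have "(\<lambda>n. F n b - F n a) \<longlonglongrightarrow> (\<integral>z. k z \<partial>lborel) + 0"
    unfolding dec by (rule tendsto_add[OF lim1 lim2])
  moreover have "(\<lambda>n. F n b - F n a) \<longlonglongrightarrow> level_length f \<Omega> b - level_length f \<Omega> a"
    using a_less_b by (intro tendsto_diff Flim) auto
  ultimately have "level_length f \<Omega> b - level_length f \<Omega> a = (\<integral>z. k z \<partial>lborel)"
    using LIMSEQ_unique by fastforce
  then show "level_length f \<Omega> b - level_length f \<Omega> a = (LINT z:(band - crit)|lborel. curvature_formula f z)"
    by (simp add: k_def set_lebesgue_integral_def)
qed

text \<open>
The coarea formula with \<open>h = 1\<close>. Finite lengths on every level are what allows \<open>level_length\<close>, a real
number, to stand for the measure of the level.
\<close>

lemma coarea_length: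
  "(level_length f \<Omega> has_integral (LINT z:band|lborel. norm (deriv f z))) {a..b}"
  "((\<lambda>z. norm (deriv f z)) has_integral (LINT z:band|lborel. norm (deriv f z))) band"
proof -
  define I where "I = (LINT z:band|lborel. norm (deriv f z))"
  have i: "set_integrable lborel band (\<lambda>z. norm (deriv f z))"
    unfolding set_integrable_def
    by (intro borel_integrable_compact compact_band continuous_intros continuous_on_subset[OF continuous_deriv_f band_subset])
  then show "((\<lambda>z. norm (deriv f z)) has_integral (LINT z:band|lborel. norm (deriv f z))) band"
    using set_borel_integral_eq_integral[OF i] by (simp add: has_integral_iff)
  have I0: "0 \<le> I" unfolding I_def set_lebesgue_integral_def by (intro Bochner_Integration.integral_nonneg) auto
  have one: "(\<lambda>z. 1 :: ennreal) \<in> borel_measurable (borel :: complex measure)" by simp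
  have J: "(\<integral>\<^sup>+z\<in>level t. 1 \<partial>arc_length) = emeasure arc_length (level t)" for t by simp
  define l where "l = (\<lambda>t. if t \<in> {a..b} then level_length f \<Omega> t else 0)"
  have L: "ennreal (l t) = emeasure arc_length (level t) * indicator {a..b} t" for t
    using finite_length_and_total_curvature(1)[of t]
    by (auto simp: l_def level_length_def emeasure_eq_ennreal_measure less_top)
  have "(\<lambda>t. emeasure arc_length (level t) * indicator {a..b} t) \<in> borel_measurable borel"
    using band_coarea(1)[OF one] by (simp add: J)
  then have "(\<lambda>t. enn2real (ennreal (l t))) \<in> borel_measurable borel"
    unfolding L[symmetric] by measurable
  moreover have l0: "0 \<le> l t" for t by (simp add: l_def level_length_def)
  ultimately have ml: "l \<in> borel_measurable borel" by simp
  have "(\<integral>\<^sup>+t. ennreal (l t) \<partial>lborel) = (\<integral>\<^sup>+z\<in>band. 1 * ennreal (norm (deriv f z)) \<partial>lborel)"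
    unfolding L using band_coarea(2)[OF one] by (simp add: J)
  also have "\<dots> = (\<integral>\<^sup>+z. ennreal (indicator band z *\<^sub>R norm (deriv f z)) \<partial>lborel)"
    by (intro nn_integral_cong) (auto simp: indicator_def)
  also have "\<dots> = ennreal I"
    unfolding I_def set_lebesgue_integral_def using i unfolding set_integrable_def
    by (intro nn_integral_eq_integral) auto
  finally have "(l has_integral I) UNIV"
    by (intro nn_integral_has_integral ml l0 I0)
  then show "(level_length f \<Omega> has_integral (LINT z:band|lborel. norm (deriv f z))) {a..b}"
    unfolding l_def has_integral_restrict_UNIV I_def .
qed

text \<open>
The coarea formula applied to the indicator function of a single level: the right-hand side is
an integral over \<open>t\<close> of a function supported at one point, so \<open>f' = 0\<close> almost everywhere on the level.
But \<open>f'\<close> has only finitely many zeros in the band.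
\<close>

lemma negligible_level:
  assumes t: "t \<in> {a..b}"
  shows "negligible (level t)"
proof -
  let ?h = "indicator (level t) :: complex \<Rightarrow> ennreal"
  have h: "?h \<in> borel_measurable borel" by simp
  have "(\<integral>\<^sup>+z\<in>band. ?h z * ennreal (norm (deriv f z)) \<partial>lborel)
      = (\<integral>\<^sup>+s\<in>{a..b}. (\<integral>\<^sup>+z\<in>level s. ?h z \<partial>arc_length) \<partial>lborel)"
    by (rule band_coarea(2)[OF h, symmetric])
  also have "\<dots> = (\<integral>\<^sup>+s. 0 \<partial>(lborel :: real measure))"
  proof (rule nn_integral_cong_AE)
    show "AE s in lborel. (\<integral>\<^sup>+z\<in>level s. ?h z \<partial>arc_length) * indicator {a..b} s = 0"
      using AE_lborel_singleton[of t]
    proof (rule eventually_mono)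
      fix s assume "s \<noteq> t"
      then have "level s \<inter> level t = {}" by (auto simp: level_set_def)
      then have "(\<integral>\<^sup>+z\<in>level s. ?h z \<partial>arc_length) = (\<integral>\<^sup>+z. 0 \<partial>arc_length)"
        by (intro nn_integral_cong) (auto simp: indicator_def)
      then show "(\<integral>\<^sup>+z\<in>level s. ?h z \<partial>arc_length) * indicator {a..b} s = 0" by simp
    qed
  qed
  finally have z: "(\<integral>\<^sup>+z\<in>band. ?h z * ennreal (norm (deriv f z)) \<partial>lborel) = 0" by simp
  define df where "df = (\<lambda>z. indicator \<Omega> z *\<^sub>R deriv f z)"
  have mdf [measurable]: "df \<in> borel_measurable borel" unfolding df_def
    by (rule deriv_f_measurable)
  have "(\<integral>\<^sup>+z. ?h z * ennreal (norm (df z)) \<partial>lborel) = 0"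
    using z level_subset_band[OF t] band_subset
    by (subst (asm) nn_integral_cong[where v="\<lambda>z. ?h z * ennreal (norm (df z))"]) (auto simp: indicator_def df_def)
  then have "AE z in lborel. ?h z * ennreal (norm (df z)) = 0"
    by (subst (asm) nn_integral_0_iff_AE) auto
  then have "AE z in lborel. z \<notin> level t"
    using AE_lborel_not_band_crit
  proof eventually_elim
    case (elim z)
    show ?case
    proof
      assume zt: "z \<in> level t"
      then have "z \<in> band" "z \<in> \<Omega>" using level_subset_band[OF t] band_subset by auto
      then have "deriv f z \<noteq> 0" using elim(2) by (auto simp: critical_points_def)
      then show False using elim(1) zt \<open>z \<in> \<Omega>\<close> by (simp add: df_def)
    qed
  qed
  then have "level t \<in> null_sets lborel"
    by (simp add: AE_iff_null_sets)
  then show ?thesis by (simp add: negligible_iff_null_sets null_sets_completionI)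
qed

lemma negligible_frontier_band: "negligible (frontier band)"
proof (rule negligible_subset)
  show "negligible (level a \<union> level b)"
    using a_less_b by (intro negligible_Un negligible_level) auto
  have "open {z \<in> \<Omega>. norm (f z) \<in> {a<..<b}}"
    using continuous_open_preimage[OF continuous_on_norm[OF continuous_f] open_domain open_greaterThanLessThan[of a b]]
    by (simp add: vimage_def Int_def)
  then have "{z \<in> \<Omega>. norm (f z) \<in> {a<..<b}} \<subseteq> interior band"
    by (intro interior_maximal) (auto simp: level_band_def)
  moreover have "frontier band = band - interior band"
    using compact_imp_closed[OF compact_band] by (simp add: frontier_def)
  ultimately show "frontier band \<subseteq> level a \<union> level b"
    by (auto simp: level_band_def level_set_def subset_eq)
qed

lemma ex_jordan_exhaustion: "\<exists>K. jordan_exhaustion band crit K"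
proof -
  define Z where "Z = band \<inter> crit"
  have Z: "finite Z" unfolding Z_def by (rule finite_band_crit)
  define O' where "O' = (\<lambda>n::nat. \<Union>c\<in>Z. ball c (inverse (real (Suc n))))"
  define K where "K = (\<lambda>n. band - O' n)"
  have "incseq K"
  proof (rule incseq_SucI)
    fix n
    have "inverse (real (Suc (Suc n))) \<le> inverse (real (Suc n))" by (intro le_imp_inverse_le) auto
    then have "O' (Suc n) \<subseteq> O' n" unfolding O'_def by (intro UN_mono subset_ball) auto
    then show "K n \<subseteq> K (Suc n)" by (auto simp: K_def)
  qed
  moreover have "closed (K n)" for n
    unfolding K_def O'_def by (intro closed_Diff compact_imp_closed[OF compact_band] open_UN) auto
  moreover have "jordan_measurable (K n)" for n
    unfolding jordan_measurable_def
  proof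
    show "bounded (K n)" unfolding K_def using compact_imp_bounded[OF compact_band] bounded_diff by blast
    have "frontier (K n) \<subseteq> frontier band \<union> frontier (- O' n)"
      unfolding K_def Diff_eq by (rule frontier_Int_subset)
    also have "frontier (- O' n) = frontier (O' n)" by (simp add: frontier_complement)
    also have "frontier (O' n) \<subseteq> (\<Union>t\<in>(\<lambda>c. ball c (inverse (real (Suc n)))) ` Z. frontier t)"
      unfolding O'_def using Z by (intro frontier_Union_subset) auto
    finally have "frontier (K n) \<subseteq> frontier band \<union> (\<Union>t\<in>(\<lambda>c. ball c (inverse (real (Suc n)))) ` Z. frontier t)" by blast
    moreover have "negligible (frontier band \<union> (\<Union>t\<in>(\<lambda>c. ball c (inverse (real (Suc n)))) ` Z. frontier t))"
      using Z negligible_frontier_band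
      by (intro negligible_Un negligible_Union) (auto intro: negligible_convex_frontier)
    ultimately show "negligible (frontier (K n))" using negligible_subset by blast
  qed
  moreover have "(\<Union>n. K n) = band - crit"
  proof
    show "(\<Union>n. K n) \<subseteq> band - crit"
      by (force simp: K_def O'_def Z_def)
    show "band - crit \<subseteq> (\<Union>n. K n)"
    proof
      fix z assume z: "z \<in> band - crit"
      have "z \<notin> Z" using z by (auto simp: Z_def)
      obtain d where d: "0 < d" "\<And>c. c \<in> Z \<Longrightarrow> c \<noteq> z \<Longrightarrow> d \<le> dist z c"
        using finite_set_avoid[OF Z, of z] by blast
      obtain n where n: "inverse (real (Suc n)) < d" using reals_Archimedean[OF d(1)] by blast
      have "z \<notin> O' n"
      proof
        assume "z \<in> O' n"
        then obtain c where "c \<in> Z" "dist c z < inverse (real (Suc n))" by (auto simp: O'_def)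
        then show False using d(2)[of c] n \<open>z \<notin> Z\<close> by (auto simp: dist_commute)
      qed
      then show "z \<in> (\<Union>n. K n)" using z by (auto simp: K_def)
    qed
  qed
  ultimately show ?thesis unfolding jordan_exhaustion_def by blast
qed

text \<open>
By absolute integrability, the integrals over any increasing exhaustion converge to
the Lebesgue integral.
\<close>

lemma curvature_area_integral:
  "has_area_integral (signed_curvature f) band crit (LINT z:(band - crit)|lborel. curvature_formula f z)"
proof -
  let ?I = "LINT z:(band - crit)|lborel. curvature_formula f z"
  have eq: "signed_curvature f z = curvature_formula f z" if "z \<in> band - crit" for z
    using that band_subset by (intro signed_curvature_eq_formula[OF open_domain holo]) auto
  show ?thesis
  proof (cases "band \<inter> crit = {}")
    case True
    then have bc: "band - crit = band" by blast
    have "(curvature_formula f has_integral ?I) band"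
      using set_borel_integral_eq_integral[OF curvature_integrable] unfolding bc by (simp add: has_integral_iff)
    then have "(signed_curvature f has_integral ?I) band"
      by (rule has_integral_eq[rotated]) (use eq bc in auto)
    then show ?thesis using True by (simp add: has_area_integral_def)
  next
    case False
    have "(\<forall>n. signed_curvature f integrable_on K n) \<and> (\<lambda>n. integral (K n) (signed_curvature f)) \<longlonglongrightarrow> ?I"
      if K: "jordan_exhaustion band crit K" for K
    proof -
      have inc: "incseq K" and cl: "\<And>n. closed (K n)" and U: "(\<Union>n. K n) = band - crit"
        using K by (auto simp: jordan_exhaustion_def)
      have sub: "K n \<subseteq> band - crit" for n using U by blast
      have si: "set_integrable lborel (K n) (curvature_formula f)" for n
        by (rule set_integrable_subset[OF curvature_integrable]) (use cl sub in auto)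
      have i: "curvature_formula f integrable_on K n"
        "(LINT z:K n|lborel. curvature_formula f z) = integral (K n) (curvature_formula f)" for n
        using set_borel_integral_eq_integral[OF si] by auto
      have "signed_curvature f integrable_on K n" for n
        by (rule integrable_eq[OF i(1)]) (use sub eq in force)
      moreover have e: "integral (K n) (signed_curvature f) = (LINT z:K n|lborel. curvature_formula f z)" for n
        unfolding i(2) by (rule Henstock_Kurzweil_Integration.integral_cong) (use sub eq in blast)
      moreover have "(\<lambda>n. LINT z:K n|lborel. curvature_formula f z) \<longlonglongrightarrow> (LINT z:(\<Union>n. K n)|lborel. curvature_formula f z)"
        by (rule set_integral_cont_up) (use cl inc curvature_integrable U in auto)
      ultimately show ?thesis by (simp add: U)
    qed
    then show ?thesis using False ex_jordan_exhaustion by (simp add: has_area_integral_def)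
  qed
qed

end

theorem theorem3:
  fixes f :: "complex \<Rightarrow> complex" and \<Omega> :: "complex set" and a b :: real
  assumes "open \<Omega>" and "connected \<Omega>"
    and "f holomorphic_on \<Omega>" and "\<not> f constant_on \<Omega>"
    and "a < b"
    and "\<exists>z\<in>\<Omega>. norm (f z) = a" and "\<exists>z\<in>\<Omega>. norm (f z) = b"
    and "compact (level_band f \<Omega> a b)"
  shows
    "(finite {t \<in> {a..b}. \<not> regular_level f \<Omega> t} \<and>
      (\<forall>t\<in>{a..b}. regular_level f \<Omega> t \<longrightarrow>
         set_integrable arc_length (level_set f \<Omega> t) (\<lambda>z. 1 / norm (deriv f z))) \<and>
      ((\<lambda>t. LINT z:level_set f \<Omega> t|arc_length. 1 / norm (deriv f z))
         has_integral measure lebesgue (level_band f \<Omega> a b)) {t \<in> {a..b}. regular_level f \<Omega> t})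
     \<and>
     ((\<forall>t\<in>{a..b}. emeasure arc_length (level_set f \<Omega> t) < \<infinity>) \<and>
      (\<exists>I. (level_length f \<Omega> has_integral I) {a..b} \<and>
           ((\<lambda>z. norm (deriv f z)) has_integral I) (level_band f \<Omega> a b)))
     \<and>
     (finite (level_band f \<Omega> a b \<inter> critical_points f \<Omega>) \<and>
      (\<exists>I. has_area_integral (signed_curvature f) (level_band f \<Omega> a b) (critical_points f \<Omega>) I \<and>
           level_length f \<Omega> b = level_length f \<Omega> a + I))"
proof -
  interpret analytic_band f \<Omega> a b
    by unfold_locales (use assms in auto)
  show ?thesis
    using finite_critical_levels regular_level_set_integrable area_formula
      finite_length_and_total_curvature coarea_length finite_band_crit curvature_area_integral
    by (intro conjI ballI impI exI[of _ "LINT z:level_band f \<Omega> a b|lborel. norm (deriv f z)"]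
        exI[of _ "LINT z:(level_band f \<Omega> a b - critical_points f \<Omega>)|lborel. curvature_formula f z"]) auto
qed

end
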